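(* For all fixed integers $\ell\ge 2$ and $t\ge 1$ there is a constant $C_{\ell,t}>0$ such that every $n$-vertex graph $H$ with simple treewidth at most $t$ (and $n$ sufficiently large) satisfies $\chi_\ell(H)\le C_{\ell,t}\cdot \log n/\log^{(t)} n$. Moreover this is asymptotically optimal: for every fixed integer $t\ge 1$ there is a constant $c_t>0$ such that for infinitely many values of $n$ there exists an $n$-vertex graph $H$ of simple treewidth $t$ with $\chi_2(H)\ge c_t\cdot \log n/\log^{(t)} n$.
   Context: A colouring $\varphi:V(G)\to\mathbb{N}$ of a graph $G$ is an $\ell$-ranking if for every non-trivial path $u_0,\ldots,u_p$ in $G$ of length $p\le \ell$, either $\varphi(u_0)\neq\varphi(u_p)$ or $\varphi(u_0)<\max\{\varphi(u_0),\ldots,\varphi(u_p)\}$; $\chi_\ell(G)$ is the minimum $k$ such that $G$ has an $\ell$-ranking with colours in $\{1,\ldots,k\}$. $\log$ is the natural logarithm, $\log^{(0)}x=x$, $\log^{(i)}x=\log(\log^{(i-1)}x)$. A tree decomposition $(B_x:x\in V(T))$ of a graph $H$ (bags $B_x\subseteq V(H)$ indexed by nodes of a tree $T$, such that each vertex's bags induce a connected subtree and each edge lies in some bag) has width $\max_x|B_x|-1$. It is $t$-simple if it has width $t$ and every $t$-element subset $S\subseteq V(H)$ satisfies $|\{x\in V(T):S\subseteq B_x\}|\le 2$. The simple treewidth of $H$ is the minimum $t$ such that $H$ has a $t$-simple tree decomposition. *)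

theory Defs
  imports Complex_Main "Graph_Theory.Graph_Theory"
begin

text \<open>
  Finite simple undirected graphs are the symmetric, loop-free, finite pair digraphs
  (locale \<^locale>\<open>pair_graph\<close>): an edge is represented by its two orientations.
\<close>

definition is_ranking :: "nat \<Rightarrow> 'a pair_pre_digraph \<Rightarrow> ('a \<Rightarrow> nat) \<Rightarrow> bool" where
  "is_ranking l G \<phi> \<longleftrightarrow>
     (\<forall>us. vpath us (with_proj G) \<and> 1 \<le> vwalk_length us \<and> vwalk_length us \<le> l \<longrightarrow>
        \<phi> (hd us) \<noteq> \<phi> (last us) \<or> \<phi> (hd us) < Max (\<phi> ` set us))"

definition ranking_number :: "nat \<Rightarrow> 'a pair_pre_digraph \<Rightarrow> nat" where
  "ranking_number l G = (LEAST k. \<exists>\<phi>. is_ranking l G \<phi> \<and> \<phi> ` pverts G \<subseteq> {1..k})"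

text \<open>
  The library's \<^const>\<open>tree\<close> is not usable for symmetric digraphs, because it counts the
  closed walk a, b, a along a single edge as a cycle. In a loop-free symmetric pair digraph,
  the directed cycles of length at least 3 are exactly the oriented cycles of the
  undirected graph.
\<close>

definition undirected_tree :: "'a pair_pre_digraph \<Rightarrow> bool" where
  "undirected_tree T \<longleftrightarrow>
     pair_graph T \<and> connected (with_proj T) \<and>
     \<not> (\<exists>p. pre_digraph.cycle (with_proj T) p \<and> 3 \<le> length p)"

text \<open>
  Note that \<^const>\<open>connected\<close> includes nonemptiness, so every vertex lies in some bag.
\<close>

definition tree_decomposition ::
    "'a pair_pre_digraph \<Rightarrow> 'b pair_pre_digraph \<Rightarrow> ('b \<Rightarrow> 'a set) \<Rightarrow> bool" where
  "tree_decomposition G T B \<longleftrightarrow>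
     undirected_tree T \<and>
     (\<forall>x \<in> pverts T. B x \<subseteq> pverts G) \<and>
     (\<forall>v \<in> pverts G. connected (with_proj T \<restriction> {x \<in> pverts T. v \<in> B x})) \<and>
     (\<forall>(u, v) \<in> parcs G. \<exists>x \<in> pverts T. u \<in> B x \<and> v \<in> B x)"

definition decomposition_width :: "'b pair_pre_digraph \<Rightarrow> ('b \<Rightarrow> 'a set) \<Rightarrow> int" where
  "decomposition_width T B = int (Max ((\<lambda>x. card (B x)) ` pverts T)) - 1"

definition simple_tree_decomposition ::
    "nat \<Rightarrow> 'a pair_pre_digraph \<Rightarrow> 'b pair_pre_digraph \<Rightarrow> ('b \<Rightarrow> 'a set) \<Rightarrow> bool" where
  "simple_tree_decomposition t G T B \<longleftrightarrow>
     tree_decomposition G T B \<and>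
     decomposition_width T B = int t \<and>
     (\<forall>S. S \<subseteq> pverts G \<and> card S = t \<longrightarrow> card {x \<in> pverts T. S \<subseteq> B x} \<le> 2)"

text \<open>
  Trees being finite, taking natural numbers as nodes of the decomposition tree loses no
  generality. Every nonempty finite graph has a one-bag decomposition that is t-simple for
  t + 1 the number of vertices, so the minimum exists.
\<close>

definition simple_treewidth :: "'a pair_pre_digraph \<Rightarrow> nat" where
  "simple_treewidth G =
     (LEAST t. \<exists>(T :: nat pair_pre_digraph) B. simple_tree_decomposition t G T B)"

end

theory Submission
  imports Defs
begin

text \<open>
  Filling the bags of a \<open>t\<close>-simple tree decomposition yields a chordal graph in which every vertex
  \<open>v\<close> has a clique \<open>N v\<close> of at most \<open>t\<close> earlier neighbours, and essentially no \<open>t\<close>-set occurs twice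
  as \<open>N v\<close>. Breadth-first layers of such a graph belong to the class for \<open>t - 1\<close>.

  Upper bound: let \<open>n v\<close> be the number of descendants of \<open>v\<close>. A vertex is \<^emph>\<open>high\<close> if some component
  hanging below it in the next layer carries more than a \<open>1/k\<close> fraction of the weight found \<open>l\<close>
  layers further up. Only \<open>O(k)\<close> high vertices of a layer are close to each other, so one global
  palette of \<open>O(k)\<close> colours serves all of them. The remaining vertices are ranked first by a level
  that strictly drops from each layer to the next and takes \<open>O(log n / log k)\<close> values. Vertices of
  equal level in one layer form graphs for \<open>t - 1\<close> of weight at most \<open>k\<close>, to which induction applies.
  The choice \<open>k = \<surd>(ln n)\<close> gives the bound.

  Lower bound: if \<open>G\<close> in the class for \<open>t\<close> admits no 2-ranking with \<open>d\<close> colours, join every vertex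
  to \<open>k + 1\<close> copies of \<open>G\<close>. In a 2-ranking with \<open>k\<close> colours one of the copies lies below the
  colour of the vertex, hence contains a colour smaller by more than \<open>d\<close>; after \<open>k/(d + 1)\<close> rounds
  the colours are exhausted. That the simple treewidth is exactly \<open>t\<close> follows from the upper bound
  for \<open>t - 1\<close>.
\<close>

section \<open>Elimination orderings and their layers\<close>

text \<open>Write \<open>T t m\<close> for the number of colours needed at weight \<open>m\<close>.
  The upper bound solves \<open>T (t + 1) m \<le> O(ln m / ln k) * T t k + O(k)\<close>. If
  \<open>T t k\<close> is about \<open>ln k / (ln ^^ t) k\<close>, the factor \<open>ln k\<close>
  cancels. A power of \<open>ln m\<close> as \<open>k\<close> makes \<open>(ln ^^ t) k\<close>
  comparable to \<open>(ln ^^ (t + 1)) m\<close>, and an exponent below one keeps the summand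
  \<open>k\<close> small.

  Cardinalities cannot drive this induction: vertices of equal layer and level may be numerous even
  in one component, but in each component their weights agree up to a factor \<open>k\<close> and
  can be rescaled to lie between 1 and \<open>k\<close>. The obstacle is a short path that leaves
  such a set and returns to it; the levels are built so that a path on which its end colours are
  maximal can be shortcut into the set.

  The lower bound runs the recursion backwards. The graph for \<open>d\<close> colours should have
  at most \<open>k\<close> vertices, which allows \<open>d\<close> of order
  \<open>ln k / (ln ^^ t) k\<close>. Each of about \<open>k / d\<close> rounds then multiplies the
  order by at most a power of \<open>k\<close>, and \<open>ln k\<close> cancels again.\<close>

locale elimination =
  fixes V :: "'a set" and N :: "'a \<Rightarrow> 'a set" and e :: "'a \<Rightarrow> nat"
  assumes finite_V: "finite V"
    and N_subset: "v \<in> V \<Longrightarrow> N v \<subseteq> V"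
    and N_less: "v \<in> V \<Longrightarrow> u \<in> N v \<Longrightarrow> e u < e v"
    and N_clique: "v \<in> V \<Longrightarrow> u \<in> N v \<Longrightarrow> w \<in> N v \<Longrightarrow> u \<noteq> w \<Longrightarrow> u \<in> N w \<or> w \<in> N u"

definition elim_rel :: "'a set \<Rightarrow> ('a \<Rightarrow> 'a set) \<Rightarrow> 'a rel" where
  "elim_rel V N = {(x, y). y \<in> V \<and> x \<in> N y}"

definition ancestor :: "'a set \<Rightarrow> ('a \<Rightarrow> 'a set) \<Rightarrow> 'a \<Rightarrow> 'a \<Rightarrow> bool" where
  "ancestor V N u v \<longleftrightarrow> (u, v) \<in> (elim_rel V N)\<^sup>*"

text \<open>Every \<open>t\<close>-set \<open>S\<close> lies in at most two bags \<open>insert v (N v)\<close>, one of which belongs to the last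
  vertex \<open>s\<close> of \<open>S\<close>. If \<open>card (N s) < t\<close>, the bag of \<open>s\<close> is \<open>S\<close> itself; it may be missing from the tree
  decomposition, and then two further vertices can have \<open>S\<close> as their set of neighbours.\<close>

definition simple_elimination :: "nat \<Rightarrow> 'a set \<Rightarrow> ('a \<Rightarrow> 'a set) \<Rightarrow> bool" where
  "simple_elimination t V N \<longleftrightarrow>
     (\<forall>v\<in>V. card (N v) \<le> t) \<and>
     (\<forall>s\<in>V. \<forall>S\<subseteq>V. card S = t \<and> s \<in> S \<and> S - {s} \<subseteq> N s \<longrightarrow>
        card {v \<in> V. N v = S} \<le> (if card (N s) < t then 2 else 1))"

text \<open>Stated for antichains instead of children, so that rescaling on a set that is convex for the
  ancestor relation preserves it.\<close>

definition tree_weight :: "'a set \<Rightarrow> ('a \<Rightarrow> 'a set) \<Rightarrow> ('a \<Rightarrow> real) \<Rightarrow> bool" where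
  "tree_weight V N n \<longleftrightarrow>
     (\<forall>v\<in>V. 1 \<le> n v) \<and>
     (\<forall>a\<in>V. \<forall>A\<subseteq>V. (\<forall>x\<in>A. ancestor V N a x) \<and>
        (\<forall>x\<in>A. \<forall>y\<in>A. ancestor V N x y \<longrightarrow> x = y) \<longrightarrow> sum n A \<le> n a)"

definition adjacent :: "('a \<Rightarrow> 'a set) \<Rightarrow> 'a \<Rightarrow> 'a \<Rightarrow> bool" where
  "adjacent N u v \<longleftrightarrow> u \<in> N v \<or> v \<in> N u"

text \<open>Walks instead of paths make the notion stronger and allow cutting and splicing without
  care for distinctness. The ends are required to differ, since a closed walk has equal end colours
  trivially; \<open>Suc l\<close> vertices mean \<open>l\<close> edges.\<close>

definition walk_ranking :: "nat \<Rightarrow> 'a set \<Rightarrow> ('a \<Rightarrow> 'a set) \<Rightarrow> ('a \<Rightarrow> nat) \<Rightarrow> bool" where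
  "walk_ranking l V N \<phi> \<longleftrightarrow>
     (\<forall>us. us \<noteq> [] \<and> set us \<subseteq> V \<and> successively (adjacent N) us \<and> length us \<le> Suc l \<and>
        hd us \<noteq> last us \<and> \<phi> (hd us) = \<phi> (last us) \<longrightarrow> (\<exists>z\<in>set us. \<phi> (hd us) < \<phi> z))"

lemma walk_rankingD:
  assumes "walk_ranking l V N \<phi>" "us \<noteq> []" "set us \<subseteq> V" "successively (adjacent N) us"
    "length us \<le> Suc l" "hd us \<noteq> last us" "\<phi> (hd us) = \<phi> (last us)"
  shows "\<exists>z\<in>set us. \<phi> (hd us) < \<phi> z"
  using assms unfolding walk_ranking_def by blast

lemma finite_inj_index: "finite A \<Longrightarrow> card A \<le> M \<Longrightarrow> \<exists>f::'a \<Rightarrow> nat. inj_on f A \<and> f ` A \<subseteq> {..<M}"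
  by (metis atLeast0LessThan ex_bij_betw_finite_nat bij_betw_def ivl_subset order_refl zero_le)

text \<open>A pair of colours is encoded as the two-digit number \<open>a * c + b\<close> with
  \<open>b < c\<close>, so that the leading digit dominates every comparison.\<close>

lemma digit_less: "a < M \<Longrightarrow> b < c \<Longrightarrow> a * c + b < M * (c::nat)"
  using mult_le_mono1[of "Suc a" M c] by simp

lemma digit_inject:
  assumes "a * c + b = a' * c + b'" "b < c" "b' < (c::nat)" shows "a = a'" "b = b'"
proof -
  have "(a * c + b) div c = a" "(a' * c + b') div c = a'" "(a * c + b) mod c = b" "(a' * c + b') mod c = b'"
    using assms(2,3) by auto
  then show "a = a'" "b = b'" using assms(1) by metis+
qed

context elimination
begin

section \<open>The ancestor order is a forest\<close>

abbreviation anc :: "'a \<Rightarrow> 'a \<Rightarrow> bool" where "anc \<equiv> ancestor V N"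

lemma anc_refl [simp, intro]: "anc v v"
  by (simp add: ancestor_def)

lemma anc_trans [trans]: "anc u v \<Longrightarrow> anc v w \<Longrightarrow> anc u w"
  unfolding ancestor_def by (rule rtrancl_trans)

lemma anc_N: "v \<in> V \<Longrightarrow> u \<in> N v \<Longrightarrow> anc u v"
  unfolding ancestor_def elim_rel_def by auto

lemma anc_induct [consumes 1, case_names refl step]:
  assumes "anc u v" "P u" "\<And>w v. anc u w \<Longrightarrow> P w \<Longrightarrow> v \<in> V \<Longrightarrow> w \<in> N v \<Longrightarrow> P v"
  shows "P v"
  using assms(1)[unfolded ancestor_def]
proof (induction rule: rtrancl_induct)
  case (step y z)
  then show ?case using assms(3)[of y z] by (simp add: ancestor_def elim_rel_def)
qed (rule assms(2))

lemma anc_cases: "anc u v \<Longrightarrow> u = v \<or> (v \<in> V \<and> (\<exists>w\<in>N v. anc u w))"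
  unfolding ancestor_def by (erule rtranclE) (auto simp: elim_rel_def)

lemma N_in_V: "v \<in> V \<Longrightarrow> u \<in> N v \<Longrightarrow> u \<in> V"
  using N_subset by blast

lemma anc_in_V: assumes "anc u v" "v \<in> V" shows "u \<in> V"
proof -
  have "v \<in> V \<longrightarrow> u \<in> V"
    using assms(1) by (induction rule: anc_induct) (auto dest: N_in_V)
  then show ?thesis using assms by blast
qed

lemma anc_less: "anc u v \<Longrightarrow> u = v \<or> e u < e v"
  by (induction rule: anc_induct) (auto dest: N_less)

lemma anc_antisym: "anc u v \<Longrightarrow> anc v u \<Longrightarrow> u = v"
  using anc_less[of u v] anc_less[of v u] by auto

text \<open>Both ancestors reach \<open>v\<close> through the clique \<open>N v\<close>. The two
  entry points are equal or adjacent, so the later one has \<open>u\<close> and \<open>u'\<close>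
  among its ancestors, and induction on \<open>e\<close> applies to it.\<close>

lemma anc_chain: "v \<in> V \<Longrightarrow> anc u v \<Longrightarrow> anc u' v \<Longrightarrow> anc u u' \<or> anc u' u"
proof (induction "e v" arbitrary: v rule: less_induct)
  case less
  show ?case
  proof (cases "u = v \<or> u' = v")
    case False
    then obtain w w' where w: "w \<in> N v" "anc u w" "w' \<in> N v" "anc u' w'"
      using anc_cases less.prems by metis
    have V: "w \<in> V" "w' \<in> V" using w N_in_V less.prems by auto
    consider "w = w'" | "w \<in> N w'" | "w' \<in> N w" using N_clique w less.prems by metis
    then obtain z where z: "z \<in> N v" "anc u z" "anc u' z"
    proof cases
      case 2
      then have "anc u w'" using w V anc_N anc_trans by metis
      then show ?thesis using that w by blast
    next
      case 3
      then have "anc u' w" using w V anc_N anc_trans by metis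
      then show ?thesis using that w by blast
    qed (use w that in blast)
    then show ?thesis using less.hyps[OF N_less[OF less.prems(1) z(1)] N_in_V[OF less.prems(1) z(1)]] by blast
  qed (use less in auto)
qed

section \<open>Breadth-first layers\<close>

definition layer :: "'a \<Rightarrow> nat" where
  "layer v = (LEAST j. \<exists>r\<in>V. N r = {} \<and> (r, v) \<in> (elim_rel V N) ^^ j)"

lemma layer_exists: "v \<in> V \<Longrightarrow> \<exists>j. \<exists>r\<in>V. N r = {} \<and> (r, v) \<in> (elim_rel V N) ^^ j"
proof (induction "e v" arbitrary: v rule: less_induct)
  case less
  show ?case
  proof (cases "N v = {}")
    case True
    then show ?thesis using less.prems by (intro exI[of _ 0] bexI[of _ v]) auto
  next
    case False
    then obtain u where u: "u \<in> N v" by blast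
    then obtain j r where "r \<in> V" "N r = {}" "(r, u) \<in> (elim_rel V N) ^^ j"
      using less.hyps[of u] less.prems N_less N_in_V by blast
    moreover have "(u, v) \<in> elim_rel V N" using u less.prems by (simp add: elim_rel_def)
    ultimately show ?thesis using relpow_Suc_I[of r u j "elim_rel V N" v] by blast
  qed
qed

lemma layer_witness:
  "v \<in> V \<Longrightarrow> \<exists>r\<in>V. N r = {} \<and> (r, v) \<in> (elim_rel V N) ^^ layer v"
  unfolding layer_def by (rule LeastI_ex) (rule layer_exists)

lemma layer_le: "r \<in> V \<Longrightarrow> N r = {} \<Longrightarrow> (r, v) \<in> (elim_rel V N) ^^ j \<Longrightarrow> layer v \<le> j"
  unfolding layer_def by (rule Least_le) blast

lemma layer_le_Suc:
  assumes "v \<in> V" "u \<in> N v" shows "layer v \<le> Suc (layer u)"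
proof -
  obtain r where "r \<in> V" "N r = {}" "(r, u) \<in> (elim_rel V N) ^^ layer u"
    using layer_witness N_in_V assms by blast
  moreover have "(u, v) \<in> elim_rel V N" using assms by (simp add: elim_rel_def)
  ultimately show ?thesis using relpow_Suc_I[of r u "layer u" "elim_rel V N" v] layer_le[of r v "Suc (layer u)"] by blast
qed

lemma layer_root: "v \<in> V \<Longrightarrow> N v = {} \<Longrightarrow> layer v = 0"
  using layer_le[of v v 0] by auto

lemma layer_pred:
  assumes "v \<in> V" "N v \<noteq> {}" shows "\<exists>u\<in>N v. layer v = Suc (layer u)"
proof -
  obtain r where r: "r \<in> V" "N r = {}" "(r, v) \<in> (elim_rel V N) ^^ layer v"
    using layer_witness assms by blast
  show ?thesis
  proof (cases "layer v")
    case 0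
    then show ?thesis using r assms by auto
  next
    case (Suc j)
    then obtain u where u: "(r, u) \<in> (elim_rel V N) ^^ j" "u \<in> N v" using r by (auto simp: elim_rel_def)
    then have "layer u \<le> j" using r layer_le by blast
    moreover have "layer v \<le> Suc (layer u)" using layer_le_Suc u assms by blast
    ultimately show ?thesis using Suc u by (intro bexI[of _ u]) auto
  qed
qed

text \<open>Some \<open>w\<close> in \<open>N v\<close> lies exactly one layer before
  \<open>v\<close>. As \<open>u\<close> and \<open>w\<close> are in the clique \<open>N v\<close>,
  either \<open>u\<close> is at most one layer after \<open>w\<close>, or \<open>u\<close> is in
  \<open>N w\<close> and induction applies to \<open>w\<close>.\<close>

lemma layer_mono: "v \<in> V \<Longrightarrow> u \<in> N v \<Longrightarrow> layer u \<le> layer v"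
proof (induction "e v" arbitrary: v rule: less_induct)
  case less
  then obtain w where w: "w \<in> N v" "layer v = Suc (layer w)" using layer_pred[of v] by blast
  have V: "u \<in> V" "w \<in> V" using less.prems w N_in_V by auto
  consider "u = w" | "w \<in> N u" | "u \<in> N w" using N_clique less.prems w by blast
  then show ?case
  proof cases
    case 2 then show ?thesis using layer_le_Suc[of u w] V w by auto
  next
    case 3 then show ?thesis using less.hyps[of w] less.prems w V N_less[of v w] by simp
  qed (use w in auto)
qed

lemma layer_anc: "anc u v \<Longrightarrow> layer u \<le> layer v"
  by (induction rule: anc_induct) (auto dest: layer_mono)

lemma layer_anc_exists: "v \<in> V \<Longrightarrow> j \<le> layer v \<Longrightarrow> \<exists>u. anc u v \<and> layer u = j"
proof (induction "e v" arbitrary: v rule: less_induct)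
  case less
  show ?case
  proof (cases "j = layer v")
    case False
    then have "layer v \<noteq> 0" using less.prems by auto
    then have "N v \<noteq> {}" using layer_root[OF less.prems(1)] by auto
    then obtain u where u: "u \<in> N v" "layer v = Suc (layer u)" using less.prems layer_pred by blast
    then have "j \<le> layer u" using less.prems False by auto
    then obtain w where "anc w u" "layer w = j"
      using less.hyps[OF N_less[OF less.prems(1) u(1)] N_in_V[OF less.prems(1) u(1)]] by blast
    then show ?thesis using anc_N[OF less.prems(1) u(1)] anc_trans by blast
  qed auto
qed

section \<open>Components of the graph from a given layer on\<close>

definition top :: "nat \<Rightarrow> 'a \<Rightarrow> 'a" where
  "top j v = arg_min e (\<lambda>u. anc u v \<and> layer u = j)"

text \<open>The ancestors of \<open>v\<close> form a chain, so the earliest one in layer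
  \<open>j\<close> is an ancestor of all others in that layer. Hence \<open>top j v\<close> is a
  canonical name for the component of \<open>v\<close> among the layers from \<open>j\<close>
  on.\<close>

lemma top_props:
  assumes "v \<in> V" "j \<le> layer v"
  shows "anc (top j v) v" "layer (top j v) = j"
    "anc u v \<Longrightarrow> layer u = j \<Longrightarrow> anc (top j v) u"
proof -
  obtain w where w: "anc w v \<and> layer w = j" using layer_anc_exists assms by blast
  have a: "(anc (top j v) v \<and> layer (top j v) = j) \<and> (\<forall>y. anc y v \<and> layer y = j \<longrightarrow> e (top j v) \<le> e y)"
    unfolding top_def by (rule arg_min_nat_lemma[where P="\<lambda>u. anc u v \<and> layer u = j", OF w])
  then show "anc (top j v) v" "layer (top j v) = j" by auto
  assume u: "anc u v" "layer u = j"
  then have "anc u (top j v) \<or> anc (top j v) u" using anc_chain assms a by blast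
  then show "anc (top j v) u" using a u anc_less[of u "top j v"] by force
qed

lemma top_eq:
  assumes "v \<in> V" "anc u v" "j \<le> layer u"
  shows "top j u = top j v"
proof (rule anc_antisym)
  have u: "u \<in> V" using anc_in_V assms by blast
  have j: "j \<le> layer v" using assms layer_anc le_trans by blast
  note U = top_props[OF u assms(3)] and T = top_props[OF assms(1) j]
  have "anc (top j u) v" using U assms anc_trans by blast
  then show a: "anc (top j v) (top j u)" using T U by blast
  have "anc (top j v) u" using a U anc_trans by blast
  then show "anc (top j u) (top j v)" using U T by blast
qed

lemma adjacent_layer:
  assumes "u \<in> V" "v \<in> V" "adjacent N u v"
  shows "layer u \<le> Suc (layer v)" "layer v \<le> Suc (layer u)"
  using assms layer_mono[of v u] layer_mono[of u v] layer_le_Suc[of v u] layer_le_Suc[of u v]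
  unfolding adjacent_def by auto

lemma adjacent_top:
  assumes "u \<in> V" "v \<in> V" "adjacent N u v" "j \<le> layer u" "j \<le> layer v"
  shows "top j u = top j v"
  using assms top_eq[of u v j] top_eq[of v u j] anc_N[of u v] anc_N[of v u]
  unfolding adjacent_def by auto

lemma walk_layer:
  assumes "set us \<subseteq> V" "successively (adjacent N) us" "us \<noteq> []" "x \<in> set us"
  shows "layer (hd us) < layer x + length us \<and> layer x < layer (hd us) + length us"
  using assms
proof (induction us)
  case (Cons a us)
  show ?case
  proof (cases "x = a")
    case False
    then have ne: "us \<noteq> []" "x \<in> set us" using Cons by auto
    then have "adjacent N a (hd us)" "successively (adjacent N) us"
      using Cons.prems by (auto simp: successively_Cons)
    moreover have "hd us \<in> V" using ne Cons.prems by auto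
    ultimately show ?thesis using Cons ne adjacent_layer[of a "hd us"] by fastforce
  qed auto
qed simp

lemma walk_top:
  assumes "set us \<subseteq> V" "successively (adjacent N) us" "us \<noteq> []" "\<And>x. x \<in> set us \<Longrightarrow> j \<le> layer x"
    "x \<in> set us"
  shows "top j x = top j (hd us)"
  using assms
proof (induction us)
  case (Cons a us)
  show ?case
  proof (cases "x = a")
    case False
    then have ne: "us \<noteq> []" "x \<in> set us" using Cons by auto
    then have "adjacent N a (hd us)" "successively (adjacent N) us"
      using Cons.prems by (auto simp: successively_Cons)
    moreover have "hd us \<in> V" "hd us \<in> set us" using ne Cons.prems by auto
    ultimately show ?thesis using Cons ne adjacent_top[of a "hd us" j] by auto
  qed auto
qed simp

text \<open>Vertices at distance at most \<open>l\<close> in the same layer share their topmost ancestor \<open>l\<close> layers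
  further up.\<close>

lemma distance_colouring:
  assumes "A \<subseteq> V" and card: "\<And>i a. card {x \<in> A. layer x = i \<and> top (i - l) x = a} \<le> M"
  obtains \<psi> :: "'a \<Rightarrow> nat" where "\<And>x. x \<in> A \<Longrightarrow> \<psi> x < Suc l * M"
    "\<And>us. set us \<subseteq> V \<Longrightarrow> successively (adjacent N) us \<Longrightarrow> us \<noteq> [] \<Longrightarrow> length us \<le> Suc l \<Longrightarrow>
       hd us \<in> A \<Longrightarrow> last us \<in> A \<Longrightarrow> \<psi> (hd us) = \<psi> (last us) \<Longrightarrow> hd us = last us"
proof -
  define G where "G i a = {x \<in> A. layer x = i \<and> top (i - l) x = a}" for i a
  have fin: "finite (G i a)" for i a
    using finite_V assms(1) unfolding G_def by (simp add: finite_subset)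
  have "\<exists>f::'a \<Rightarrow> nat. inj_on f (G i a) \<and> f ` G i a \<subseteq> {..<M}" for i a
    using finite_inj_index[OF fin] card unfolding G_def by blast
  then obtain f :: "nat \<Rightarrow> 'a \<Rightarrow> 'a \<Rightarrow> nat" where f: "\<And>i a. inj_on (f i a) (G i a)" "\<And>i a. f i a ` G i a \<subseteq> {..<M}"
    by metis
  define idx where "idx x = f (layer x) (top (layer x - l) x) x" for x
  \<comment> \<open>A walk of at most \<open>l\<close> edges moves by at most \<open>l\<close>
    layers, so the residue modulo \<open>Suc l\<close> already tells different layers apart. The
    index separates vertices of the same layer and component.\<close>
  define \<psi> where "\<psi> x = idx x * Suc l + layer x mod Suc l" for x
  have inG: "x \<in> A \<Longrightarrow> x \<in> G (layer x) (top (layer x - l) x)" for x by (simp add: G_def)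
  have lt: "idx x < M" if "x \<in> A" for x using f(2) inG[OF that] unfolding idx_def by blast
  show thesis
  proof (rule that[of \<psi>])
    fix x assume "x \<in> A"
    then show "\<psi> x < Suc l * M"
      using digit_less[OF lt, of x "layer x mod Suc l" "Suc l"] unfolding \<psi>_def by (simp add: mult.commute)
  next
    fix us assume us: "set us \<subseteq> V" "successively (adjacent N) us" "us \<noteq> []" "length us \<le> Suc l"
      and A: "hd us \<in> A" "last us \<in> A" and eq: "\<psi> (hd us) = \<psi> (last us)"
    define i where "i = layer (hd us)"
    have d: "i < layer x + Suc l \<and> layer x < i + Suc l" if "x \<in> set us" for x
      using walk_layer[OF us(1-3) that] us(4) unfolding i_def by linarith
    have m: "i mod Suc l = layer (last us) mod Suc l" and ix: "idx (hd us) = idx (last us)"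
      using digit_inject[OF eq[unfolded \<psi>_def]] unfolding i_def by auto
    have dl: "i < layer (last us) + Suc l \<and> layer (last us) < i + Suc l" using d us(3) by simp
    have il: "layer (last us) = i"
    proof (rule ccontr)
      assume ne: "layer (last us) \<noteq> i"
      show False
      proof (cases "i < layer (last us)")
        case True
        then have "Suc l dvd layer (last us) - i" using m by (metis less_imp_le_nat mod_eq_dvd_iff_nat)
        then show False using True dl by (auto dest: dvd_imp_le)
      next
        case False
        then have "Suc l dvd i - layer (last us)" using m by (metis linorder_le_less_linear mod_eq_dvd_iff_nat)
        then show False using False ne dl by (auto dest: dvd_imp_le)
      qed
    qed
    \<comment> \<open>The walk never goes above layer \<open>i - l\<close>, so both ends lie in one
      component from that layer on. Truncation at 0 is harmless, as there is no earlier
      layer.\<close>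
    have "top (i - l) (last us) = top (i - l) (hd us)"
      by (rule walk_top[OF us(1-3)]) (use d us(3) in \<open>fastforce+\<close>)
    then have "hd us \<in> G i (top (i - l) (hd us))" "last us \<in> G i (top (i - l) (hd us))"
      "f i (top (i - l) (hd us)) (hd us) = f i (top (i - l) (hd us)) (last us)"
      using A il ix unfolding G_def idx_def by (auto simp: i_def)
    then show "hd us = last us" using f(1) by (meson inj_onD)
  qed
qed

section \<open>Weights, and the structure of a single layer\<close>

lemma weight_mono:
  assumes "tree_weight V N n" "anc u v" "v \<in> V" shows "n v \<le> n u"
proof -
  have "u \<in> V" using assms anc_in_V by blast
  then have "sum n {v} \<le> n u" using assms unfolding tree_weight_def by blast
  then show ?thesis by simp
qed


text \<open>The last vertex \<open>w\<close> before \<open>y\<close> on the way from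
  \<open>r\<close> shares the clique \<open>N y\<close> with \<open>x\<close>. As \<open>x\<close>
  is in an earlier layer, \<open>w \<in> N x\<close> is impossible, so \<open>x \<in> N w\<close>,
  and the argument repeats up to \<open>r\<close>. With \<open>r\<close> topmost, the parents of a
  whole component thus lie in the single small set \<open>N r\<close>.\<close>

lemma N_top:
  assumes "anc r y" "y \<in> V" "layer r = layer y" "x \<in> N y" "layer x < layer y"
  shows "x \<in> N r"
proof -
  have "y \<in> V \<and> layer r = layer y \<and> x \<in> N y \<longrightarrow> x \<in> N r"
    using assms(1)
  proof (induction rule: anc_induct)
    case (step w y)
    show ?case
    proof
      assume a: "y \<in> V \<and> layer r = layer y \<and> x \<in> N y"
      then have w: "layer w = layer y" "w \<in> V"
        using layer_anc[OF step(1)] layer_mono[OF step(2,3)] N_in_V[OF step(2,3)] by auto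
      have "x \<in> V" "x \<noteq> w" using a N_in_V w assms(3,5) by auto
      then have "x \<in> N w \<or> w \<in> N x" using N_clique[OF step(2) _ step(3)] a by blast
      then have "x \<in> N w" using layer_mono[OF \<open>x \<in> V\<close>, of w] w a assms(3,5) by auto
      then show "x \<in> N r" using step(4) w a by simp
    qed
  qed simp
  then show ?thesis using assms by blast
qed

text \<open>A vertex with a neighbour in \<open>N v \<inter> W\<close> also has one in the preceding
  layer, which costs one element of \<open>N v\<close>. If \<open>N v \<inter> W = S\<close> has
  size \<open>t\<close>, then \<open>N v\<close> is \<open>S\<close> with one such vertex
  \<open>a\<close> added, and \<open>a\<close> belongs to \<open>N s\<close> as well. Occurrences of
  \<open>S\<close> are therefore counted by those of the sets \<open>insert a S\<close> in the
  larger graph.\<close>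

lemma layer_simple:
  assumes "simple_elimination (Suc t) V N" "1 \<le> t" "W \<subseteq> V" "\<And>v. v \<in> W \<Longrightarrow> layer v = i"
  shows "simple_elimination t W (\<lambda>v. N v \<inter> W)"
proof -
  have cN: "card (N v) \<le> Suc t" if "v \<in> V" for v
    using assms(1) that unfolding simple_elimination_def by blast
  have finN: "finite (N v)" if "v \<in> V" for v
    using finite_subset[OF N_subset[OF that] finite_V] .
  have sub: "N v \<inter> W \<union> U \<subseteq> N v \<and> card (N v \<inter> W \<union> U) = card (N v \<inter> W) + card U"
    if v: "v \<in> W" and U: "U = {a \<in> N v. Suc (layer a) = i}" for v U
  proof -
    have fin: "finite (N v)" using finN[of v] v assms(3) by blast
    have "N v \<inter> W \<inter> U = {}"
    proof (rule ccontr)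
      assume "N v \<inter> W \<inter> U \<noteq> {}"
      then obtain a where "a \<in> W" "Suc (layer a) = i" using U by blast
      then show False using assms(4)[of a] by simp
    qed
    moreover have "finite U" using fin U by simp
    ultimately have "card (N v \<inter> W \<union> U) = card (N v \<inter> W) + card U"
      using fin by (intro card_Un_disjoint) auto
    then show ?thesis using U by blast
  qed
  have up: "N v \<inter> W = {} \<or> {a \<in> N v. Suc (layer a) = i} \<noteq> {}" if "v \<in> W" for v
  proof (cases "N v = {}")
    case False
    then show ?thesis using layer_pred[of v] that assms by auto
  qed auto
  have card1: "card (N v \<inter> W) + card {a \<in> N v. Suc (layer a) = i} \<le> Suc t" if "v \<in> W" for v
  proof -
    have "card (N v \<inter> W \<union> {a \<in> N v. Suc (layer a) = i}) \<le> card (N v)"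
      using sub[OF that refl] finN that assms by (intro card_mono) auto
    also have "\<dots> \<le> Suc t" using cN that assms by blast
    finally show ?thesis using sub[OF that refl] by linarith
  qed
  have cW: "card (N v \<inter> W) \<le> t" if "v \<in> W" for v
  proof (cases "N v \<inter> W = {}")
    case False
    then have "{a \<in> N v. Suc (layer a) = i} \<noteq> {}" using up that by blast
    moreover have "finite {a \<in> N v. Suc (layer a) = i}" using finN that assms by auto
    ultimately have "card {a \<in> N v. Suc (layer a) = i} \<ge> 1" by (simp add: Suc_le_eq card_gt_0_iff)
    then show ?thesis using card1[OF that] by linarith
  qed (use assms in simp)
  have "card {v \<in> W. N v \<inter> W = S} \<le> (if card (N s \<inter> W) < t then 2 else 1)"
    if s: "s \<in> W" and S: "S \<subseteq> W" "card S = t" "s \<in> S" "S - {s} \<subseteq> N s \<inter> W" for s S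
  proof -
    define U where "U = {a \<in> N s. Suc (layer a) = i}"
    have sV: "s \<in> V" using s assms by blast
    have finS: "finite S" using S assms by (metis card.infinite not_one_le_zero)
    have finU: "finite U" using finN sV by (simp add: U_def)
    have ex: "\<exists>a\<in>U. N v = insert a S" if v: "v \<in> W" "N v \<inter> W = S" for v
    proof -
      have vV: "v \<in> V" using v assms by blast
      obtain a where a: "a \<in> N v" "Suc (layer a) = i" using up[OF v(1)] v S by auto
      have aV: "a \<in> V" using a N_in_V vV by blast
      have "a \<notin> W" using a assms(4)[of a] by auto
      then have "a \<noteq> s" "a \<notin> S" using s S by auto
      have sN: "s \<in> N v" using v S by auto
      then have "a \<in> N s \<or> s \<in> N a" using N_clique[OF vV a(1) sN] \<open>a \<noteq> s\<close> by blast
      then have "a \<in> U" using layer_mono[OF aV, of s] a assms(4)[OF s] unfolding U_def by auto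
      moreover have "insert a S \<subseteq> N v" using a v by auto
      then have "insert a S = N v"
        using finN[OF vV] cN[OF vV] \<open>a \<notin> S\<close> finS S by (intro card_seteq) auto
      ultimately show ?thesis by auto
    qed
    have sub1: "{v \<in> W. N v \<inter> W = S} \<subseteq> (\<Union>a\<in>U. {v \<in> V. N v = insert a S})"
      using ex assms(3) by blast
    have b: "card {v \<in> V. N v = insert a S} \<le> (if card (N s) < Suc t then 2 else 1)" if "a \<in> U" for a
    proof -
      have "a \<notin> W" using that assms(4)[of a] unfolding U_def by auto
      then have "a \<notin> S" using S by auto
      have "insert a S \<subseteq> V" using that S assms N_in_V[OF sV] unfolding U_def by auto
      moreover have "card (insert a S) = Suc t" using \<open>a \<notin> S\<close> S finS by simp
      moreover have "insert a S - {s} \<subseteq> N s" using that S unfolding U_def by auto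
      ultimately show ?thesis using assms(1) sV S(3) unfolding simple_elimination_def
        by (meson insertI2)
    qed
    have "card {v \<in> W. N v \<inter> W = S} \<le> card (\<Union>a\<in>U. {v \<in> V. N v = insert a S})"
      using sub1 finite_V finU by (intro card_mono) auto
    also have "\<dots> \<le> (\<Sum>a\<in>U. card {v \<in> V. N v = insert a S})" using finU by (rule card_UN_le)
    also have "\<dots> \<le> (\<Sum>a\<in>U. if card (N s) < Suc t then 2 else 1)" using b by (rule sum_mono)
    also have "\<dots> = card U * (if card (N s) < Suc t then 2 else 1)" by simp
    \<comment> \<open>\<open>N s \<inter> W\<close> has at least \<open>t - 1\<close> elements. If
      it has exactly \<open>t - 1\<close>, there are at most two choices of \<open>a\<close>; two
      choices make \<open>N s\<close> full, so that each set occurs only once. If it has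
      \<open>t\<close>, there is at most one choice, and that choice makes \<open>N s\<close>
      full.\<close>
    also have "\<dots> \<le> (if card (N s \<inter> W) < t then 2 else 1)"
    proof -
      have c1: "card (N s \<inter> W) + card U \<le> Suc t" using card1[OF s] unfolding U_def .
      have c2: "card (N s \<inter> W) + card U \<le> card (N s)"
        using sub[OF s, of U] finN[OF sV] card_mono[of "N s" "N s \<inter> W \<union> U"] unfolding U_def by auto
      have "card (S - {s}) \<le> card (N s \<inter> W)" using S finN[OF sV] by (intro card_mono) auto
      then have c3: "t \<le> Suc (card (N s \<inter> W))" using S finS by simp
      show ?thesis
      proof (cases "card (N s \<inter> W) < t")
        case True
        then have "card U \<le> 2" using c1 c3 by linarith
        then consider "card U = 0" | "card U = 1" | "card U = 2" by linarith
        then show ?thesis using True c2 c3 by cases auto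
      next
        case False
        then have "card U \<le> 1" using c1 by linarith
        then consider "card U = 0" | "card U = 1" by linarith
        then show ?thesis using False c2 by cases auto
      qed
    qed
    finally show ?thesis .
  qed
  then show ?thesis using cW unfolding simple_elimination_def by blast
qed

text \<open>Here the components are paths: a root has at most two successors, every other vertex at
  most one. A layer of a component has at most two vertices, so constantly many colours suffice to
  give distinct colours to all vertices within distance \<open>l\<close>.\<close>

lemma ranking_linear:
  assumes "simple_elimination 1 V N"
  shows "\<exists>\<phi>. walk_ranking l V N \<phi> \<and> (\<forall>v\<in>V. \<phi> v < Suc l * 2)"
proof -
  define D where "D b i = {x \<in> V. layer x = i \<and> top 0 x = b}" for b i
  have finD: "finite (D b i)" for b i using finite_V by (simp add: D_def)
  have finN: "finite (N v)" if "v \<in> V" for v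
    using finite_subset[OF N_subset[OF that] finite_V] .
  have N1: "\<exists>s. N x = {s} \<and> s \<in> D b i" if "x \<in> D b (Suc i)" for x b i
  proof -
    have x: "x \<in> V" "layer x = Suc i" "top 0 x = b" using that by (auto simp: D_def)
    then have "N x \<noteq> {}" using layer_root[of x] by auto
    then obtain s where s: "s \<in> N x" "layer x = Suc (layer s)" using layer_pred x by blast
    have "card (N x) \<le> 1" using assms x unfolding simple_elimination_def by blast
    then have "N x = {s}" using s finN[OF x(1)] by (metis card_le_Suc0_iff_eq One_nat_def is_singletonI' is_singletonE emptyE singletonD)
    moreover have "s \<in> D b i" using s x N_in_V top_eq[OF x(1) anc_N[OF x(1) s(1)], of 0] by (auto simp: D_def)
    ultimately show ?thesis by blast
  qed
  have C: "card {v \<in> V. N v = {s}} \<le> (if card (N s) < 1 then 2 else 1)" if "s \<in> V" for s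
  proof -
    have "{s} \<subseteq> V \<and> card {s} = 1 \<and> s \<in> {s} \<and> {s} - {s} \<subseteq> N s" using that by auto
    then show ?thesis using assms that unfolding simple_elimination_def by blast
  qed
  have D0: "D b 0 \<subseteq> {b}" for b
  proof
    fix x assume "x \<in> D b 0"
    then have x: "x \<in> V" "layer x = 0" "top 0 x = b" by (auto simp: D_def)
    then have "N x = {}" using layer_pred[of x] by auto
    then have "top 0 x = x" using top_props(1)[of x 0] anc_cases x by auto
    then show "x \<in> {b}" using x by simp
  qed
  have D1: "D b (Suc 0) \<subseteq> {v \<in> V. N v = {b}}" for b
    using N1[of _ b 0] D0[of b] by (fastforce simp: D_def)
  have card_D: "card (D b i) \<le> 2" for b i
  proof (induction i)
    case 0
    have "card (D b 0) \<le> card {b}" using D0 by (intro card_mono) auto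
    then show ?case by simp
  next
    case (Suc i)
    show ?case
    proof (cases i)
      case 0
      show ?thesis
      proof (cases "b \<in> V")
        case True
        have "card (D b (Suc 0)) \<le> card {v \<in> V. N v = {b}}" using D1 finite_V by (intro card_mono) auto
        also have "\<dots> \<le> 2" using C[OF True] by (auto split: if_splits)
        finally show ?thesis using 0 by simp
      next
        case False
        have "D b (Suc 0) = {}"
        proof (rule ccontr)
          assume "D b (Suc 0) \<noteq> {}"
          then obtain x where "x \<in> D b (Suc 0)" by blast
          then show False using N1[of x b 0] D0[of b] False by (auto simp: D_def)
        qed
        then show ?thesis using 0 by simp
      qed
    next
      case (Suc j)
      define p where "p x = (THE s. N x = {s})" for x
      have p: "N x = {p x}" "p x \<in> D b i" if "x \<in> D b (Suc i)" for x
        using N1[OF that] unfolding p_def by auto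
      have "inj_on p (D b (Suc i))"
      proof (rule inj_onI)
        fix x y assume xy: "x \<in> D b (Suc i)" "y \<in> D b (Suc i)" "p x = p y"
        let ?s = "p x"
        obtain z where "N ?s = {z}" using N1[of ?s b j] p(2)[OF xy(1)] Suc by blast
        moreover have "?s \<in> V" using p(2)[OF xy(1)] by (simp add: D_def)
        ultimately have c: "card {v \<in> V. N v = {?s}} \<le> 1" using C by fastforce
        have "x \<in> {v \<in> V. N v = {?s}}" "y \<in> {v \<in> V. N v = {?s}}"
          using xy p(1)[of x] p(1)[of y] by (auto simp: D_def)
        then show "x = y" using c finite_V card_le_Suc0_iff_eq[of "{v \<in> V. N v = {?s}}"] by auto
      qed
      then have "card (D b (Suc i)) \<le> card (D b i)" using p(2) finD by (intro card_inj_on_le) auto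
      then show ?thesis using Suc.IH by linarith
    qed
  qed
  have M: "card {x \<in> V. layer x = i \<and> top (i - l) x = a} \<le> 2" for i a
  proof -
    have "{x \<in> V. layer x = i \<and> top (i - l) x = a} \<subseteq> D (top 0 a) i"
    proof
      fix x assume "x \<in> {x \<in> V. layer x = i \<and> top (i - l) x = a}"
      then have x: "x \<in> V" "layer x = i" "top (i - l) x = a" by auto
      then have "anc a x" using top_props(1)[of x "i - l"] by auto
      then show "x \<in> D (top 0 a) i" using x top_eq[of x a 0] by (simp add: D_def)
    qed
    then show ?thesis using card_D[of "top 0 a" i] card_mono[OF finD] le_trans by blast
  qed
  obtain \<psi> :: "'a \<Rightarrow> nat" where \<psi>: "\<And>x. x \<in> V \<Longrightarrow> \<psi> x < Suc l * 2"
    "\<And>us. set us \<subseteq> V \<Longrightarrow> successively (adjacent N) us \<Longrightarrow> us \<noteq> [] \<Longrightarrow> length us \<le> Suc l \<Longrightarrow>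
       hd us \<in> V \<Longrightarrow> last us \<in> V \<Longrightarrow> \<psi> (hd us) = \<psi> (last us) \<Longrightarrow> hd us = last us"
    using distance_colouring[of V l 2] M by blast
  have "walk_ranking l V N \<psi>"
    unfolding walk_ranking_def
  proof (intro allI impI, elim conjE)
    fix us assume us: "us \<noteq> []" "set us \<subseteq> V" "successively (adjacent N) us" "length us \<le> Suc l"
      "hd us \<noteq> last us" "\<psi> (hd us) = \<psi> (last us)"
    then have "hd us \<in> V" "last us \<in> V" by auto
    then show "\<exists>z\<in>set us. \<psi> (hd us) < \<psi> z" using \<psi>(2)[of us] us by blast
  qed
  then show ?thesis using \<psi>(1) by blast
qed

end

section \<open>Combining the rankings of the layers\<close>

lemma (in elimination) restrict_elimination:
  assumes "W \<subseteq> V"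
  shows "elimination W (\<lambda>v. N v \<inter> W) e"
proof
  show "finite W" using finite_subset[OF assms finite_V] .
next
  fix v u w assume a: "v \<in> W" "u \<in> N v \<inter> W" "w \<in> N v \<inter> W" "u \<noteq> w"
  then have "u \<in> N w \<or> w \<in> N u" using N_clique[of v u w] assms by blast
  then show "u \<in> N w \<inter> W \<or> w \<in> N u \<inter> W" using a by blast
qed (use N_less assms in auto)

lemma ancestor_restrict:
  assumes "ancestor W (\<lambda>v. N v \<inter> W) x y" "W \<subseteq> V" shows "ancestor V N x y"
proof -
  have "elim_rel W (\<lambda>v. N v \<inter> W) \<subseteq> elim_rel V N" using assms(2) by (auto simp: elim_rel_def)
  then show ?thesis using assms(1) rtrancl_mono unfolding ancestor_def by blast
qed

context elimination
begin

definition band :: "real \<Rightarrow> ('a \<Rightarrow> real) \<Rightarrow> 'a \<Rightarrow> nat" where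
  "band k n x = nat \<lfloor>log k (n x)\<rfloor>"

text \<open>Summing the bands of \<open>l + 1\<close> consecutive topmost ancestors makes the level drop as soon as the
  weight drops by a factor \<open>k\<close> within \<open>l + 1\<close> layers. The truncated subtraction \<open>layer x - j\<close> repeats
  the root of the tree for the first layers.\<close>

definition level :: "real \<Rightarrow> ('a \<Rightarrow> real) \<Rightarrow> nat \<Rightarrow> 'a \<Rightarrow> nat" where
  "level k n l x = band k n x + (\<Sum>j\<le>l. band k n (top (layer x - j) x))"

definition high :: "real \<Rightarrow> ('a \<Rightarrow> real) \<Rightarrow> nat \<Rightarrow> 'a set" where
  "high k n l = {x \<in> V. \<exists>y\<in>V. x \<in> N y \<and> layer y = Suc (layer x) \<and>
     n (top (layer x - l) x) < k * n (top (layer y) y)}"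

end

section \<open>The induction step from \<open>t\<close> to \<open>Suc t\<close> at a fixed scale
  \<open>k\<close>\<close>

locale weighted_elimination = elimination +
  fixes n :: "'a \<Rightarrow> real" and k m :: real and l t :: nat
  assumes weight: "tree_weight V N n" and weight_le: "v \<in> V \<Longrightarrow> n v \<le> m" and k_gt_1: "1 < k"
    and simple: "simple_elimination (Suc t) V N" and t_ge_1: "1 \<le> t"
begin

abbreviation "bnd \<equiv> band k n"
abbreviation "lev \<equiv> level k n l"
abbreviation "hi \<equiv> high k n l"

lemma weight_ge_1: "v \<in> V \<Longrightarrow> 1 \<le> n v"
  using weight unfolding tree_weight_def by blast

lemma top_in_V: "v \<in> V \<Longrightarrow> j \<le> layer v \<Longrightarrow> top j v \<in> V"
  using top_props(1) anc_in_V by blast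

lemma band_mono: assumes "anc u v" "v \<in> V" shows "bnd v \<le> bnd u"
proof -
  have "1 \<le> n v" "n v \<le> n u" using weight_ge_1 weight_mono[OF weight] assms by auto
  then have "log k (n v) \<le> log k (n u)" using k_gt_1 by simp
  then show ?thesis unfolding band_def by (intro nat_mono floor_mono)
qed

lemma band_less: assumes "u \<in> V" "v \<in> V" "k * n v \<le> n u" shows "bnd v < bnd u"
proof -
  have v: "1 \<le> n v" using weight_ge_1 assms by auto
  then have "log k (k * n v) \<le> log k (n u)" using k_gt_1 assms(3)
    by (smt (verit, best) log_le_cancel_iff mult_pos_pos)
  moreover have "log k (k * n v) = 1 + log k (n v)" using k_gt_1 v by (simp add: log_mult)
  moreover have "0 \<le> log k (n v)" using v k_gt_1 by simp
  ultimately show ?thesis unfolding band_def by linarith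
qed

text \<open>This keeps the rescaled weight \<open>n v / k ^ bnd v\<close> between 1 and
  \<open>k\<close>.\<close>

lemma band_power: assumes "v \<in> V" shows "k ^ bnd v \<le> n v" "n v \<le> k * k ^ bnd v"
proof -
  have v: "1 \<le> n v" using weight_ge_1 assms by auto
  then have l0: "0 \<le> log k (n v)" using k_gt_1 by simp
  have "real (bnd v) \<le> log k (n v)" using l0 unfolding band_def by linarith
  then have "k powr real (bnd v) \<le> k powr log k (n v)" using k_gt_1 by simp
  then show "k ^ bnd v \<le> n v" using v k_gt_1 by (simp add: powr_realpow)
  have "log k (n v) \<le> real (Suc (bnd v))" using l0 unfolding band_def by linarith
  then have "k powr log k (n v) \<le> k powr real (Suc (bnd v))" using k_gt_1 by simp
  also have "k powr real (Suc (bnd v)) = k ^ Suc (bnd v)" using k_gt_1 by (intro powr_realpow) auto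
  finally show "n v \<le> k * k ^ bnd v" using v k_gt_1 by simp
qed

lemma level_le:
  assumes "x \<in> V" shows "lev x \<le> (l + 2) * nat \<lfloor>log k m\<rfloor>"
proof -
  have b: "bnd y \<le> nat \<lfloor>log k m\<rfloor>" if "y \<in> V" for y
  proof -
    have "1 \<le> n y" "n y \<le> m" using weight_ge_1 weight_le that by auto
    then have "log k (n y) \<le> log k m" using k_gt_1 by simp
    then show ?thesis unfolding band_def by (intro nat_mono floor_mono)
  qed
  have "(\<Sum>j\<le>l. bnd (top (layer x - j) x)) \<le> (\<Sum>j\<le>l. nat \<lfloor>log k m\<rfloor>)"
    using b top_in_V[OF assms] by (intro sum_mono) simp
  then show ?thesis using b[OF assms] unfolding level_def by simp
qed

text \<open>The topmost ancestors in the sum are shared, so along an ancestor chain inside a layer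
  the level changes exactly as the band does. Equal level then means equal band, which is what
  permits rescaling.\<close>

lemma level_same_layer:
  assumes "v \<in> V" "anc u v" "layer u = layer v"
  shows "lev v \<le> lev u" "lev u + bnd v = lev v + bnd u"
proof -
  have "top (layer v - j) u = top (layer v - j) v" for j
    using top_eq[OF assms(1,2), of "layer v - j"] assms(3) by simp
  then show "lev u + bnd v = lev v + bnd u" using assms(3) unfolding level_def by simp
  then show "lev v \<le> lev u" using band_mono[OF assms(2,1)] by linarith
qed

text \<open>The step from layer \<open>i\<close> to \<open>i + 1\<close> shifts the window of
  topmost ancestors: \<open>top (i - l) u\<close> leaves, \<open>r\<close> enters, the others are
  common. As \<open>u\<close> is not high, the entering weight is smaller by a factor
  \<open>k\<close>, so its band is strictly smaller. The band of the vertex itself does not grow,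
  because \<open>r\<close> lies between \<open>u\<close> and \<open>v\<close>.\<close>

lemma level_drop:
  assumes v: "v \<in> V" and u: "u \<in> N v" "u \<notin> hi" and L: "layer v = Suc (layer u)"
  shows "lev v < lev u"
proof -
  define i where "i = layer u"
  define r where "r = top (Suc i) v"
  have uV: "u \<in> V" using N_in_V[OF v u(1)] .
  have r: "anc r v" "layer r = Suc i" using top_props[OF v, of "Suc i"] L unfolding i_def r_def by auto
  have rV: "r \<in> V" using anc_in_V[OF r(1) v] .
  have uv: "anc u v" using anc_N[OF v u(1)] .
  have ur: "anc u r"
  proof (rule ccontr)
    assume "\<not> anc u r"
    then have "anc r u" using anc_chain[OF v uv r(1)] by blast
    then show False using layer_anc[of r u] r(2) unfolding i_def by simp
  qed
  have teq: "top (i - j) u = top (i - j) v" for j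
    using top_eq[OF v uv, of "i - j"] unfolding i_def by simp
  have aV: "top (i - l) u \<in> V" using top_in_V[OF uV] unfolding i_def by simp
  have "\<not> (n (top (layer u - l) u) < k * n (top (layer v) v))"
    using u v uV L unfolding high_def by blast
  then have "k * n r \<le> n (top (i - l) u)" using L unfolding i_def r_def by simp
  then have less: "bnd r < bnd (top (i - l) u)" using band_less[OF aV rV] by simp
  have "(\<Sum>j\<le>l. bnd (top (layer v - j) v)) = bnd r + (\<Sum>j<l. bnd (top (i - j) v))"
    unfolding sum.atMost_shift using L by (simp add: r_def i_def)
  then have 1: "lev v = bnd v + bnd r + (\<Sum>j<l. bnd (top (i - j) u))"
    unfolding level_def teq by simp
  have 2: "lev u = bnd u + bnd (top (i - l) u) + (\<Sum>j<l. bnd (top (i - j) u))"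
    unfolding level_def i_def[symmetric] by (simp add: lessThan_Suc_atMost[symmetric])
  show ?thesis using 1 2 less band_mono[OF ur rV] band_mono[OF r(1) v] by linarith
qed

text \<open>A high vertex has a child in a component from layer \<open>i + 1\<close> on whose top
  \<open>r\<close> weighs more than \<open>n a / k\<close>. Such tops form an antichain below
  \<open>a\<close>, so there are at most \<open>k\<close> of them, and by \<open>N_top\<close> each
  accounts only for vertices of \<open>N r\<close>.\<close>

lemma high_card: "card {x \<in> hi. layer x = i \<and> top (i - l) x = a} \<le> Suc t * nat \<lfloor>k\<rfloor>"
proof -
  define R where "R = {r \<in> V. layer r = Suc i \<and> top (Suc i) r = r \<and> anc a r \<and> n a < k * n r}"
  have finR: "finite R" using finite_V by (simp add: R_def)
  have sub: "{x \<in> hi. layer x = i \<and> top (i - l) x = a} \<subseteq> (\<Union>r\<in>R. N r)"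
  proof
    fix x assume "x \<in> {x \<in> hi. layer x = i \<and> top (i - l) x = a}"
    then obtain y where x: "x \<in> V" "layer x = i" "top (i - l) x = a" and
      y: "y \<in> V" "x \<in> N y" "layer y = Suc i" "n a < k * n (top (Suc i) y)"
      unfolding high_def by auto
    define r where "r = top (Suc i) y"
    have r: "anc r y" "layer r = Suc i" using top_props[OF y(1), of "Suc i"] y(3) unfolding r_def by auto
    have rV: "r \<in> V" using anc_in_V[OF r(1) y(1)] .
    have "x \<in> N r" using N_top[OF r(1) y(1) _ y(2)] r x y by simp
    moreover have "anc a x" using top_props(1)[OF x(1), of "i - l"] x by simp
    then have "anc a r" using anc_N[OF rV \<open>x \<in> N r\<close>] anc_trans by blast
    moreover have "top (Suc i) r = r" using top_eq[OF y(1) r(1), of "Suc i"] r unfolding r_def by simp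
    ultimately show "x \<in> (\<Union>r\<in>R. N r)" using r rV y(4) unfolding R_def r_def by auto
  qed
  have cardR: "card R \<le> nat \<lfloor>k\<rfloor>"
  proof (cases "R = {}")
    case False
    then have aV: "a \<in> V" using anc_in_V unfolding R_def by blast
    have anti: "x = y" if "x \<in> R" "y \<in> R" "anc x y" for x y
    proof -
      have x: "layer x = Suc i" and y: "y \<in> V" "layer y = Suc i" "top (Suc i) y = y"
        using that unfolding R_def by auto
      have "anc (top (Suc i) y) x" using top_props(3)[OF y(1) _ that(3) x] y by simp
      then show ?thesis using anc_antisym[OF that(3)] y by simp
    qed
    have "R \<subseteq> V" "\<forall>x\<in>R. anc a x" unfolding R_def by auto
    then have s: "sum n R \<le> n a" using weight aV anti unfolding tree_weight_def by blast
    have "real (card R) * (n a / k) \<le> sum n R"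
      using k_gt_1 by (intro sum_bounded_below) (auto simp: R_def field_simps)
    then have "real (card R) * (n a / k) \<le> n a" using s by linarith
    moreover have "n a > 0" using weight_ge_1[OF aV] by simp
    ultimately have "real (card R) \<le> k" using k_gt_1 by (simp add: field_simps)
    then show ?thesis by linarith
  qed simp
  have finN: "finite (N v)" if "v \<in> V" for v
    using finite_subset[OF N_subset[OF that] finite_V] .
  have "card {x \<in> hi. layer x = i \<and> top (i - l) x = a} \<le> card (\<Union>r\<in>R. N r)"
    using sub finR finN by (intro card_mono) (auto simp: R_def)
  also have "\<dots> \<le> (\<Sum>r\<in>R. card (N r))" using finR by (rule card_UN_le)
  also have "\<dots> \<le> (\<Sum>r\<in>R. Suc t)"
    using simple unfolding simple_elimination_def by (intro sum_mono) (auto simp: R_def)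
  also have "\<dots> = Suc t * card R" by simp
  also have "\<dots> \<le> Suc t * nat \<lfloor>k\<rfloor>" using cardR by (rule mult_le_mono2)
  finally show ?thesis .
qed

section \<open>Pieces: equal layer and equal level\<close>

definition piece :: "nat \<Rightarrow> nat \<Rightarrow> 'a set" where
  "piece i g = {v \<in> V. layer v = i \<and> lev v = g}"

lemma piece_subset: "piece i g \<subseteq> V"
  by (auto simp: piece_def)

text \<open>Layers never fall and, within a layer, levels never rise along the ancestor order, so
  everything between two vertices of a piece is in the piece. Antichains of a piece are therefore
  antichains of the whole graph.\<close>

lemma piece_ancestor:
  assumes "anc x y" "x \<in> piece i g" "y \<in> piece i g"
  shows "ancestor (piece i g) (\<lambda>v. N v \<inter> piece i g) x y"
proof -
  have "y \<in> piece i g \<longrightarrow> ancestor (piece i g) (\<lambda>v. N v \<inter> piece i g) x y"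
    using assms(1)
  proof (induction rule: anc_induct)
    case refl
    then show ?case by (simp add: ancestor_def)
  next
    case (step w y)
    show ?case
    proof
      assume y: "y \<in> piece i g"
      have wV: "w \<in> V" using N_in_V[OF step(2,3)] .
      have wy: "anc w y" using anc_N[OF step(2,3)] .
      have x: "x \<in> V" "layer x = i" "lev x = g" and y': "y \<in> V" "layer y = i" "lev y = g"
        using assms(2) y by (auto simp: piece_def)
      have "layer w = i" using layer_anc[OF step(1)] layer_anc[OF wy] x y' by linarith
      moreover have "lev w = g"
        using level_same_layer(1)[OF wV step(1)] level_same_layer(1)[OF y'(1) wy] calculation x y' by linarith
      ultimately have w: "w \<in> piece i g" using wV by (simp add: piece_def)
      then have "(w, y) \<in> elim_rel (piece i g) (\<lambda>v. N v \<inter> piece i g)"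
        using y step(3) by (simp add: elim_rel_def)
      then show "ancestor (piece i g) (\<lambda>v. N v \<inter> piece i g) x y"
        using step(4) w unfolding ancestor_def by (meson rtrancl.rtrancl_into_rtrancl)
    qed
  qed
  then show ?thesis using assms by blast
qed

text \<open>Each vertex is rescaled by its own band, yet below a fixed \<open>a\<close> of the piece
  the band is constant. The antichain inequality is thus divided by one common factor.\<close>

lemma piece_weight:
  "tree_weight (piece i g) (\<lambda>v. N v \<inter> piece i g) (\<lambda>x. n x / k ^ bnd x)"
  unfolding tree_weight_def
proof (intro conjI ballI allI impI)
  fix v assume "v \<in> piece i g"
  then have "k ^ bnd v \<le> n v" using band_power piece_subset by blast
  then show "1 \<le> n v / k ^ bnd v" using k_gt_1 by simp
next
  fix a A
  let ?a = "ancestor (piece i g) (\<lambda>v. N v \<inter> piece i g)"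
  assume a: "a \<in> piece i g" and A: "A \<subseteq> piece i g"
    and h: "(\<forall>x\<in>A. ?a a x) \<and> (\<forall>x\<in>A. \<forall>y\<in>A. ?a x y \<longrightarrow> x = y)"
  have anc: "anc a x" if "x \<in> A" for x
    using h that ancestor_restrict[OF _ piece_subset] by blast
  have anti: "x = y" if "x \<in> A" "y \<in> A" "anc x y" for x y
    using h that piece_ancestor[OF that(3)] A by blast
  have "A \<subseteq> V" using A piece_subset by blast
  moreover have "a \<in> V" using a piece_subset by blast
  ultimately have s: "sum n A \<le> n a" using weight anc anti unfolding tree_weight_def by blast
  have b: "bnd x = bnd a" if "x \<in> A" for x
  proof -
    have "x \<in> V" "layer a = layer x" "lev a = lev x" using A a that by (auto simp: piece_def)
    then show ?thesis using level_same_layer(2)[of x a] anc[OF that] by simp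
  qed
  have "(\<Sum>x\<in>A. n x / k ^ bnd x) = (\<Sum>x\<in>A. n x / k ^ bnd a)" using b by (intro sum.cong) auto
  also have "\<dots> = sum n A / k ^ bnd a" by (simp add: sum_divide_distrib)
  also have "\<dots> \<le> n a / k ^ bnd a" using s k_gt_1 by (simp add: divide_right_mono)
  finally show "(\<Sum>x\<in>A. n x / k ^ bnd x) \<le> n a / k ^ bnd a" .
qed

lemma piece_weight_le: "v \<in> piece i g \<Longrightarrow> n v / k ^ bnd v \<le> k"
  using band_power(2)[of v] k_gt_1 piece_subset by (auto simp: divide_le_eq)

text \<open>Entering the next layer from a vertex that is not high lowers the level, and moving on
  inside a layer never raises it; this leaves only equality.\<close>

lemma low_step:
  assumes "v \<in> V" "u \<in> N v" "u \<notin> hi" "lev u \<le> lev v"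
  shows "lev u = lev v \<and> layer u = layer v"
proof -
  have "layer v \<noteq> Suc (layer u)" using level_drop[OF assms(1-3)] assms(4) by auto
  then have "layer u = layer v"
    using layer_mono[OF assms(1,2)] layer_le_Suc[OF assms(1,2)] by linarith
  then show ?thesis using level_same_layer(1)[OF assms(1) anc_N[OF assms(1,2)]] assms(4) by simp
qed

text \<open>Removing the \<open>e\<close>-largest vertex of a walk keeps it a walk, because the two neighbours of
  that vertex lie in a common clique. If it is an endpoint, then its neighbour has the same level
  and layer.\<close>

lemma low_walk:
  assumes "us \<noteq> []" "set us \<subseteq> V - hi" "successively (adjacent N) us"
    "\<forall>x\<in>set us. lev x \<le> g" "lev (hd us) = g" "lev (last us) = g"
  shows "\<exists>ws. ws \<noteq> [] \<and> set ws \<subseteq> set us \<and> set ws \<subseteq> piece (layer (hd us)) g \<and>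
    successively (adjacent N) ws \<and> hd ws = hd us \<and> last ws = last us \<and> length ws \<le> length us"
  using assms
proof (induction "length us" arbitrary: us rule: less_induct)
  case less
  note us = less.prems
  have "finite (set us)" "set us \<noteq> {}" using us by auto
  then obtain z where z: "z \<in> set us" "\<And>x. x \<in> set us \<Longrightarrow> e x \<le> e z"
    using obtains_MAX by (metis (no_types, lifting) Max_ge finite_imageI imageI)
  obtain xs ys where sp: "us = xs @ z # ys" using z(1) by (meson split_list)
  have zV: "z \<in> V" using z us by blast
  have nb: "x \<in> N z" if "x \<in> set us" "adjacent N x z \<or> adjacent N z x" for x
  proof -
    have "x \<in> V" using that us by blast
    then have "z \<notin> N x" using N_less[of x z] z(2)[OF that(1)] by auto
    then show ?thesis using that unfolding adjacent_def by blast
  qed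
  consider "xs = []" "ys = []" | "xs = []" "ys \<noteq> []" | "xs \<noteq> []" "ys = []" | "xs \<noteq> []" "ys \<noteq> []"
    by blast
  then show ?case
  proof cases
    case 1
    then show ?thesis using sp us zV by (intro exI[of _ us]) (auto simp: piece_def)
  next
    case 2
    let ?u = "hd ys"
    have u: "?u \<in> set us" "adjacent N z ?u" using sp us 2 by (auto simp: successively_Cons)
    have lz: "lev z = g" using us(5) sp 2 by simp
    have st: "lev ?u = lev z \<and> layer ?u = layer z"
    proof (rule low_step[OF zV])
      show "?u \<in> N z" using nb[OF u(1)] u(2) by blast
      show "?u \<notin> hi" using u(1) us(2) by blast
      show "lev ?u \<le> lev z" using u(1) us(4) lz by simp
    qed
    obtain ws where ws: "ws \<noteq> []" "set ws \<subseteq> set ys" "set ws \<subseteq> piece (layer ?u) g"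
      "successively (adjacent N) ws" "hd ws = ?u" "last ws = last ys" "length ws \<le> length ys"
      using less.hyps[of ys] us sp 2 st lz by (auto simp: successively_Cons)
    have "z \<in> piece (layer z) g" using zV lz by (simp add: piece_def)
    then show ?thesis using ws sp 2 u st by (intro exI[of _ "z # ws"]) (auto simp: successively_Cons)
  next
    case 3
    let ?u = "last xs"
    have u: "?u \<in> set us" "adjacent N ?u z" using sp us 3 by (auto simp: successively_append_iff)
    have lz: "lev z = g" using us(6) sp 3 by simp
    have st: "lev ?u = lev z \<and> layer ?u = layer z"
    proof (rule low_step[OF zV])
      show "?u \<in> N z" using nb[OF u(1)] u(2) by blast
      show "?u \<notin> hi" using u(1) us(2) by blast
      show "lev ?u \<le> lev z" using u(1) us(4) lz by simp
    qed
    obtain ws where ws: "ws \<noteq> []" "set ws \<subseteq> set xs" "set ws \<subseteq> piece (layer (hd xs)) g"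
      "successively (adjacent N) ws" "hd ws = hd xs" "last ws = ?u" "length ws \<le> length xs"
      using less.hyps[of xs] us sp 3 st lz by (auto simp: successively_append_iff)
    have "?u \<in> piece (layer (hd xs)) g" using ws by (metis last_in_set subsetD)
    then have "z \<in> piece (layer (hd xs)) g" using zV lz st by (simp add: piece_def)
    then show ?thesis using ws sp 3 u
      by (intro exI[of _ "ws @ [z]"]) (auto simp: successively_append_iff)
  next
    case 4
    note xy = this
    let ?a = "last xs" and ?b = "hd ys"
    have ab: "?a \<in> N z" "?b \<in> N z"
      using nb[of ?a] nb[of ?b] sp us 4 by (auto simp: successively_append_iff successively_Cons)
    \<comment> \<open>The walk may go to \<open>z\<close> and straight back. Then one of the two
      equal neighbours has to go as well, since no vertex is adjacent to itself.\<close>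
    define us' where "us' = (if ?a = ?b then xs @ tl ys else xs @ ys)"
    have s: "successively (adjacent N) xs" "successively (adjacent N) ys"
      using us sp 4 by (auto simp: successively_append_iff successively_Cons)
    have ys: "ys = ?b # tl ys" using 4 by simp
    have 1: "successively (adjacent N) us'"
    proof (cases "?a = ?b")
      case True
      have "successively (adjacent N) (?b # tl ys)" using s ys by simp
      then show ?thesis using True s unfolding us'_def
        by (auto simp: successively_append_iff successively_Cons)
    next
      case False
      then have "adjacent N ?a ?b" using N_clique[OF zV ab] unfolding adjacent_def by blast
      then show ?thesis using False s unfolding us'_def by (simp add: successively_append_iff)
    qed
    have 2: "set us' \<subseteq> set us"
      using sp set_subset_Cons[of "tl ys" ?b] ys unfolding us'_def by (auto split: if_splits dest: list.set_sel(2)[OF 4(2)])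
    have 3: "hd us' = hd us" "us' \<noteq> []" using sp xy unfolding us'_def by auto
    have 4: "last us' = last us"
    proof (cases "?a = ?b \<and> tl ys = []")
      case True
      then have "last ys = ?b" using ys by (metis last_ConsL)
      then show ?thesis using True sp xy unfolding us'_def by simp
    next
      case False
      have "last (tl ys) = last ys" if "tl ys \<noteq> []" using that by (simp add: last_tl)
      then show ?thesis using False sp xy unfolding us'_def by auto
    qed
    have 5: "length us' < length us" using sp unfolding us'_def by (simp add: less_Suc_eq_le)
    have "set us' \<subseteq> V - hi" "\<forall>x\<in>set us'. lev x \<le> g" "lev (hd us') = g" "lev (last us') = g"
      using 2 3 4 us by auto
    from less.hyps[OF 5 3(2) this(1) 1 this(2-4)] show ?thesis
      using 2 3 4 5 by (metis less_imp_le_nat order_trans)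
  qed
qed

text \<open>Colours are ordered with the palette of the high vertices on top, then by level, then by
  a ranking of the piece. A walk whose ends have equal and maximal colour either ends in two high
  vertices, which the palette excludes, or avoids high vertices and all levels above that of its
  ends. In the second case \<open>low_walk\<close> shortens it into one piece, whose ranking
  supplies a larger colour.\<close>

lemma ranking_step:
  assumes IH: "\<And>V' N' n'. elimination V' N' e \<Longrightarrow> simple_elimination t V' N' \<Longrightarrow> tree_weight V' N' n' \<Longrightarrow>
    (\<forall>v\<in>V'. n' v \<le> k) \<Longrightarrow> \<exists>\<phi>. walk_ranking l V' N' \<phi> \<and> (\<forall>v\<in>V'. \<phi> v < c)"
  shows "\<exists>\<phi>. walk_ranking l V N \<phi> \<and>
    (\<forall>v\<in>V. \<phi> v < Suc ((l + 2) * nat \<lfloor>log k m\<rfloor>) * c + Suc l * (Suc t * nat \<lfloor>k\<rfloor>))"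
proof -
  define B where "B = Suc ((l + 2) * nat \<lfloor>log k m\<rfloor>)"
  have "\<exists>\<phi>. walk_ranking l (piece i g) (\<lambda>v. N v \<inter> piece i g) \<phi> \<and> (\<forall>v\<in>piece i g. \<phi> v < c)" for i g
  proof (rule IH)
    show "elimination (piece i g) (\<lambda>v. N v \<inter> piece i g) e" using restrict_elimination[OF piece_subset] .
    show "simple_elimination t (piece i g) (\<lambda>v. N v \<inter> piece i g)"
      by (rule layer_simple[OF simple t_ge_1 piece_subset, of i g i]) (simp add: piece_def)
    show "tree_weight (piece i g) (\<lambda>v. N v \<inter> piece i g) (\<lambda>x. n x / k ^ bnd x)" by (rule piece_weight)
    show "\<forall>v\<in>piece i g. n v / k ^ bnd v \<le> k" using piece_weight_le by blast
  qed
  then obtain \<rho> :: "nat \<Rightarrow> nat \<Rightarrow> 'a \<Rightarrow> nat" where \<rho>: "\<And>i g. walk_ranking l (piece i g) (\<lambda>v. N v \<inter> piece i g) (\<rho> i g)"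
    "\<And>i g v. v \<in> piece i g \<Longrightarrow> \<rho> i g v < c"
    by metis
  have "hi \<subseteq> V" unfolding high_def by blast
  then obtain \<psi> :: "'a \<Rightarrow> nat" where \<psi>: "\<And>x. x \<in> hi \<Longrightarrow> \<psi> x < Suc l * (Suc t * nat \<lfloor>k\<rfloor>)"
    "\<And>us. set us \<subseteq> V \<Longrightarrow> successively (adjacent N) us \<Longrightarrow> us \<noteq> [] \<Longrightarrow> length us \<le> Suc l \<Longrightarrow>
       hd us \<in> hi \<Longrightarrow> last us \<in> hi \<Longrightarrow> \<psi> (hd us) = \<psi> (last us) \<Longrightarrow> hd us = last us"
    using distance_colouring[of hi l "Suc t * nat \<lfloor>k\<rfloor>"] high_card by blast
  define r where "r x = \<rho> (layer x) (lev x) x" for x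
  have r: "r x < c" if "x \<in> V" for x
    unfolding r_def using that by (intro \<rho>(2)) (simp add: piece_def)
  define \<phi> where "\<phi> x = (if x \<in> hi then B * c + \<psi> x else lev x * c + r x)" for x
  have low: "lev x * c + r x < B * c" if "x \<in> V" for x
    using digit_less[OF _ r[OF that], of "lev x" B] level_le[OF that] unfolding B_def by simp
  have "walk_ranking l V N \<phi>"
    unfolding walk_ranking_def
  proof (intro allI impI, elim conjE, rule ccontr)
    fix us assume us: "us \<noteq> []" "set us \<subseteq> V" "successively (adjacent N) us" "length us \<le> Suc l"
      and ne: "hd us \<noteq> last us" and eq: "\<phi> (hd us) = \<phi> (last us)" and "\<not> (\<exists>z\<in>set us. \<phi> (hd us) < \<phi> z)"
    then have le: "\<phi> z \<le> \<phi> (hd us)" if "z \<in> set us" for z using that by force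
    have hl: "hd us \<in> V" "last us \<in> V" using us by auto
    show False
    proof (cases "hd us \<in> hi")
      case True
      then have "last us \<in> hi" using eq low[OF hl(2)] unfolding \<phi>_def by (auto split: if_splits)
      then show False using \<psi>(2)[OF us(2,3,1,4) True] eq True ne unfolding \<phi>_def by auto
    next
      case False
      have lw: "z \<notin> hi" if "z \<in> set us" for z
        using le[OF that] low[OF hl(1)] False unfolding \<phi>_def by (auto split: if_splits)
      define g where "g = lev (hd us)"
      have lev_le: "lev z \<le> g" if "z \<in> set us" for z
      proof (rule ccontr)
        assume "\<not> lev z \<le> g"
        then have "g * c + r (hd us) < lev z * c" using digit_less[OF _ r[OF hl(1)], of g "lev z"] by simp
        then show False using le[OF that] lw[OF that] False unfolding \<phi>_def g_def by simp
      qed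
      have last: "last us \<notin> hi" using lw us by simp
      have d: "lev (hd us) * c + r (hd us) = lev (last us) * c + r (last us)"
        using eq False last unfolding \<phi>_def by simp
      note di = digit_inject[OF d r[OF hl(1)] r[OF hl(2)]]
      obtain ws where ws: "ws \<noteq> []" "set ws \<subseteq> set us" "set ws \<subseteq> piece (layer (hd us)) g"
        "successively (adjacent N) ws" "hd ws = hd us" "last ws = last us" "length ws \<le> length us"
      proof -
        have "set us \<subseteq> V - hi" "\<forall>x\<in>set us. lev x \<le> g" "lev (hd us) = g" "lev (last us) = g"
          using us(2) lw lev_le di(1) g_def by auto
        then show ?thesis using low_walk[OF us(1) _ us(3)] that by blast
      qed
      let ?P = "piece (layer (hd us)) g"
      have in_P: "layer x = layer (hd us)" "lev x = g" if "x \<in> set ws" for x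
        using ws(3) that by (auto simp: piece_def)
      have "successively (adjacent (\<lambda>v. N v \<inter> ?P)) ws"
        using ws(4) by (rule successively_mono) (use ws(3) in \<open>auto simp: adjacent_def\<close>)
      moreover have "last ws \<in> set ws" "hd ws \<in> set ws" using ws(1) by auto
      then have "\<rho> (layer (hd us)) g (hd ws) = \<rho> (layer (hd us)) g (last ws)"
        using di(2) in_P[of "last ws"] ws unfolding r_def g_def by simp
      ultimately obtain z where z: "z \<in> set ws" "\<rho> (layer (hd us)) g (hd ws) < \<rho> (layer (hd us)) g z"
        using walk_rankingD[OF \<rho>(1) ws(1,3)] ws ne us(4) by (metis le_trans)
      then have "r (hd us) < r z" "lev z = g" using in_P[OF z(1)] ws(5) unfolding r_def g_def by auto
      then show False using le[of z] lw[of z] z ws(2) False unfolding \<phi>_def g_def by auto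
    qed
  qed
  moreover have "\<phi> v < B * c + Suc l * (Suc t * nat \<lfloor>k\<rfloor>)" if "v \<in> V" for v
    using low[OF that] \<psi>(1)[of v] unfolding \<phi>_def by auto
  ultimately show ?thesis unfolding B_def by blast
qed

end

section \<open>Asymptotics of the upper bound\<close>

lemma filterlim_iterated_ln: "filterlim ((ln :: real \<Rightarrow> real) ^^ t) at_top at_top"
proof (induction t)
  case 0
  then show ?case by (simp add: filterlim_ident id_def)
next
  case (Suc t)
  have "filterlim (\<lambda>x. ln (((ln :: real \<Rightarrow> real) ^^ t) x)) at_top at_top"
    using filterlim_compose[OF ln_at_top Suc] .
  then show ?case by (simp add: o_def)
qed

text \<open>The square root halves the first logarithm. Every further logarithm turns the factor 2
  into a summand \<open>ln 2\<close>, which is at most half of \<open>ln y\<close> once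
  \<open>y \<ge> 4\<close>.\<close>

lemma eventually_iterated_ln_sqrt:
  assumes "1 \<le> t"
  shows "\<forall>\<^sub>F x in at_top. ((ln :: real \<Rightarrow> real) ^^ t) x / 2 \<le> (ln ^^ t) (sqrt x)"
  using assms
proof (induction t rule: dec_induct)
  case base
  show ?case using eventually_gt_at_top[of 0] by eventually_elim (simp add: ln_sqrt)
next
  case (step t)
  have "\<forall>\<^sub>F x in at_top. 4 \<le> ((ln :: real \<Rightarrow> real) ^^ t) x"
    using filterlim_iterated_ln[of t] by (simp add: filterlim_at_top)
  with step(3) show ?case
  proof eventually_elim
    case (elim x)
    let ?y = "((ln :: real \<Rightarrow> real) ^^ t) x"
    have "ln 4 \<le> ln ?y" using elim by simp
    moreover have "ln (4::real) = 2 * ln 2" using ln_realpow[of 2 2] by simp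
    ultimately have "ln ?y / 2 \<le> ln ?y - ln 2" by linarith
    also have "\<dots> = ln (?y / 2)" using elim by (simp add: ln_div)
    also have "\<dots> \<le> ln ((ln ^^ t) (sqrt x))" using elim by simp
    finally show ?case by simp
  qed
qed

lemma eventually_iterated_ln_le:
  assumes "1 \<le> t"
  shows "\<forall>\<^sub>F x in at_top. ((ln :: real \<Rightarrow> real) ^^ t) x \<le> ln x"
  using assms
proof (induction t rule: dec_induct)
  case base
  show ?case by simp
next
  case (step t)
  have "\<forall>\<^sub>F x in at_top. 1 \<le> ((ln :: real \<Rightarrow> real) ^^ t) x"
    using filterlim_iterated_ln[of t] by (simp add: filterlim_at_top)
  with step(3) show ?case
  proof eventually_elim
    case (elim x)
    have "ln (((ln :: real \<Rightarrow> real) ^^ t) x) \<le> (ln ^^ t) x"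
      using ln_le_minus_one[of "((ln :: real \<Rightarrow> real) ^^ t) x"] elim by linarith
    then show ?case using elim by simp
  qed
qed

lemma ln_le_sqrt: "0 < x \<Longrightarrow> ln x \<le> 2 * sqrt (x::real)"
  using ln_le_minus_one[of "sqrt x"] by (simp add: ln_sqrt)

text \<open>The recursive bound of \<open>ranking_step\<close> is balanced by \<open>k = \<surd>(ln m)\<close>.\<close>

lemma elimination_ranking_bound:
  assumes "1 \<le> t"
  shows "\<exists>C>0. \<forall>\<^sub>F m in at_top. \<forall>(V :: 'a set) N e n. elimination V N e \<and> simple_elimination t V N \<and>
    tree_weight V N n \<and> (\<forall>v\<in>V. n v \<le> m) \<longrightarrow>
    (\<exists>\<phi>. walk_ranking l V N \<phi> \<and> (\<forall>v\<in>V. real (\<phi> v) < C * (ln m / (ln ^^ t) m)))"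
  using assms
proof (induction t rule: dec_induct)
  case base
  have "\<forall>\<^sub>F m::real in at_top. m > exp 1" by (rule eventually_gt_at_top)
  then have "\<forall>\<^sub>F m in at_top. \<forall>(V :: 'a set) N e n. elimination V N e \<and> simple_elimination 1 V N \<and>
    tree_weight V N n \<and> (\<forall>v\<in>V. n v \<le> m) \<longrightarrow>
    (\<exists>\<phi>. walk_ranking l V N \<phi> \<and> (\<forall>v\<in>V. real (\<phi> v) < real (Suc l * 2) * (ln m / (ln ^^ 1) m)))"
  proof eventually_elim
    case (elim m)
    have "0 < m" using elim exp_gt_zero[of "1::real"] by linarith
    then have "1 < ln m" using elim by (metis exp_less_cancel_iff exp_ln)
    then have "ln m / (ln ^^ 1) m = 1" by simp
    then show ?case using elimination.ranking_linear[where l = l] by (metis mult.right_neutral of_nat_less_iff)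
  qed
  moreover have "(0::real) < real (Suc l * 2)" by simp
  ultimately show ?case by blast
next
  case (step t)
  define P where "P C m \<longleftrightarrow> (\<forall>(V :: 'a set) N e n. elimination V N e \<and> simple_elimination t V N \<and>
    tree_weight V N n \<and> (\<forall>v\<in>V. n v \<le> m) \<longrightarrow>
    (\<exists>\<phi>. walk_ranking l V N \<phi> \<and> (\<forall>v\<in>V. real (\<phi> v) < C * (ln m / (ln ^^ t) m))))" for C m
  obtain C where C: "C > 0" "\<forall>\<^sub>F m in at_top. P C m" using step.IH unfolding P_def by blast
  \<comment> \<open>The first summand pays for the number of levels times the colours of a piece,
    the second for the palette of the high vertices.\<close>
  define D where "D = 2 * (real l + 3) * (C + 1) + 2 * (real l + 1) * (real t + 1)"
  have lim_ln: "filterlim (\<lambda>m. ln m :: real) at_top at_top" by (rule ln_at_top)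
  have lim: "filterlim (\<lambda>m. sqrt (ln m)) at_top at_top"
    by (rule filterlim_compose[OF sqrt_at_top ln_at_top])
  have "\<forall>\<^sub>F m in at_top. \<forall>(V :: 'a set) N e n. elimination V N e \<and> simple_elimination (Suc t) V N \<and>
    tree_weight V N n \<and> (\<forall>v\<in>V. n v \<le> m) \<longrightarrow>
    (\<exists>\<phi>. walk_ranking l V N \<phi> \<and> (\<forall>v\<in>V. real (\<phi> v) < D * (ln m / (ln ^^ Suc t) m)))"
    using eventually_compose_filterlim[OF C(2) lim]
      eventually_compose_filterlim[OF eventually_iterated_ln_sqrt[OF step(1)] lim_ln]
      eventually_compose_filterlim[OF eventually_iterated_ln_le[OF step(1)] lim_ln]
      eventually_compose_filterlim[OF eventually_iterated_ln_le[OF step(1)] lim]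
      eventually_compose_filterlim[OF eventually_ge_at_top[of "3::real"] lim]
      eventually_compose_filterlim[OF filterlim_iterated_ln[of t, unfolded filterlim_at_top, rule_format, of 1] lim]
      eventually_compose_filterlim[OF filterlim_iterated_ln[of t, unfolded filterlim_at_top, rule_format, of 1] lim_ln]
  proof eventually_elim
    case (elim m)
    define k where "k = sqrt (ln m)"
    define L where "L = ((ln :: real \<Rightarrow> real) ^^ Suc t) m"
    define Lk where "Lk = ((ln :: real \<Rightarrow> real) ^^ t) k"
    have L_eq: "L = (ln ^^ t) (ln m)" unfolding L_def by (simp add: funpow_swap1)
    have k3: "3 \<le> k" using elim unfolding k_def by blast
    then have "0 < sqrt (ln m)" unfolding k_def by linarith
    then have lnm: "ln m = k * k" unfolding k_def by simp
    have lnm9: "9 \<le> ln m" using mult_mono[of 3 k 3 k] k3 unfolding lnm by simp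
    have Lk: "L / 2 \<le> Lk" "Lk \<le> ln k" "1 \<le> Lk" "1 \<le> L" "L \<le> ln (ln m)"
      using elim unfolding Lk_def L_eq k_def by auto
    \<comment> \<open>As \<open>ln m = k * k\<close>, this inequality is what fits a palette of size
      proportional to \<open>k\<close> into a multiple of \<open>ln m / L\<close>.\<close>
    have L2: "L \<le> 2 * k" using Lk(5) ln_le_sqrt[of "ln m"] lnm9 unfolding k_def by linarith
    have lnk: "0 < ln k" "ln k \<le> ln m"
    proof -
      show "0 < ln k" using k3 by simp
      have "ln k \<le> k" using ln_le_minus_one[of k] k3 by linarith
      also have "\<dots> \<le> k * k" using k3 by simp
      finally show "ln k \<le> ln m" using lnm by simp
    qed
    \<comment> \<open>The ceiling adds at most 1, which \<open>C + 1\<close> absorbs because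
      \<open>ln k / Lk \<ge> 1\<close>.\<close>
    define c where "c = nat \<lceil>C * (ln k / Lk)\<rceil>"
    have q: "1 \<le> ln k / Lk" using Lk by simp
    then have "0 \<le> C * (ln k / Lk)" using C(1) by (intro mult_nonneg_nonneg) auto
    then have "real c \<le> C * (ln k / Lk) + 1" unfolding c_def by linarith
    then have c: "real c \<le> (C + 1) * (ln k / Lk)" using q unfolding distrib_right by linarith
    define b where "b = nat \<lfloor>log k m\<rfloor>"
    have logeq: "log k m = ln m / ln k" by (simp add: log_def)
    have "real b \<le> ln m / ln k" unfolding b_def logeq using lnk lnm9 by simp
    moreover define r where "r = ln m / ln k"
    moreover have "1 \<le> ln m / ln k" using lnk by simp
    ultimately have r: "real b \<le> r" "1 \<le> r" by auto
    have "real (Suc ((l + 2) * b)) = (real l + 2) * real b + 1" by (simp add: algebra_simps)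
    also have "\<dots> \<le> (real l + 2) * r + r" using r by (intro add_mono mult_left_mono) auto
    finally have B: "real (Suc ((l + 2) * b)) \<le> (real l + 3) * (ln m / ln k)"
      unfolding r_def[symmetric] by (simp add: algebra_simps)
    have "real (Suc ((l + 2) * b) * c) \<le> ((real l + 3) * (ln m / ln k)) * ((C + 1) * (ln k / Lk))"
      unfolding of_nat_mult using lnk lnm9 by (intro mult_mono B c) auto
    also have "\<dots> = (real l + 3) * (C + 1) * (ln m / Lk)" using lnk Lk(3) by (simp add: field_simps)
    also have "\<dots> \<le> (real l + 3) * (C + 1) * (2 * (ln m / L))"
    proof (intro mult_left_mono)
      have "ln m / Lk \<le> ln m / (L / 2)" using Lk lnm9 by (intro divide_left_mono) auto
      then show "ln m / Lk \<le> 2 * (ln m / L)" by (simp add: mult.commute)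
    qed (use C(1) in auto)
    finally have b1: "real (Suc ((l + 2) * b) * c) \<le> 2 * (real l + 3) * (C + 1) * (ln m / L)"
      by (simp only: mult.assoc mult.left_commute)
    have "real (nat \<lfloor>k\<rfloor>) \<le> k" using k3 by simp
    also have "k \<le> 2 * (ln m / L)"
      using L2 Lk(4) k3 unfolding lnm by (simp add: field_simps)
    finally have "real (Suc l * (Suc t * nat \<lfloor>k\<rfloor>)) \<le> (real l + 1) * ((real t + 1) * (2 * (ln m / L)))"
      unfolding of_nat_mult by (intro mult_mono) auto
    then have b2: "real (Suc l * (Suc t * nat \<lfloor>k\<rfloor>)) \<le> 2 * (real l + 1) * (real t + 1) * (ln m / L)"
      by (simp only: mult.assoc mult.left_commute)
    have bound: "real (Suc ((l + 2) * b) * c + Suc l * (Suc t * nat \<lfloor>k\<rfloor>)) \<le> D * (ln m / L)"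
      unfolding D_def of_nat_add
        distrib_right[of "2 * (real l + 3) * (C + 1)" "2 * (real l + 1) * (real t + 1)" "ln m / L"]
      by (rule add_mono[OF b1 b2])
    show ?case
    proof (intro allI impI, elim conjE)
      fix V :: "'a set" and N e n
      assume a: "elimination V N e" "simple_elimination (Suc t) V N" "tree_weight V N n" "\<forall>v\<in>V. n v \<le> m"
      interpret elimination V N e by fact
      interpret weighted_elimination V N e n k m l t
        by unfold_locales (use a k3 step(1) in auto)
      have "\<exists>\<phi>. walk_ranking l V N \<phi> \<and>
        (\<forall>v\<in>V. \<phi> v < Suc ((l + 2) * nat \<lfloor>log k m\<rfloor>) * c + Suc l * (Suc t * nat \<lfloor>k\<rfloor>))"
      proof (rule ranking_step)
        fix V' N' n' assume b: "elimination V' N' e" "simple_elimination t V' N'" "tree_weight V' N' n'"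
          "\<forall>v\<in>V'. n' v \<le> k"
        have "P C k" using elim unfolding k_def by blast
        then obtain \<phi> where \<phi>: "walk_ranking l V' N' \<phi>" "\<forall>v\<in>V'. real (\<phi> v) < C * (ln k / (ln ^^ t) k)"
          using b unfolding P_def by blast
        have "\<phi> v < c" if "v \<in> V'" for v
        proof -
          have "real (\<phi> v) < C * (ln k / Lk)" using \<phi>(2) that unfolding Lk_def by blast
          then show ?thesis unfolding c_def by linarith
        qed
        then show "\<exists>\<phi>. walk_ranking l V' N' \<phi> \<and> (\<forall>v\<in>V'. \<phi> v < c)" using \<phi>(1) by blast
      qed
      then obtain \<phi> where \<phi>: "walk_ranking l V N \<phi>"
        "\<forall>v\<in>V. \<phi> v < Suc ((l + 2) * b) * c + Suc l * (Suc t * nat \<lfloor>k\<rfloor>)"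
        unfolding b_def by blast
      have "real (\<phi> v) < D * (ln m / (ln ^^ Suc t) m)" if "v \<in> V" for v
      proof -
        have "real (\<phi> v) < real (Suc ((l + 2) * b) * c + Suc l * (Suc t * nat \<lfloor>k\<rfloor>))"
          using \<phi>(2) that by (simp only: of_nat_less_iff)
        then show ?thesis using bound unfolding L_def by linarith
      qed
      then show "\<exists>\<phi>. walk_ranking l V N \<phi> \<and> (\<forall>v\<in>V. real (\<phi> v) < D * (ln m / (ln ^^ Suc t) m))"
        using \<phi>(1) by blast
    qed
  qed
  moreover have "0 < 2 * (real l + 3) * (C + 1)" using C(1) by simp
  then have "D > 0" unfolding D_def by (simp add: add_pos_nonneg)
  ultimately show ?case by blast
qed

section \<open>Rooting tree decompositions\<close>

text \<open>A path from \<open>y\<close> to \<open>x\<close> around the edge has at least two arcs,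
  since \<open>x \<noteq> y\<close> and the arc \<open>(y, x)\<close> is removed. Closed by
  \<open>(x, y)\<close> it is a cycle of length at least 3, the only kind that trees exclude
  here.\<close>

lemma tree_edge_bridge:
  assumes "undirected_tree T" "(x, y) \<in> parcs T"
  shows "(y, x) \<notin> (parcs T - {(x, y), (y, x)})\<^sup>*"
proof
  assume r: "(y, x) \<in> (parcs T - {(x, y), (y, x)})\<^sup>*"
  interpret T: pair_graph T using assms unfolding undirected_tree_def by blast
  define T' where "T' = \<lparr>pverts = pverts T, parcs = parcs T - {(x, y), (y, x)}\<rparr>"
  interpret T': pair_wf_digraph T'
    by unfold_locales (auto simp: T'_def dest: T.arc_fst_in_verts T.arc_snd_in_verts)
  have xy: "x \<in> pverts T" "y \<in> pverts T" "x \<noteq> y"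
    using assms(2) T.in_arcsD1 T.in_arcsD2 T.no_loops' by auto
  have "(y, x) \<in> rtrancl_on (pverts T') (parcs T')"
    using r
  proof (induction rule: rtrancl_induct)
    case base
    then show ?case using xy by (simp add: T'_def)
  next
    case (step w z)
    then show ?case using T'.in_arcsD2[of w z] by (auto simp: T'_def intro: rtrancl_on_into_rtrancl_on)
  qed
  then have "y \<rightarrow>\<^sup>*\<^bsub>with_proj T'\<^esub> x" by (simp add: reachable_def)
  then obtain p where p: "T'.apath y p x" using T'.reachable_apath by blast
  then have p': "set p \<subseteq> parcs T'" "pcas y p x" "distinct (pawalk_verts y p)"
    unfolding T'.apath_def T'.awalk_def by auto
  have "2 \<le> length p"
  proof (rule ccontr)
    assume "\<not> 2 \<le> length p"
    then consider "p = []" | e where "p = [e]"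
      by (metis Suc_1 Suc_leI length_0_conv length_Suc_conv less_2_cases_iff linorder_not_le)
    then show False
    proof cases
      case 1
      then show ?thesis using p' xy by simp
    next
      case 2
      then have "e = (y, x)" using p'(2) by (cases e) simp
      then show ?thesis using p'(1) 2 by (simp add: T'_def)
    qed
  qed
  moreover have "T.cycle ((x, y) # p)"
    unfolding T.cycle_def T.awalk_def
    using p' assms(2) xy by (intro exI[of _ x]) (auto simp: T'_def)
  ultimately show False using assms(1) unfolding undirected_tree_def by force
qed

text \<open>The parent \<open>p\<close> is unique: two routes towards the root would bypass an edge, but every edge is a
  bridge.\<close>

lemma tree_rooting:
  assumes "undirected_tree T"
  obtains p :: "'b \<Rightarrow> 'b" and d :: "'b \<Rightarrow> nat" where
    "\<And>x y. (x, y) \<in> parcs T \<Longrightarrow> y = p x \<and> d x = Suc (d y) \<or> x = p y \<and> d y = Suc (d x)"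
proof -
  interpret T: pair_graph T using assms unfolding undirected_tree_def by blast
  let ?E = "parcs T"
  have sym: "(y, x) \<in> ?E" if "(x, y) \<in> ?E" for x y
    using T.pair_sym_arcs that unfolding symmetric_def by (auto dest: symD)
  have bridge: "(y, x) \<notin> (?E - {(x, y), (y, x)})\<^sup>*" if "(x, y) \<in> ?E" for x y
    using tree_edge_bridge[OF assms that] .
  have conn: "connected (with_proj T)" using assms unfolding undirected_tree_def by blast
  then obtain r where r: "r \<in> pverts T" by (auto simp: connected_conv)
  have reach: "\<exists>j. (r, x) \<in> ?E ^^ j" if "x \<in> pverts T" for x
  proof -
    have "(r, x) \<in> rtrancl_on (pverts T) (?E\<^sup>s)" using conn r that by (auto simp: connected_conv)
    then have "(r, x) \<in> ?E\<^sup>*"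
    proof (induction rule: rtrancl_on_induct)
      case (step y z)
      then have "(y, z) \<in> ?E" using sym unfolding symcl_def by auto
      then show ?case using step by (meson rtrancl.rtrancl_into_rtrancl)
    qed simp
    then show ?thesis by (rule rtrancl_imp_relpow)
  qed
  define d where "d x = (LEAST j. (r, x) \<in> ?E ^^ j)" for x
  have d: "(r, x) \<in> ?E ^^ d x" if "x \<in> pverts T" for x
    unfolding d_def using LeastI_ex[OF reach[OF that]] .
  have d_le: "d x \<le> j" if "(r, x) \<in> ?E ^^ j" for x j
    unfolding d_def using that by (rule Least_le)
  have d_Suc: "d y \<le> Suc (d x)" if "(x, y) \<in> ?E" for x y
    using d_le[OF relpow_Suc_I[OF d that]] T.in_arcsD1[OF that] by blast
  define F where "F = {(x, y) \<in> ?E. d y = Suc (d x)}"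
  \<comment> \<open>Shortest paths from the root use only arcs away from it and no vertex deeper
    than their end. This keeps them clear of the edge to be bypassed.\<close>
  have up: "(r, x) \<in> {(a, b) \<in> F. d b \<le> d x}\<^sup>*" if "x \<in> pverts T" for x
    using that
  proof (induction "d x" arbitrary: x)
    case 0
    then have "x = r" using d[OF 0(2)] by simp
    then show ?case by simp
  next
    case (Suc j)
    obtain w where w: "(r, w) \<in> ?E ^^ j" "(w, x) \<in> ?E" using d[OF Suc(3)] Suc(2) by (metis relpow_Suc_E)
    have wV: "w \<in> pverts T" using T.in_arcsD1[OF w(2)] .
    have "d w = j" using d_le[OF w(1)] d_Suc[OF w(2)] Suc(2) by linarith
    then have "(r, w) \<in> {(a, b) \<in> F. d b \<le> d w}\<^sup>*" "(w, x) \<in> F"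
      using Suc(1)[OF _ wV] w(2) Suc(2) unfolding F_def by auto
    moreover have "{(a, b) \<in> F. d b \<le> d w}\<^sup>* \<subseteq> {(a, b) \<in> F. d b \<le> d x}\<^sup>*"
      using \<open>d w = j\<close> Suc(2) by (intro rtrancl_mono) auto
    moreover have "(w, x) \<in> {(a, b) \<in> F. d b \<le> d x}" using \<open>(w, x) \<in> F\<close> by simp
    ultimately show ?case by (meson rtrancl.rtrancl_into_rtrancl subsetD)
  qed
  have conn2: "(x, y) \<in> G\<^sup>*"
    if "x \<in> pverts T" "y \<in> pverts T" "sym G" "{(a, b) \<in> F. d b \<le> d x} \<subseteq> G" "{(a, b) \<in> F. d b \<le> d y} \<subseteq> G" for x y G
  proof -
    have "(r, x) \<in> G\<^sup>*" "(r, y) \<in> G\<^sup>*" using up that rtrancl_mono by blast+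
    then show ?thesis using that(3) by (meson sym_rtrancl symD rtrancl_trans)
  qed
  have symE: "sym (?E - {(x, y), (y, x)})" for x y using sym by (auto simp: sym_def)
  have ne: "d x \<noteq> d y" if "(x, y) \<in> ?E" for x y
  proof
    assume eq: "d x = d y"
    have "F \<subseteq> ?E - {(x, y), (y, x)}"
    proof (rule subrelI)
      fix a b assume "(a, b) \<in> F"
      then have "(a, b) \<in> ?E" "d b \<noteq> d a" unfolding F_def by auto
      then show "(a, b) \<in> ?E - {(x, y), (y, x)}" using eq by auto
    qed
    then have "(y, x) \<in> (?E - {(x, y), (y, x)})\<^sup>*"
      by (intro conn2 T.in_arcsD1[OF that] T.in_arcsD2[OF that] symE) auto
    then show False using bridge[OF that] by blast
  qed
  \<comment> \<open>Shortest paths to \<open>y\<close> and \<open>y'\<close> stay above the depth of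
    \<open>x\<close>, so they avoid the edge between \<open>x\<close> and \<open>y\<close>;
    continued by the arc from \<open>y'\<close> to \<open>x\<close> they bypass it.\<close>
  have uniq: "y = y'" if "(x, y) \<in> ?E" "(x, y') \<in> ?E" "d x = Suc (d y)" "d x = Suc (d y')" for x y y'
  proof (rule ccontr)
    assume nq: "y \<noteq> y'"
    let ?G = "?E - {(x, y), (y, x)}"
    have sub: "{(a, b) \<in> F. d b \<le> d z} \<subseteq> ?G" if "d z = d y" for z
    proof (rule subrelI)
      fix a b assume "(a, b) \<in> {(a, b) \<in> F. d b \<le> d z}"
      then have "(a, b) \<in> ?E" "d b \<le> d y" "d a \<le> d y" using that unfolding F_def by auto
      then show "(a, b) \<in> ?G" using \<open>d x = Suc (d y)\<close> by auto
    qed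
    have "(y, y') \<in> ?G\<^sup>*"
      using that(3,4) by (intro conn2 T.in_arcsD2[OF that(1)] T.in_arcsD2[OF that(2)] symE sub) auto
    moreover have "(y', x) \<in> ?G" using sym[OF that(2)] nq T.no_loops'[OF that(2)] by auto
    ultimately have "(y, x) \<in> ?G\<^sup>*" by (rule rtrancl.rtrancl_into_rtrancl)
    then show False using bridge[OF that(1)] by blast
  qed
  define p where "p x = (THE y. (x, y) \<in> ?E \<and> d x = Suc (d y))" for x
  have p: "p x = y" if "(x, y) \<in> ?E" "d x = Suc (d y)" for x y
    unfolding p_def using that uniq by (intro the_equality) blast+
  show thesis
  proof (rule that[of p d])
    fix x y assume xy: "(x, y) \<in> ?E"
    have "d x = Suc (d y) \<or> d y = Suc (d x)"
      using ne[OF xy] d_Suc[OF xy] d_Suc[OF sym[OF xy]] by linarith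
    then show "y = p x \<and> d x = Suc (d y) \<or> x = p y \<and> d y = Suc (d x)"
      using p[OF xy] p[OF sym[OF xy]] by auto
  qed
qed

section \<open>Subtrees of a rooted tree\<close>

definition parent_rel :: "('b \<Rightarrow> 'b) \<Rightarrow> ('b \<Rightarrow> nat) \<Rightarrow> 'b set \<Rightarrow> 'b rel" where
  "parent_rel p d S = {(y, x). y = p x \<and> d x = Suc (d y) \<and> x \<in> S \<and> y \<in> S}"

lemma parent_rel_depth: "(x, y) \<in> (parent_rel p d S)\<^sup>* \<Longrightarrow> d x \<le> d y"
  by (induction rule: rtrancl_induct) (auto simp: parent_rel_def)

text \<open>Going up from \<open>x\<close> leaves no choice, so the route in \<open>S\<close> to
  \<open>x\<^sub>0\<close>, which is no deeper than \<open>a\<close>, passes through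
  \<open>a\<close>. The sets differ because they will be the nodes whose bags contain two different
  vertices.\<close>

lemma parent_rel_between:
  assumes "(x\<^sub>0, x) \<in> (parent_rel p d S)\<^sup>*" "(a, x) \<in> (parent_rel p d U)\<^sup>*" "d x\<^sub>0 \<le> d a"
  shows "(x\<^sub>0, a) \<in> (parent_rel p d S)\<^sup>*"
proof -
  have "(x\<^sub>0, x) \<in> (parent_rel p d S)\<^sup>* \<longrightarrow> (x\<^sub>0, a) \<in> (parent_rel p d S)\<^sup>*"
    using assms(2)
  proof (induction rule: rtrancl_induct)
    case (step y z)
    have yz: "y = p z" "d z = Suc (d y)" using step(2) by (auto simp: parent_rel_def)
    show ?case
    proof
      assume "(x\<^sub>0, z) \<in> (parent_rel p d S)\<^sup>*"
      then have "(x\<^sub>0, y) \<in> (parent_rel p d S)\<^sup>*"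
      proof (cases rule: rtranclE)
        case base
        then have "d x\<^sub>0 = Suc (d y)" using yz(2) by metis
        then show ?thesis using assms(3) parent_rel_depth[OF step(1)] by linarith
      next
        case (step w)
        then have "w = y" using yz(1) unfolding parent_rel_def by blast
        then show ?thesis using step(1) by blast
      qed
      then show "(x\<^sub>0, a) \<in> (parent_rel p d S)\<^sup>*" using step(3) by blast
    qed
  qed simp
  then show ?thesis using assms(1) by blast
qed

text \<open>From a node of least depth, each step of an undirected walk in \<open>S\<close> either
  extends the current descending path or undoes its last arc; it never climbs above the
  start.\<close>

lemma connected_subtree_top:
  assumes edge: "\<And>x y. (x, y) \<in> parcs T \<Longrightarrow> y = p x \<and> d x = Suc (d y) \<or> x = p y \<and> d y = Suc (d x)"
    and conn: "connected (with_proj T \<restriction> S)"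
  shows "\<exists>x\<^sub>0\<in>S. \<forall>x\<in>S. (x\<^sub>0, x) \<in> (parent_rel p d S)\<^sup>*"
proof -
  have "S \<noteq> {}" using conn by (auto simp: connected_conv)
  then obtain x\<^sub>0 where x0: "x\<^sub>0 \<in> S" "\<And>x. x \<in> S \<Longrightarrow> d x\<^sub>0 \<le> d x"
    using ex_has_least_nat[of "\<lambda>x. x \<in> S" _ d] by blast
  have "(x\<^sub>0, x) \<in> (parent_rel p d S)\<^sup>*" if "x \<in> S" for x
  proof -
    have "(x\<^sub>0, x) \<in> rtrancl_on S ((arcs_ends (with_proj T \<restriction> S))\<^sup>s)"
      using conn x0 that by (auto simp: connected_conv)
    then show ?thesis
    proof (induction rule: rtrancl_on_induct)
      case (step y z)
      have "(y, z) \<in> parcs T \<or> (z, y) \<in> parcs T"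
        using step(2) by (auto simp: symcl_def arcs_ends_conv)
      then have "z = p y \<and> d y = Suc (d z) \<or> y = p z \<and> d z = Suc (d y)" using edge by blast
      then show ?case
      proof
        assume a: "y = p z \<and> d z = Suc (d y)"
        then have "(y, z) \<in> parent_rel p d S" using step by (simp add: parent_rel_def)
        then show ?thesis using step(5) by (rule rtrancl.rtrancl_into_rtrancl[rotated])
      next
        assume a: "z = p y \<and> d y = Suc (d z)"
        have "y \<noteq> x\<^sub>0" using a x0(2)[OF step(4)] by auto
        with step(5) obtain w where w: "(x\<^sub>0, w) \<in> (parent_rel p d S)\<^sup>*" "(w, y) \<in> parent_rel p d S"
          by (metis rtranclE)
        then have "w = z" using a unfolding parent_rel_def by blast
        then show ?thesis using w(1) by blast
      qed
    qed simp
  qed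
  then show ?thesis using x0(1) by blast
qed

text \<open>Vertices are ordered by the depth of the topmost node whose bag contains them, with ties
  broken by a numbering, and \<open>N v\<close> is the earlier part of that topmost bag. If two
  vertices share some bag, the earlier one is in the topmost bag of the later one; this yields both
  the clique condition and the edges.\<close>

lemma simple_tree_decomposition_elimination:
  fixes G :: "'a pair_pre_digraph"
  assumes "pair_graph G" "simple_tree_decomposition t G T B"
  shows "\<exists>N e. elimination (pverts G) N e \<and> simple_elimination t (pverts G) N \<and>
    (\<forall>(u, v)\<in>parcs G. adjacent N u v)"
proof -
  interpret G: pair_graph G by fact
  let ?V = "pverts G"
  have td: "tree_decomposition G T B" and width: "decomposition_width T B = int t"
    and two: "\<And>S. S \<subseteq> ?V \<Longrightarrow> card S = t \<Longrightarrow> card {x \<in> pverts T. S \<subseteq> B x} \<le> 2"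
    using assms(2) unfolding simple_tree_decomposition_def by auto
  have tree: "undirected_tree T" and bag: "\<And>x. x \<in> pverts T \<Longrightarrow> B x \<subseteq> ?V"
    and conn: "\<And>v. v \<in> ?V \<Longrightarrow> connected (with_proj T \<restriction> {x \<in> pverts T. v \<in> B x})"
    and cover: "\<And>u v. (u, v) \<in> parcs G \<Longrightarrow> \<exists>x\<in>pverts T. u \<in> B x \<and> v \<in> B x"
    using td unfolding tree_decomposition_def by auto
  interpret T: pair_graph T using tree unfolding undirected_tree_def by blast
  have finV: "finite ?V" by (rule G.pair_finite_verts)
  have finT: "finite (pverts T)" by (rule T.pair_finite_verts)
  have card_bag: "card (B x) \<le> Suc t" if "x \<in> pverts T" for x
  proof -
    have "card (B x) \<le> Max ((\<lambda>x. card (B x)) ` pverts T)" using finT that by (intro Max_ge) auto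
    then show ?thesis using width unfolding decomposition_width_def by linarith
  qed
  have fin_bag: "finite (B x)" if "x \<in> pverts T" for x using finite_subset[OF bag[OF that] finV] .
  obtain p d where edge: "\<And>x y. (x, y) \<in> parcs T \<Longrightarrow> y = p x \<and> d x = Suc (d y) \<or> x = p y \<and> d y = Suc (d x)"
    using tree_rooting[OF tree] by blast
  define S where "S v = {x \<in> pverts T. v \<in> B x}" for v
  have "\<exists>x\<^sub>0\<in>S v. \<forall>x\<in>S v. (x\<^sub>0, x) \<in> (parent_rel p d (S v))\<^sup>*" if "v \<in> ?V" for v
    unfolding S_def by (rule connected_subtree_top[OF edge conn[OF that]])
  then obtain top where top: "\<And>v. v \<in> ?V \<Longrightarrow> top v \<in> S v"
    "\<And>v x. v \<in> ?V \<Longrightarrow> x \<in> S v \<Longrightarrow> (top v, x) \<in> (parent_rel p d (S v))\<^sup>*"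
    by metis
  obtain f :: "'a \<Rightarrow> nat" where f: "inj_on f ?V" "f ` ?V \<subseteq> {..<card ?V}"
    using finite_inj_index[OF finV order_refl] by blast
  define e where "e v = d (top v) * card ?V + f v" for v
  have f_lt: "v \<in> ?V \<Longrightarrow> f v < card ?V" for v using f(2) by blast
  have e_inj: "u = v" if "u \<in> ?V" "v \<in> ?V" "e u = e v" for u v
    using digit_inject(2)[OF that(3)[unfolded e_def] f_lt[OF that(1)] f_lt[OF that(2)]] f(1) that by (meson inj_onD)
  have e_d: "d (top u) \<le> d (top v)" if "u \<in> ?V" "v \<in> ?V" "e u < e v" for u v
  proof (rule ccontr)
    assume "\<not> ?thesis"
    then have "e v < d (top u) * card ?V"
      unfolding e_def using f_lt[OF that(2)] by (intro digit_less) auto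
    then show False using that(3) unfolding e_def by simp
  qed
  have between: "u \<in> B (top w)" if "u \<in> ?V" "w \<in> ?V" "e u < e w" "x \<in> S u" "x \<in> S w" for u w x
  proof -
    have "(top u, top w) \<in> (parent_rel p d (S u))\<^sup>*"
      using parent_rel_between[OF top(2)[OF that(1,4)] top(2)[OF that(2,5)] e_d[OF that(1-3)]] .
    moreover have "top u \<in> S u" using top(1)[OF that(1)] .
    ultimately have "top w \<in> S u" by (induction rule: rtrancl_induct) (auto simp: parent_rel_def)
    then show ?thesis by (simp add: S_def)
  qed
  define N where "N v = {u \<in> B (top v). u \<in> ?V \<and> e u < e v}" for v
  have topT: "top v \<in> pverts T" "v \<in> B (top v)" if "v \<in> ?V" for v
    using top(1)[OF that] by (auto simp: S_def)
  have mem: "u \<in> N w" if "u \<in> ?V" "w \<in> ?V" "e u < e w" "x \<in> S u" "x \<in> S w" for u w x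
    using between[OF that] that unfolding N_def by simp
  have e1: "elimination ?V N e"
  proof
    fix v u w assume v: "v \<in> ?V" and u: "u \<in> N v" and w: "w \<in> N v" and "u \<noteq> w"
    have uw: "u \<in> ?V" "w \<in> ?V" "top v \<in> S u" "top v \<in> S w"
      using u w topT[OF v] by (auto simp: N_def S_def)
    have "e u < e w \<or> e w < e u" using e_inj[OF uw(1,2)] \<open>u \<noteq> w\<close> by (meson linorder_neqE_nat)
    then show "u \<in> N w \<or> w \<in> N u" using mem uw by blast
  qed (use finV in \<open>auto simp: N_def\<close>)
  \<comment> \<open>Bags have at most \<open>t + 1\<close> vertices, so a \<open>t\<close>-element
    \<open>N v\<close> leaves room only for \<open>v\<close>.\<close>
  have fullbag: "B (top v) = insert v (N v)" if v: "v \<in> ?V" and c: "card (N v) = t" for v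
  proof (rule sym, rule card_seteq)
    show "finite (B (top v))" using fin_bag topT v by blast
    show "insert v (N v) \<subseteq> B (top v)" using topT[OF v] by (auto simp: N_def)
    have "finite (N v)" using fin_bag[OF topT(1)[OF v]] by (simp add: N_def)
    moreover have "v \<notin> N v" by (simp add: N_def)
    ultimately show "card (B (top v)) \<le> card (insert v (N v))" using card_bag[OF topT(1)[OF v]] c by simp
  qed
  have "card (N v) \<le> t" if v: "v \<in> ?V" for v
  proof -
    have fin: "finite (B (top v))" using fin_bag topT v by blast
    have "insert v (N v) \<subseteq> B (top v)" using topT[OF v] by (auto simp: N_def)
    then have "card (insert v (N v)) \<le> Suc t" using card_mono[OF fin] card_bag[OF topT(1)[OF v]] le_trans by blast
    moreover have "v \<notin> N v" "finite (N v)" using fin by (auto simp: N_def)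
    ultimately show ?thesis by simp
  qed
  moreover have "card {v \<in> ?V. N v = X} \<le> (if card (N s) < t then 2 else 1)"
    if s: "s \<in> ?V" and X: "X \<subseteq> ?V" "card X = t" "s \<in> X" "X - {s} \<subseteq> N s" for s X
  proof -
    let ?K = "{v \<in> ?V. N v = X}" and ?Z = "{x \<in> pverts T. X \<subseteq> B x}"
    have finZ: "finite ?Z" using finT by simp
    have Z2: "card ?Z \<le> 2" using two X by blast
    have sub: "top ` ?K \<subseteq> ?Z" using topT by (auto simp: N_def)
    \<comment> \<open>The full bags \<open>insert v X\<close> differ for different \<open>v\<close>,
      so every occurrence of \<open>X\<close> uses up one of the at most two nodes containing
      \<open>X\<close>.\<close>
    have inj: "inj_on top ?K"
    proof (rule inj_onI)
      fix v w assume v: "v \<in> ?K" and w: "w \<in> ?K" and eq: "top v = top w"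
      have "insert v X = insert w X" using fullbag[of v] fullbag[of w] v w eq X(2) by auto
      moreover have "v \<notin> N v" "w \<notin> N w" by (auto simp: N_def)
      ultimately show "v = w" using v w by blast
    qed
    show ?thesis
    proof (cases "card (N s) < t")
      case True
      then show ?thesis using card_inj_on_le[OF inj sub finZ] Z2 by simp
    next
      case False
      then have Ns: "card (N s) = t" using \<open>\<And>v. v \<in> ?V \<Longrightarrow> card (N v) \<le> t\<close>[OF s] by simp
      have sZ: "top s \<in> ?Z" using topT[OF s] X by (auto simp: N_def)
      \<comment> \<open>A full \<open>N s\<close> provides one more node containing
        \<open>X\<close>. If it coincided with that of \<open>v\<close>, equality of the full bags
        would place \<open>v\<close> before \<open>s\<close>, although
        \<open>s \<in> N v\<close>.\<close>
      have "top s \<notin> top ` ?K"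
      proof
        assume "top s \<in> top ` ?K"
        then obtain v where v: "v \<in> ?V" "N v = X" "top s = top v" by auto
        then have "insert s (N s) = insert v X" using fullbag[OF s Ns] fullbag[OF v(1)] X(2) by simp
        moreover have "s \<in> N v" using v X(3) by simp
        then have "e s < e v" by (simp add: N_def)
        ultimately have "v \<in> N s" by auto
        then show False using \<open>e s < e v\<close> by (simp add: N_def)
      qed
      then have "card (insert (top s) (top ` ?K)) = Suc (card ?K)"
        using card_image[OF inj] finV by simp
      moreover have "card (insert (top s) (top ` ?K)) \<le> card ?Z"
        using sub sZ finZ by (intro card_mono) auto
      ultimately show ?thesis using Z2 False by simp
    qed
  qed
  ultimately have "simple_elimination t ?V N" unfolding simple_elimination_def by blast
  moreover have "adjacent N u v" if uv: "(u, v) \<in> parcs G" for u v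
  proof -
    obtain x where "x \<in> pverts T" "u \<in> B x" "v \<in> B x" using cover[OF uv] by blast
    then have x: "x \<in> S u" "x \<in> S v" by (auto simp: S_def)
    have V: "u \<in> ?V" "v \<in> ?V" "u \<noteq> v" using G.in_arcsD1[OF uv] G.in_arcsD2[OF uv] G.no_loops'[OF uv] by auto
    then have "e u < e v \<or> e v < e u" using e_inj[OF V(1,2)] by (meson linorder_neqE_nat)
    then show ?thesis using mem V x unfolding adjacent_def by blast
  qed
  ultimately show ?thesis using e1 by blast
qed

section \<open>The upper bound\<close>

text \<open>For \<open>t < t'\<close> no \<open>N v\<close> is large enough to equal a
  \<open>t'\<close>-set, so there is nothing to count.\<close>

lemma simple_elimination_mono:
  assumes "simple_elimination t V N" "t \<le> t'" shows "simple_elimination t' V N"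
proof (cases "t = t'")
  case False
  have c: "card (N v) \<le> t" if "v \<in> V" for v using assms that unfolding simple_elimination_def by blast
  have z: "card {v \<in> V. N v = S} = 0" if "card S = t'" for S
  proof -
    have "N v \<noteq> S" if "v \<in> V" for v using c[OF that] \<open>card S = t'\<close> assms(2) False by auto
    then have "{v \<in> V. N v = S} = {}" by blast
    then show ?thesis by (simp only: card.empty)
  qed
  show ?thesis unfolding simple_elimination_def
  proof (intro conjI ballI allI impI)
    show "card (N v) \<le> t'" if "v \<in> V" for v using c[OF that] assms(2) by simp
  qed (simp add: z)
qed (use assms in simp)

text \<open>By \<open>anc_chain\<close>, incomparable vertices have disjoint sets of
  descendants.\<close>

lemma (in elimination) descendant_tree_weight:
  "tree_weight V N (\<lambda>v. real (card {w \<in> V. anc v w}))"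
  unfolding tree_weight_def
proof (intro conjI ballI allI impI)
  fix v assume "v \<in> V"
  then have "{v} \<subseteq> {w \<in> V. anc v w}" by auto
  then have "card {v} \<le> card {w \<in> V. anc v w}" using finite_V by (intro card_mono) auto
  then show "1 \<le> real (card {w \<in> V. anc v w})" by simp
next
  fix a A assume "a \<in> V" "A \<subseteq> V" and h: "(\<forall>x\<in>A. anc a x) \<and> (\<forall>x\<in>A. \<forall>y\<in>A. anc x y \<longrightarrow> x = y)"
  have finA: "finite A" using \<open>A \<subseteq> V\<close> finite_V finite_subset by blast
  have disj: "{w \<in> V. anc x w} \<inter> {w \<in> V. anc y w} = {}" if "x \<in> A" "y \<in> A" "x \<noteq> y" for x y
    using anc_chain[of _ x y] h that by blast
  have "card (\<Union>x\<in>A. {w \<in> V. anc x w}) = (\<Sum>x\<in>A. card {w \<in> V. anc x w})"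
    using finA finite_V disj by (intro card_UN_disjoint) auto
  moreover have "card (\<Union>x\<in>A. {w \<in> V. anc x w}) \<le> card {w \<in> V. anc a w}"
    using finite_V h anc_trans by (intro card_mono) auto
  ultimately show "(\<Sum>x\<in>A. real (card {w \<in> V. anc x w})) \<le> real (card {w \<in> V. anc a w})"
    by (metis of_nat_le_iff of_nat_sum)
qed

section \<open>From walk rankings to the ranking number\<close>

lemma vwalk_successively:
  "set (vwalk_arcs us) \<subseteq> R \<Longrightarrow> (\<And>u v. (u, v) \<in> R \<Longrightarrow> P u v) \<Longrightarrow> successively P us"
  by (induction us rule: vwalk_arcs.induct) auto

lemma walk_ranking_ranking_number_le:
  assumes "walk_ranking l (pverts G) N \<phi>" "\<forall>(u, v)\<in>parcs G. adjacent N u v"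
    "\<forall>v\<in>pverts G. \<phi> v < k"
  shows "ranking_number l G \<le> k"
  unfolding ranking_number_def
proof (rule Least_le, intro exI conjI)
  show "is_ranking l G (\<lambda>v. Suc (\<phi> v))"
    unfolding is_ranking_def
  proof (intro allI impI, elim conjE)
    fix us assume us: "vpath us (with_proj G)" "1 \<le> vwalk_length us" "vwalk_length us \<le> l"
    then have w: "us \<noteq> []" "set us \<subseteq> pverts G" "set (vwalk_arcs us) \<subseteq> parcs G" "distinct us"
      by (auto simp: vpath_def vwalk_def)
    obtain a b bs where ab: "us = a # b # bs"
      using us(2) w(1) by (cases us; cases "tl us") auto
    then have "hd us \<noteq> last us" using w(4) by auto
    moreover have "successively (adjacent N) us"
      using w(3) by (rule vwalk_successively) (use assms(2) in auto)
    ultimately have "\<phi> (hd us) \<noteq> \<phi> (last us) \<or> (\<exists>z\<in>set us. \<phi> (hd us) < \<phi> z)"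
      using walk_rankingD[OF assms(1) w(1,2)] us(3) by auto
    then show "Suc (\<phi> (hd us)) \<noteq> Suc (\<phi> (last us)) \<or> Suc (\<phi> (hd us)) < Max ((\<lambda>v. Suc (\<phi> v)) ` set us)"
      using w(1) by (auto simp: Max_gr_iff)
  qed
  show "(\<lambda>v. Suc (\<phi> v)) ` pverts G \<subseteq> {1..k}" using assms(3) by auto
qed

lemma simple_tree_decomposition_exists:
  assumes "pair_graph G" "pverts G \<noteq> {}"
  shows "simple_tree_decomposition (card (pverts G) - 1) G \<lparr>pverts = {0::nat}, parcs = {}\<rparr> (\<lambda>_. pverts G)"
proof -
  interpret G: pair_graph G by fact
  let ?T = "\<lparr>pverts = {0::nat}, parcs = {}\<rparr>"
  interpret T: pair_graph ?T by unfold_locales (auto simp: symmetric_def sym_def)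
  have "\<not> T.cycle p" for p unfolding T.cycle_def T.awalk_def by auto
  moreover have "connected (with_proj ?T)" by (auto simp: connected_conv)
  ultimately have tree: "undirected_tree ?T" unfolding undirected_tree_def using T.pair_graph by blast
  have conn: "connected (with_proj ?T \<restriction> {x \<in> pverts ?T. v \<in> pverts G})" if "v \<in> pverts G" for v
    using that by (auto simp: connected_conv)
  show ?thesis
    unfolding simple_tree_decomposition_def tree_decomposition_def
  proof (intro conjI allI impI ballI tree conn)
    have "0 < card (pverts G)" using assms(2) G.pair_finite_verts by (simp add: card_gt_0_iff)
    then show "decomposition_width ?T (\<lambda>_. pverts G) = int (card (pverts G) - 1)"
      by (simp add: decomposition_width_def of_nat_diff)
    fix S assume "S \<subseteq> pverts G \<and> card S = card (pverts G) - 1"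
    have "card {x \<in> pverts ?T. S \<subseteq> pverts G} \<le> card {0::nat}" by (rule card_mono) auto
    then show "card {x \<in> pverts ?T. S \<subseteq> pverts G} \<le> 2" by simp
  qed (auto dest: G.in_arcsD1 G.in_arcsD2)
qed

lemma simple_treewidth_elimination:
  assumes "pair_graph G" "pverts G \<noteq> {}"
  shows "\<exists>N e. elimination (pverts G) N e \<and> simple_elimination (simple_treewidth G) (pverts G) N \<and>
    (\<forall>(u, v)\<in>parcs G. adjacent N u v)"
proof -
  have "\<exists>t. \<exists>(T :: nat pair_pre_digraph) B. simple_tree_decomposition t G T B"
    using simple_tree_decomposition_exists[OF assms] by blast
  then have "\<exists>(T :: nat pair_pre_digraph) B. simple_tree_decomposition (simple_treewidth G) G T B"
    unfolding simple_treewidth_def by (rule LeastI_ex)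
  then show ?thesis using simple_tree_decomposition_elimination[OF assms(1)] by blast
qed

text \<open>The initial weights are numbers of descendants, so \<open>m\<close> can be taken as the
  number of vertices.\<close>

lemma ranking_number_upper_bound:
  assumes "1 \<le> t"
  shows "\<exists>C>0. \<exists>n\<^sub>0::nat. \<forall>n\<ge>n\<^sub>0. \<forall>H :: 'a pair_pre_digraph.
    pair_graph H \<and> card (pverts H) = n \<and> simple_treewidth H \<le> t \<longrightarrow>
    real (ranking_number l H) \<le> C * (ln (real n) / (ln ^^ t) (real n))"
proof -
  define P where "P C m \<longleftrightarrow> (\<forall>(V :: 'a set) N e n. elimination V N e \<and> simple_elimination t V N \<and>
    tree_weight V N n \<and> (\<forall>v\<in>V. n v \<le> m) \<longrightarrow>
    (\<exists>\<phi>. walk_ranking l V N \<phi> \<and> (\<forall>v\<in>V. real (\<phi> v) < C * (ln m / (ln ^^ t) m))))" for C m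
  obtain C where C: "C > 0" "\<forall>\<^sub>F m in at_top. P C m"
    using elimination_ranking_bound[OF assms] unfolding P_def by blast
  have "\<forall>\<^sub>F m in at_top. ((ln :: real \<Rightarrow> real) ^^ t) m \<le> ln m \<and> 1 \<le> (ln ^^ t) m \<and> 1 \<le> m \<and> P C m"
    using C(2) eventually_iterated_ln_le[OF assms] eventually_ge_at_top[of 1]
      filterlim_iterated_ln[of t, unfolded filterlim_at_top, rule_format, of 1]
    by eventually_elim auto
  then obtain M where M: "\<And>m. m \<ge> M \<Longrightarrow> ((ln :: real \<Rightarrow> real) ^^ t) m \<le> ln m \<and> 1 \<le> (ln ^^ t) m \<and> 1 \<le> m \<and> P C m"
    unfolding eventually_at_top_linorder by blast
  have "real (ranking_number l H) \<le> (C + 1) * (ln (real n) / (ln ^^ t) (real n))"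
    if "nat \<lceil>M\<rceil> \<le> n" and H: "pair_graph H" "card (pverts H) = n" "simple_treewidth H \<le> t"
    for n and H :: "'a pair_pre_digraph"
  proof -
    let ?q = "ln (real n) / (ln ^^ t) (real n)"
    have "M \<le> real n" using that(1) by linarith
    note M = M[OF this]
    have "pverts H \<noteq> {}" using M H(2) by auto
    then obtain N e where N: "elimination (pverts H) N e" "simple_elimination t (pverts H) N"
      "\<forall>(u, v)\<in>parcs H. adjacent N u v"
      using simple_treewidth_elimination[OF H(1)] simple_elimination_mono[OF _ H(3)] by blast
    interpret elimination "pverts H" N e by fact
    have "\<forall>v\<in>pverts H. real (card {w \<in> pverts H. anc v w}) \<le> real n"
      using card_mono[OF finite_V, of "{w \<in> pverts H. anc _ w}"] H(2) by auto
    then obtain \<phi> where \<phi>: "walk_ranking l (pverts H) N \<phi>" "\<forall>v\<in>pverts H. real (\<phi> v) < C * ?q"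
      using M N(1,2) descendant_tree_weight unfolding P_def by blast
    have "\<phi> v < nat \<lceil>C * ?q\<rceil>" if "v \<in> pverts H" for v
    proof -
      have "real (\<phi> v) < C * ?q" using \<phi>(2) that by blast
      then show ?thesis by linarith
    qed
    then have "ranking_number l H \<le> nat \<lceil>C * ?q\<rceil>"
      using walk_ranking_ranking_number_le[OF \<phi>(1) N(3)] by blast
    moreover have q: "1 \<le> ?q" using M by simp
    moreover have "0 \<le> C * ?q" using q C(1) by (intro mult_nonneg_nonneg) auto
    ultimately have "real (ranking_number l H) \<le> C * ?q + 1" by linarith
    also have "\<dots> \<le> (C + 1) * ?q" using q unfolding distrib_right by linarith
    finally show ?thesis .
  qed
  moreover have "0 < C + 1" using C(1) by simp
  ultimately show ?thesis by blast
qed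

section \<open>Tree decompositions of elimination graphs\<close>

text \<open>Numbers are their own elimination order. A \<open>t\<close>-set occurs at most once as
  \<open>N v\<close>, without the exception made in \<open>simple_elimination\<close>, because here
  the bags \<open>insert v (N v)\<close> are all present and must form a \<open>t\<close>-simple
  decomposition themselves.\<close>

definition strict_elimination :: "nat \<Rightarrow> nat \<Rightarrow> (nat \<Rightarrow> nat set) \<Rightarrow> bool" where
  "strict_elimination t n N \<longleftrightarrow>
     (\<forall>v<n. N v \<subseteq> {..<v} \<and> card (N v) \<le> t \<and> (\<forall>u\<in>N v. \<forall>w\<in>N v. u < w \<longrightarrow> u \<in> N w)) \<and>
     (\<forall>v<n. \<forall>w<n. N v = N w \<and> card (N v) = t \<longrightarrow> v = w)"

text \<open>Guarantees a bag with \<open>t + 1\<close> vertices, so that the width is exactly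
  \<open>t\<close>, as \<open>simple_tree_decomposition\<close> demands.\<close>

definition full_elimination :: "nat \<Rightarrow> nat \<Rightarrow> (nat \<Rightarrow> nat set) \<Rightarrow> bool" where
  "full_elimination t n N \<longleftrightarrow> (\<exists>v<n. card (N v) = t)"

definition elimination_graph :: "nat \<Rightarrow> (nat \<Rightarrow> nat set) \<Rightarrow> nat pair_pre_digraph" where
  "elimination_graph n N = \<lparr>pverts = {..<n}, parcs = {(u, v). u < n \<and> v < n \<and> adjacent N u v}\<rparr>"

definition two_ranking :: "nat \<Rightarrow> (nat \<Rightarrow> nat set) \<Rightarrow> (nat \<Rightarrow> nat) \<Rightarrow> bool" where
  "two_ranking n N \<phi> \<longleftrightarrow>
     (\<forall>u<n. \<forall>v<n. adjacent N u v \<longrightarrow> \<phi> u \<noteq> \<phi> v) \<and>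
     (\<forall>u<n. \<forall>x<n. \<forall>v<n. adjacent N u x \<and> adjacent N x v \<and> u \<noteq> v \<and> \<phi> u = \<phi> v \<longrightarrow> \<phi> u < \<phi> x)"

definition colourable :: "nat \<Rightarrow> nat \<Rightarrow> (nat \<Rightarrow> nat set) \<Rightarrow> bool" where
  "colourable k n N \<longleftrightarrow> (\<exists>\<phi>. two_ranking n N \<phi> \<and> \<phi> ` {..<n} \<subseteq> {1..k})"

lemma adjacent_commute: "adjacent N u v \<longleftrightarrow> adjacent N v u"
  by (auto simp: adjacent_def)

lemma strict_eliminationD:
  assumes "strict_elimination t n N" "v < n"
  shows "N v \<subseteq> {..<v}" "card (N v) \<le> t" "u \<in> N v \<Longrightarrow> w \<in> N v \<Longrightarrow> u < w \<Longrightarrow> u \<in> N w"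
  using assms unfolding strict_elimination_def by blast+

lemma strict_elimination_inj:
  assumes "strict_elimination t n N" "v < n" "w < n" "N v = N w" "card (N v) = t" shows "v = w"
  using assms unfolding strict_elimination_def by blast

lemma strict_elimination_adjacent_neq:
  assumes "strict_elimination t n N" "u < n" "v < n" "adjacent N u v" shows "u \<noteq> v"
  using assms strict_eliminationD(1)[OF assms(1)] unfolding adjacent_def by blast

lemma pair_graph_elimination_graph:
  assumes "strict_elimination t n N" shows "pair_graph (elimination_graph n N)"
proof
  show "symmetric (with_proj (elimination_graph n N))"
    by (auto simp: elimination_graph_def symmetric_def sym_def adjacent_def)
  have "parcs (elimination_graph n N) \<subseteq> {..<n} \<times> {..<n}" by (auto simp: elimination_graph_def)
  then show "finite (parcs (elimination_graph n N))" by (rule finite_subset) simp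
  fix e assume "e \<in> parcs (elimination_graph n N)"
  then show "fst e \<noteq> snd e" using strict_elimination_adjacent_neq[OF assms]
    by (auto simp: elimination_graph_def)
qed (auto simp: elimination_graph_def)

lemma is_ranking_imp_two_ranking:
  assumes "is_ranking 2 (elimination_graph n N) \<phi>" "strict_elimination t n N"
  shows "two_ranking n N \<phi>"
proof -
  have r: "\<phi> (hd us) \<noteq> \<phi> (last us) \<or> \<phi> (hd us) < Max (\<phi> ` set us)"
    if "vpath us (with_proj (elimination_graph n N))" "1 \<le> vwalk_length us" "vwalk_length us \<le> 2" for us
    using assms(1) that unfolding is_ranking_def by blast
  have "\<phi> u \<noteq> \<phi> v" if "u < n" "v < n" "adjacent N u v" for u v
  proof -
    have "u \<noteq> v" using strict_elimination_adjacent_neq[OF assms(2) that] .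
    then show ?thesis using r[of "[u, v]"] that
      by (auto simp: vpath_def vwalk_def elimination_graph_def)
  qed
  moreover have "\<phi> u < \<phi> x" if "u < n" "x < n" "v < n" "adjacent N u x" "adjacent N x v" "u \<noteq> v" "\<phi> u = \<phi> v" for u x v
  proof -
    have "u \<noteq> x" "x \<noteq> v" using strict_elimination_adjacent_neq[OF assms(2)] that by blast+
    then show ?thesis using r[of "[u, x, v]"] that
      by (auto simp: vpath_def vwalk_def elimination_graph_def max_def split: if_splits)
  qed
  ultimately show ?thesis unfolding two_ranking_def by blast
qed

text \<open>Giving all vertices distinct colours is always a 2-ranking. The consequence makes the
  orders of the constructed graphs unbounded.\<close>

lemma not_colourable_imp_card_gt:
  assumes "strict_elimination t n N" "\<not> colourable k n N" shows "k < n"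
proof (rule ccontr)
  assume "\<not> k < n"
  have "two_ranking n N Suc"
    using strict_elimination_adjacent_neq[OF assms(1)] unfolding two_ranking_def by blast
  moreover have "Suc ` {..<n} \<subseteq> {1..k}" using \<open>\<not> k < n\<close> by auto
  ultimately show False using assms(2) unfolding colourable_def by blast
qed

lemma not_colourable_imp_ranking_number_gt:
  assumes "strict_elimination t n N" "\<not> colourable k n N"
  shows "k < ranking_number 2 (elimination_graph n N)"
proof (rule ccontr)
  let ?G = "elimination_graph n N"
  assume le: "\<not> k < ranking_number 2 ?G"
  have "\<exists>k. \<exists>\<phi>. is_ranking 2 ?G \<phi> \<and> \<phi> ` pverts ?G \<subseteq> {1..k}"
  proof (intro exI conjI)
    show "is_ranking 2 ?G Suc"
      unfolding is_ranking_def
    proof (intro allI impI disjI1, elim conjE)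
      fix us :: "nat list" assume us: "vpath us (with_proj ?G)" "1 \<le> vwalk_length us"
      then have "distinct us" by (simp add: vpath_def)
      moreover obtain a b bs where "us = a # b # bs"
        using us(2) by (cases us; cases "tl us") auto
      ultimately show "Suc (hd us) \<noteq> Suc (last us)" by auto
    qed
    show "Suc ` pverts ?G \<subseteq> {1..n}" by (auto simp: elimination_graph_def)
  qed
  then have "\<exists>\<phi>. is_ranking 2 ?G \<phi> \<and> \<phi> ` pverts ?G \<subseteq> {1..ranking_number 2 ?G}"
    unfolding ranking_number_def by (rule LeastI_ex)
  then obtain \<phi> where \<phi>: "is_ranking 2 ?G \<phi>" "\<phi> ` pverts ?G \<subseteq> {1..ranking_number 2 ?G}" by blast
  have "\<phi> ` {..<n} \<subseteq> {1..k}" using \<phi>(2) le by (force simp: elimination_graph_def)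
  then show False
    using is_ranking_imp_two_ranking[OF \<phi>(1) assms(1)] assms(2) unfolding colourable_def by blast
qed

section \<open>Trees given by a parent function\<close>

lemma parent_connected:
  fixes r :: nat
  assumes "r \<in> S" and step: "\<And>x. x \<in> S \<Longrightarrow> x \<noteq> r \<Longrightarrow> \<pi> x \<in> S \<and> \<pi> x < x \<and> (x, \<pi> x) \<in> R \<and> (\<pi> x, x) \<in> R"
    and "u \<in> S" "v \<in> S"
  shows "(u, v) \<in> rtrancl_on S R"
proof -
  have "(x, r) \<in> rtrancl_on S R \<and> (r, x) \<in> rtrancl_on S R" if "x \<in> S" for x
    using that
  proof (induction x rule: less_induct)
    case (less x)
    show ?case
    proof (cases "x = r")
      case False
      note st = step[OF less.prems False]
      then have "(\<pi> x, r) \<in> rtrancl_on S R" "(r, \<pi> x) \<in> rtrancl_on S R" using less.IH by auto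
      then show ?thesis using st less.prems
        by (auto intro: rtrancl_on_into_rtrancl_on converse_rtrancl_on_into_rtrancl_on)
    qed (use assms(1) in simp)
  qed
  then show ?thesis using assms(3,4) rtrancl_on_trans[of u r S R v] by simp
qed

lemma pcas_nth:
  assumes "pcas u p w" "i < length p"
  shows "p ! i = (pawalk_verts u p ! i, pawalk_verts u p ! Suc i)"
  using assms
proof (induction p arbitrary: u i)
  case (Cons e p)
  have "pawalk_verts (snd e) p ! 0 = snd e" using Cons.prems(1) by (cases p) auto
  show ?case
  proof (cases i)
    case 0
    then show ?thesis using \<open>pawalk_verts (snd e) p ! 0 = snd e\<close> by simp
  next
    case (Suc j)
    then show ?thesis using Cons.IH[of "snd e" j] Cons.prems by simp
  qed
qed simp

lemma pawalk_verts_nth_0_last: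
  assumes "pcas u p w"
  shows "length (pawalk_verts u p) = Suc (length p)" "pawalk_verts u p ! 0 = u" "pawalk_verts u p ! length p = w"
  using assms by (induction p arbitrary: u) auto

text \<open>The maximal vertex of a cycle would have two different neighbours below it.\<close>

lemma parent_tree_no_cycle:
  fixes \<pi> :: "nat \<Rightarrow> nat"
  assumes arcs: "\<And>x y. (x, y) \<in> parcs T \<Longrightarrow> x = \<pi> y \<and> x < y \<or> y = \<pi> x \<and> y < x"
    and cyc: "pre_digraph.cycle (with_proj T) p" "3 \<le> length p"
  shows False
proof -
  obtain u where u: "set p \<subseteq> parcs T" "pcas u p u" "distinct (tl (pawalk_verts u p))"
    using cyc(1) unfolding pre_digraph.cycle_def pre_digraph.awalk_def
    by (auto simp: cas_with_proj_eq awalk_verts_with_proj_eq)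
  define W where "W i = pawalk_verts u p ! i" for i
  define L where "L = length p"
  have len: "length (pawalk_verts u p) = Suc L" and W0: "W 0 = W L"
    using pawalk_verts_nth_0_last[OF u(2)] unfolding W_def L_def by auto
  have E: "(W i, W (Suc i)) \<in> parcs T" if "i < L" for i
    using pcas_nth[OF u(2), of i] that u(1) unfolding W_def L_def by (metis nth_mem subsetD)
  have inj: "i = j" if "1 \<le> i" "i \<le> L" "1 \<le> j" "j \<le> L" "W i = W j" for i j
  proof -
    have "tl (pawalk_verts u p) ! (i - 1) = tl (pawalk_verts u p) ! (j - 1)"
      using that len unfolding W_def by (simp add: nth_tl)
    then have "i - 1 = j - 1" using that len u(3) by (subst (asm) nth_eq_iff_index_eq) auto
    then show ?thesis using that by linarith
  qed
  have L3: "3 \<le> L" using cyc(2) unfolding L_def .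
  have "finite (W ` {1..L})" "W ` {1..L} \<noteq> {}" using L3 by auto
  then have "Max (W ` {1..L}) \<in> W ` {1..L}" by (rule Max_in)
  then obtain m where m: "1 \<le> m" "m \<le> L" "W m = Max (W ` {1..L})" by auto
  have Wle: "W i \<le> W m" if "i \<le> L" for i
  proof -
    have "W i \<in> W ` {1..L}" using that W0 L3 by (cases "i = 0") auto
    then show ?thesis using m(3) by simp
  qed
  have "(W (m - 1), W m) \<in> parcs T" using E[of "m - 1"] m by simp
  then have a: "W (m - 1) = \<pi> (W m)" using arcs[of "W (m - 1)" "W m"] Wle[of "m - 1"] m by fastforce
  \<comment> \<open>As \<open>W 0 = W L\<close>, only the positions from 1 to \<open>L\<close> are
    distinct. In that range \<open>i\<close> and \<open>j\<close> are the cyclic predecessor and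
    successor of \<open>m\<close>, which differ because \<open>L \<ge> 3\<close>.\<close>
  define i where "i = (if m = 1 then L else m - 1)"
  define j where "j = (if m = L then 1 else Suc m)"
  have "(W m, W j) \<in> parcs T"
    using E[of m] E[of 0] W0 L3 m unfolding j_def by (auto split: if_splits)
  moreover have jL: "1 \<le> j" "j \<le> L" using m unfolding j_def by auto
  ultimately have "W j = \<pi> (W m)" using arcs[of "W m" "W j"] Wle[of j] by fastforce
  moreover have "W i = \<pi> (W m)" using a W0 unfolding i_def by (auto split: if_splits)
  moreover have "1 \<le> i" "i \<le> L" using m L3 unfolding i_def by auto
  ultimately have "i = j" using inj[of i j] jL by simp
  then show False using m L3 unfolding i_def j_def by (auto split: if_splits)
qed

text \<open>The parent of \<open>v\<close> is the last vertex of the clique \<open>N v\<close>,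
  whose bag contains all of \<open>N v\<close>; hence the bags containing a given vertex are
  connected. A \<open>t\<close>-set \<open>S\<close> lies in the bag of its last element and
  otherwise only in bags with \<open>N x = S\<close>, of which there is at most one.\<close>

lemma strict_elimination_decomposition:
  assumes N: "strict_elimination t n N" "full_elimination t n N" and t: "1 \<le> t"
  shows "\<exists>(T :: nat pair_pre_digraph) B. simple_tree_decomposition t (elimination_graph n N) T B"
proof -
  \<comment> \<open>Vertices with empty \<open>N v\<close> are hung below 0, which joins the
    components into one tree.\<close>
  define \<pi> where "\<pi> v = (if N v = {} then 0 else Max (N v))" for v
  define T where "T = \<lparr>pverts = {..<n},
    parcs = {(x, y). x < n \<and> y < n \<and> (x = \<pi> y \<and> x < y \<or> y = \<pi> x \<and> y < x)}\<rparr>"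
  define B where "B v = insert v (N v)" for v
  let ?G = "elimination_graph n N"
  have N_lt: "N v \<subseteq> {..<v}" if "v < n" for v using strict_eliminationD(1)[OF N(1) that] .
  have finN: "finite (N v)" if "v < n" for v using N_lt[OF that] finite_subset by blast
  have \<pi>: "\<pi> v \<in> N v" if "v < n" "N v \<noteq> {}" for v
    using that finN unfolding \<pi>_def by simp
  have \<pi>_lt: "\<pi> v < v" if "v < n" "0 < v" for v
    using \<pi>[of v] N_lt[of v] that unfolding \<pi>_def by (cases "N v = {}") auto
  have edge: "(x, \<pi> x) \<in> parcs T" "(\<pi> x, x) \<in> parcs T" if "x < n" "0 < x" for x
    using \<pi>_lt[OF that] that unfolding T_def by auto
  interpret T: pair_graph T
  proof
    have "parcs T \<subseteq> {..<n} \<times> {..<n}" by (auto simp: T_def)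
    then show "finite (parcs T)" by (rule finite_subset) simp
  qed (auto simp: T_def symmetric_def sym_def)
  obtain v\<^sub>0 where v0: "v\<^sub>0 < n" "card (N v\<^sub>0) = t" using N(2) unfolding full_elimination_def by blast
  have "connected (with_proj T)"
  proof -
    have "(u, v) \<in> rtrancl_on {..<n} ((parcs T)\<^sup>s)" if "u < n" "v < n" for u v
    proof (rule parent_connected[of 0 _ \<pi>])
      fix x assume "x \<in> {..<n}" "x \<noteq> 0"
      then have "x < n" "0 < x" by auto
      then show "\<pi> x \<in> {..<n} \<and> \<pi> x < x \<and> (x, \<pi> x) \<in> (parcs T)\<^sup>s \<and> (\<pi> x, x) \<in> (parcs T)\<^sup>s"
        using edge[of x] \<pi>_lt[of x] by (auto simp: symcl_def)
    qed (use that in auto)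
    then show ?thesis using v0(1) by (auto simp: connected_conv T_def)
  qed
  moreover have arcs: "x = \<pi> y \<and> x < y \<or> y = \<pi> x \<and> y < x" if "(x, y) \<in> parcs T" for x y
    using that by (simp add: T_def)
  have "\<not> (\<exists>p. T.cycle p \<and> 3 \<le> length p)"
    using parent_tree_no_cycle[OF arcs] by blast
  ultimately have tree: "undirected_tree T" unfolding undirected_tree_def using T.pair_graph by blast
  have conn: "connected (with_proj T \<restriction> {x \<in> pverts T. v \<in> B x})" if v: "v < n" for v
  proof -
    let ?S = "{x \<in> pverts T. v \<in> B x}"
    have "(x, y) \<in> rtrancl_on ?S ((arcs_ends (with_proj T \<restriction> ?S))\<^sup>s)" if "x \<in> ?S" "y \<in> ?S" for x y
    proof (rule parent_connected[of v _ \<pi>])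
      show "v \<in> ?S" using v by (simp add: T_def B_def)
      fix x assume x: "x \<in> ?S" "x \<noteq> v"
      then have xn: "x < n" and vx: "v \<in> N x" by (auto simp: T_def B_def)
      then have x0: "0 < x" using N_lt[of x] by auto
      have "v \<le> \<pi> x" using vx finN[OF xn] unfolding \<pi>_def by auto
      moreover have "\<pi> x \<in> N x" using \<pi>[OF xn] vx by blast
      ultimately have "v \<in> B (\<pi> x)"
        using strict_eliminationD(3)[OF N(1) xn vx, of "\<pi> x"] unfolding B_def by (cases "v = \<pi> x") auto
      then have S: "\<pi> x \<in> ?S" using \<pi>_lt[OF xn x0] xn by (simp add: T_def)
      have "(x, \<pi> x) \<in> arcs_ends (with_proj T \<restriction> ?S)" "(\<pi> x, x) \<in> arcs_ends (with_proj T \<restriction> ?S)"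
        using S x edge[OF xn x0] by (force simp: arcs_ends_conv)+
      then show "\<pi> x \<in> ?S \<and> \<pi> x < x \<and> (x, \<pi> x) \<in> (arcs_ends (with_proj T \<restriction> ?S))\<^sup>s \<and>
        (\<pi> x, x) \<in> (arcs_ends (with_proj T \<restriction> ?S))\<^sup>s"
        using S \<pi>_lt[OF xn x0] by (auto simp: symcl_def)
    qed (use that in auto)
    moreover have "v \<in> ?S" using v by (simp add: T_def B_def)
    ultimately show ?thesis by (auto simp: connected_conv)
  qed
  have card_B: "card (B v) = Suc (card (N v))" if "v < n" for v
    using N_lt[OF that] finN[OF that] unfolding B_def by (subst card_insert_disjoint) auto
  have "simple_tree_decomposition t ?G T B"
    unfolding simple_tree_decomposition_def tree_decomposition_def
  proof (intro conjI ballI allI impI tree)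
    show "B x \<subseteq> pverts ?G" if "x \<in> pverts T" for x
      using that N_lt[of x] by (auto simp: T_def B_def elimination_graph_def)
    show "connected (with_proj T \<restriction> {x \<in> pverts T. v \<in> B x})" if "v \<in> pverts ?G" for v
      using conn that by (simp add: elimination_graph_def)
    show "case e of (u, v) \<Rightarrow> \<exists>x\<in>pverts T. u \<in> B x \<and> v \<in> B x" if "e \<in> parcs ?G" for e
      using that by (auto simp: elimination_graph_def adjacent_def T_def B_def)
    have "Max ((\<lambda>x. card (B x)) ` {..<n}) = Suc t"
    proof (rule Max_eqI)
      show "y \<le> Suc t" if "y \<in> (\<lambda>x. card (B x)) ` {..<n}" for y
        using that card_B strict_eliminationD(2)[OF N(1)] by auto
      show "Suc t \<in> (\<lambda>x. card (B x)) ` {..<n}" using v0 card_B by force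
    qed simp
    then show "decomposition_width T B = int t" by (simp add: decomposition_width_def T_def)
    fix S assume S: "S \<subseteq> pverts ?G \<and> card S = t"
    then have finS: "finite S" and Sn: "S \<subseteq> {..<n}" "S \<noteq> {}"
      using t finite_subset by (auto simp: elimination_graph_def)
    define s where "s = Max S"
    have s: "s \<in> S" "\<And>x. x \<in> S \<Longrightarrow> x \<le> s" using finS Sn unfolding s_def by auto
    have xS: "x = s \<or> N x = S" if x: "x < n" "S \<subseteq> B x" for x
    proof (cases "x \<in> S")
      case True
      have "s \<le> x" using s(1) x N_lt[OF x(1)] unfolding B_def by auto
      then show ?thesis using s(2)[OF True] by simp
    next
      case False
      then have "S \<subseteq> N x" using x(2) unfolding B_def by auto
      then have "S = N x" using finN[OF x(1)] strict_eliminationD(2)[OF N(1) x(1)] S by (intro card_seteq) auto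
      then show ?thesis by simp
    qed
    have c1: "card {x. x < n \<and> N x = S} \<le> Suc 0"
      using strict_elimination_inj[OF N(1)] S by (subst card_le_Suc0_iff_eq) auto
    have "{x \<in> pverts T. S \<subseteq> B x} \<subseteq> insert s {x. x < n \<and> N x = S}" using xS by (auto simp: T_def)
    then have "card {x \<in> pverts T. S \<subseteq> B x} \<le> card (insert s {x. x < n \<and> N x = S})"
      by (rule card_mono[rotated]) simp
    also have "\<dots> \<le> Suc (card {x. x < n \<and> N x = S})" by (rule card_insert_le_m1[OF zero_less_Suc, simplified]) simp
    finally show "card {x \<in> pverts T. S \<subseteq> B x} \<le> 2" using c1 by simp
  qed
  then show ?thesis by blast
qed

lemma simple_treewidth_elimination_graph_le:
  assumes "strict_elimination t n N" "full_elimination t n N" "1 \<le> t"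
  shows "simple_treewidth (elimination_graph n N) \<le> t"
  unfolding simple_treewidth_def by (rule Least_le) (rule strict_elimination_decomposition[OF assms])

section \<open>Attaching copies below every vertex\<close>

text \<open>Vertex \<open>g\<close> in the \<open>c\<close>-th copy, with \<open>M\<close> vertices, attached to the vertex \<open>x < Q\<close>; the vertices
  below \<open>Q\<close> are the old ones.\<close>

definition copy_vertex :: "nat \<Rightarrow> nat \<Rightarrow> nat \<Rightarrow> nat \<Rightarrow> nat \<Rightarrow> nat" where
  "copy_vertex Q M x c g = Q * Suc (c * M + g) + x"

definition attach :: "nat \<Rightarrow> (nat \<Rightarrow> nat set) \<Rightarrow> nat \<Rightarrow> (nat \<Rightarrow> nat set) \<Rightarrow> nat \<Rightarrow> nat set" where
  "attach Q H M G v = (if v < Q then H v else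
     let x = v mod Q; c = (v div Q - 1) div M; g = (v div Q - 1) mod M
     in insert x (copy_vertex Q M x c ` G g))"

lemma copy_vertex_inject:
  assumes "copy_vertex Q M x c g = copy_vertex Q M x' c' g'" "x < Q" "x' < Q" "g < M" "g' < M"
  shows "x = x'" "c = c'" "g = g'"
proof -
  have d: "Suc (c * M + g) * Q + x = Suc (c' * M + g') * Q + x'"
    using assms(1) by (simp add: copy_vertex_def mult.commute)
  note 1 = digit_inject[OF d assms(2,3)]
  then have "c * M + g = c' * M + g'" by simp
  note 2 = digit_inject[OF this assms(4,5)]
  show "x = x'" "c = c'" "g = g'" using 1 2 by auto
qed

lemma copy_vertex_ge: "Q \<le> copy_vertex Q M x c g"
  by (simp add: copy_vertex_def)

lemma copy_vertex_less:
  assumes "x < Q" "c \<le> k" "g < M" shows "copy_vertex Q M x c g < Q * (1 + (k + 1) * M)"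
proof -
  have "c * M + g < Suc k * M" using assms by (intro digit_less) auto
  then have "Suc (c * M + g) * Q + x < Suc (Suc k * M) * Q" using assms(1) by (intro digit_less) auto
  then show ?thesis by (simp add: copy_vertex_def mult.commute)
qed

lemma attach_copy_vertex:
  assumes "x < Q" "g < M"
  shows "attach Q H M G (copy_vertex Q M x c g) = insert x (copy_vertex Q M x c ` G g)"
proof -
  have "(y * Q + x) mod Q = x" "(y * Q + x) div Q = y" for y using assms(1) by auto
  moreover have "copy_vertex Q M x c g = Suc (c * M + g) * Q + x" by (simp only: copy_vertex_def mult.commute)
  ultimately have "copy_vertex Q M x c g mod Q = x" "copy_vertex Q M x c g div Q = Suc (c * M + g)" by metis+
  moreover have "(c * M + g) div M = c" "(c * M + g) mod M = g" using assms by auto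
  ultimately show ?thesis using copy_vertex_ge[of Q M x c g] unfolding attach_def by (simp add: Let_def)
qed

lemma attach_old: "v < Q \<Longrightarrow> attach Q H M G v = H v"
  by (simp add: attach_def)

lemma copy_vertex_cases:
  assumes "v < Q * (1 + (k + 1) * M)" "0 < M"
  obtains "v < Q" | x c g where "x < Q" "c \<le> k" "g < M" "v = copy_vertex Q M x c g"
proof (cases "v < Q")
  case False
  have Q: "0 < Q" using assms(1) by (cases Q) auto
  define j where "j = v div Q - 1"
  have "1 \<le> v div Q" using False Q by (simp add: div_greater_zero_iff Suc_le_eq)
  then have v: "v = Q * Suc j + v mod Q" unfolding j_def by simp
  have "v div Q < 1 + (k + 1) * M" using assms(1) Q by (simp add: less_mult_imp_div_less mult.commute)
  then have "j < (k + 1) * M" unfolding j_def using \<open>1 \<le> v div Q\<close> by linarith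
  then have "j div M < k + 1" by (simp add: less_mult_imp_div_less)
  moreover have "v = copy_vertex Q M (v mod Q) (j div M) (j mod M)" using v unfolding copy_vertex_def by simp
  ultimately show thesis using that(2)[of "v mod Q" "j div M" "j mod M"] Q assms(2) by simp
qed (use that in blast)

text \<open>Joining \<open>x\<close> to a whole copy enlarges each clique of the copy by one. A full
  set \<open>N v\<close> of a new vertex contains another new vertex because
  \<open>t \<ge> 1\<close>; this reveals \<open>x\<close> and the number of the copy, and uniqueness
  in \<open>G\<close> does the rest.\<close>

lemma strict_attach:
  assumes H: "strict_elimination (Suc t) Q H" and G: "strict_elimination t M G" and t: "1 \<le> t" and M: "0 < M"
  shows "strict_elimination (Suc t) (Q * (1 + (k + 1) * M)) (attach Q H M G)"
proof -
  let ?A = "attach Q H M G" and ?n = "Q * (1 + (k + 1) * M)"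
  have G_lt: "G g \<subseteq> {..<g}" if "g < M" for g using strict_eliminationD(1)[OF G that] .
  have finG: "finite (G g)" if "g < M" for g using G_lt[OF that] finite_subset by blast
  have copy_vertex_mono: "copy_vertex Q M x c g' < copy_vertex Q M x c g" if "g' < g" "x < Q" for x c g g'
    using that unfolding copy_vertex_def by simp
  have a: "?A v \<subseteq> {..<v} \<and> card (?A v) \<le> Suc t \<and> (\<forall>u\<in>?A v. \<forall>w\<in>?A v. u < w \<longrightarrow> u \<in> ?A w)" if "v < ?n" for v
    using that M
  proof (cases rule: copy_vertex_cases)
    case 1
    then have "w < Q" if "w \<in> H v" for w using strict_eliminationD(1)[OF H 1] that by auto
    then show ?thesis using strict_eliminationD[OF H 1] 1 by (auto simp: attach_old)
  next
    case (2 x c g)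
    have A: "?A v = insert x (copy_vertex Q M x c ` G g)" using attach_copy_vertex 2 by simp
    have "x < v" using 2 copy_vertex_ge[of Q M x c g] by simp
    moreover have "copy_vertex Q M x c g' < v" if "g' \<in> G g" for g' using copy_vertex_mono[of g' g x c] G_lt[OF 2(3)] that 2 by auto
    ultimately have "?A v \<subseteq> {..<v}" unfolding A by auto
    moreover have "card (?A v) \<le> Suc t"
    proof -
      have "card (?A v) \<le> Suc (card (copy_vertex Q M x c ` G g))" unfolding A by (rule card_insert_le_m1) auto
      also have "card (copy_vertex Q M x c ` G g) \<le> card (G g)" using finG[OF 2(3)] by (rule card_image_le)
      also have "card (G g) \<le> t" using strict_eliminationD(2)[OF G 2(3)] .
      finally show ?thesis by simp
    qed
    moreover have "u \<in> ?A w" if u: "u \<in> ?A v" and w: "w \<in> ?A v" and "u < w" for u w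
    proof -
      have "w \<noteq> x" using u \<open>u < w\<close> 2(1) copy_vertex_ge[of Q M x c] unfolding A by (metis imageE insertE leD less_trans less_irrefl)
      then obtain g' where g': "g' \<in> G g" "w = copy_vertex Q M x c g'" using w unfolding A by auto
      have g'M: "g' < M" using g' G_lt[OF 2(3)] 2(3) by auto
      have Aw: "?A w = insert x (copy_vertex Q M x c ` G g')" using attach_copy_vertex g' g'M 2 by simp
      show ?thesis
      proof (cases "u = x")
        case False
        then obtain g'' where g'': "g'' \<in> G g" "u = copy_vertex Q M x c g''" using u unfolding A by auto
        have "g'' < g'"
        proof (rule ccontr)
          assume "\<not> g'' < g'"
          then have "w \<le> u" unfolding g' g'' copy_vertex_def by simp
          then show False using \<open>u < w\<close> by simp
        qed
        then have "g'' \<in> G g'" using strict_eliminationD(3)[OF G 2(3) g''(1) g'(1)] by blast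
        then show ?thesis using g'' Aw by auto
      qed (simp add: Aw)
    qed
    ultimately show ?thesis by blast
  qed
  \<comment> \<open>Old vertices have old neighbours only, while a full set of a new vertex contains
    a new one.\<close>
  have old_new: False if a: "v < Q" "x < Q" "g < M" "H v = insert x (copy_vertex Q M x c ` G g)" "card (H v) = Suc t" for v x c g
  proof -
    have "G g \<noteq> {}"
    proof
      assume "G g = {}"
      then have "card (H v) = 1" using a by simp
      then show False using a(5) t by simp
    qed
    then obtain g' where "copy_vertex Q M x c g' \<in> H v" using a(4) by auto
    then show False using strict_eliminationD(1)[OF H a(1)] copy_vertex_ge[of Q M x c g'] a(1) by auto
  qed
  have b: "v = w" if v: "v < ?n" and w: "w < ?n" and eq: "?A v = ?A w" and c: "card (?A v) = Suc t" for v w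
    using v M
  proof (cases rule: copy_vertex_cases)
    case 1
    note v = this
    show ?thesis using w M
    proof (cases rule: copy_vertex_cases)
      case 1
      then show ?thesis using strict_elimination_inj[OF H v 1] eq c v by (simp add: attach_old)
    next
      case (2 x c' g)
      then have "H v = insert x (copy_vertex Q M x c' ` G g)" using eq attach_old[OF v] attach_copy_vertex[OF 2(1,3)] by simp
      then show ?thesis using old_new[OF v 2(1,3)] c attach_old[OF v] by metis
    qed
  next
    case (2 x c' g)
    note v = this
    show ?thesis using w M
    proof (cases rule: copy_vertex_cases)
      case 1
      then have "H w = insert x (copy_vertex Q M x c' ` G g)" using eq attach_old[OF 1] attach_copy_vertex[OF v(1,3)] v(4) by simp
      then show ?thesis using old_new[OF 1 v(1,3)] c eq attach_old[OF 1] by metis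
    next
      case (2 y d h)
      have A: "insert x (copy_vertex Q M x c' ` G g) = insert y (copy_vertex Q M y d ` G h)"
        using eq attach_copy_vertex v 2 by simp
      have Ac: "card (insert x (copy_vertex Q M x c' ` G g)) = Suc t" using c attach_copy_vertex v by simp
      have "card (insert x (copy_vertex Q M x c' ` G g)) \<le> Suc (card (copy_vertex Q M x c' ` G g))"
        by (rule card_insert_le_m1) auto
      moreover have "card (copy_vertex Q M x c' ` G g) \<le> card (G g)" using finG[OF v(3)] by (rule card_image_le)
      ultimately have Gt: "card (G g) = t" using Ac strict_eliminationD(2)[OF G v(3)] by linarith
      have key: "\<exists>h'\<in>G h. g' = h' \<and> x = y \<and> c' = d" if g': "g' \<in> G g" for g'
      proof -
        have "copy_vertex Q M x c' g' \<in> insert y (copy_vertex Q M y d ` G h)" using g' A by blast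
        moreover have "copy_vertex Q M x c' g' \<noteq> y" using copy_vertex_ge[of Q M x c' g'] 2(1) by auto
        ultimately obtain h' where h': "h' \<in> G h" "copy_vertex Q M x c' g' = copy_vertex Q M y d h'" by auto
        have "g' < M" "h' < M" using g' h' G_lt[OF v(3)] G_lt[OF 2(3)] v(3) 2(3) by auto
        then show ?thesis using copy_vertex_inject[OF h'(2) v(1) 2(1)] h'(1) by blast
      qed
      have key2: "h' \<in> G g" if h': "h' \<in> G h" for h'
      proof -
        have "copy_vertex Q M y d h' \<in> insert x (copy_vertex Q M x c' ` G g)" using h' A by blast
        moreover have "copy_vertex Q M y d h' \<noteq> x" using copy_vertex_ge[of Q M y d h'] v(1) by auto
        ultimately obtain g' where g': "g' \<in> G g" "copy_vertex Q M y d h' = copy_vertex Q M x c' g'" by auto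
        have "g' < M" "h' < M" using g' h' G_lt[OF v(3)] G_lt[OF 2(3)] v(3) 2(3) by auto
        then show ?thesis using copy_vertex_inject(3)[OF g'(2) 2(1) v(1)] g'(1) by blast
      qed
      have "G g \<noteq> {}" using Gt t by auto
      then have "x = y" "c' = d" using key by blast+
      moreover have "G g = G h" using key key2 by blast
      then have "g = h" using strict_elimination_inj[OF G v(3) 2(3)] Gt by simp
      ultimately show ?thesis using v 2 by simp
    qed
  qed
  show ?thesis unfolding strict_elimination_def using a b by blast
qed

lemma full_attach:
  assumes "strict_elimination t M G" "full_elimination t M G" "0 < Q"
  shows "full_elimination (Suc t) (Q * (1 + (k + 1) * M)) (attach Q H M G)"
proof -
  obtain g where g: "g < M" "card (G g) = t" using assms(2) unfolding full_elimination_def by blast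
  have G: "G g \<subseteq> {..<g}" using strict_eliminationD(1)[OF assms(1) g(1)] .
  have "inj_on (copy_vertex Q M 0 0) (G g)"
    using copy_vertex_inject(3)[of Q M 0 0 _ 0 0] G g(1) assms(3) by (intro inj_onI) (meson lessThan_iff less_trans subsetD)
  then have "card (copy_vertex Q M 0 0 ` G g) = t" using g(2) by (simp add: card_image)
  moreover have "0 \<notin> copy_vertex Q M 0 0 ` G g" using assms(3) by (auto simp: copy_vertex_def)
  moreover have "finite (G g)" using G finite_subset by blast
  ultimately have "card (attach Q H M G (copy_vertex Q M 0 0 g)) = Suc t"
    using attach_copy_vertex[OF assms(3) g(1)] by simp
  then show ?thesis unfolding full_elimination_def using copy_vertex_less[OF assms(3) _ g(1), of 0 k] by auto
qed

text \<open>Among \<open>k + 1\<close> copies below \<open>x\<close>, one is coloured entirely below the colour of \<open>x\<close>: larger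
  colours cannot repeat in the neighbourhood of \<open>x\<close>.\<close>

lemma attach_colour_drop:
  assumes \<phi>: "two_ranking (Q * (1 + (k + 1) * M)) (attach Q H M G) \<phi>"
    "\<phi> ` {..<Q * (1 + (k + 1) * M)} \<subseteq> {1..k}"
    and G: "strict_elimination t M G" and d: "\<not> colourable d M G" and x: "x < Q"
  shows "\<exists>y < Q * (1 + (k + 1) * M). \<phi> y + Suc d \<le> \<phi> x"
proof -
  let ?A = "attach Q H M G" and ?n = "Q * (1 + (k + 1) * M)"
  have xn: "x < ?n" using x by (simp add: trans_less_add1)
  have col: "1 \<le> \<phi> v \<and> \<phi> v \<le> k" if "v < ?n" for v using \<phi>(2) that by force
  have adj: "adjacent ?A (copy_vertex Q M x c g) x" if "g < M" for c g
    using attach_copy_vertex[OF x that] by (simp add: adjacent_def)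
  have cn: "copy_vertex Q M x c g < ?n" if "c \<le> k" "g < M" for c g using copy_vertex_less[OF x that] .
  have "\<exists>c\<le>k. \<forall>g<M. \<phi> (copy_vertex Q M x c g) < \<phi> x"
  proof (rule ccontr)
    assume "\<not> ?thesis"
    then have "\<forall>c\<in>{..k}. \<exists>g<M. \<not> \<phi> (copy_vertex Q M x c g) < \<phi> x" by auto
    then obtain f where f: "\<And>c. c \<le> k \<Longrightarrow> f c < M" "\<And>c. c \<le> k \<Longrightarrow> \<not> \<phi> (copy_vertex Q M x c (f c)) < \<phi> x"
      by (metis atMost_iff)
    have "inj_on (\<lambda>c. \<phi> (copy_vertex Q M x c (f c))) {..k}"
    proof (rule inj_onI, rule ccontr)
      fix c c' assume c: "c \<in> {..k}" "c' \<in> {..k}" "\<phi> (copy_vertex Q M x c (f c)) = \<phi> (copy_vertex Q M x c' (f c'))" "c \<noteq> c'"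
      let ?u = "copy_vertex Q M x c (f c)" and ?v = "copy_vertex Q M x c' (f c')"
      have "?u \<noteq> ?v" using copy_vertex_inject(2)[OF _ x x f(1) f(1)] c by auto
      moreover have "adjacent ?A ?u x" using adj f(1) c(1) by simp
      moreover have "adjacent ?A x ?v" using adj f(1) c(2) by (subst adjacent_commute) simp
      moreover have "?u < ?n" "?v < ?n" using cn f(1) c by auto
      ultimately have "\<phi> ?u < \<phi> x" using \<phi>(1) xn c(3) unfolding two_ranking_def by blast
      then show False using f(2) c(1) by simp
    qed
    moreover have "(\<lambda>c. \<phi> (copy_vertex Q M x c (f c))) ` {..k} \<subseteq> {1..k}" using col cn f(1) by auto
    ultimately have "card {..k} \<le> card {1..k}" by (intro card_inj_on_le) auto
    then show False by simp
  qed
  then obtain c where c: "c \<le> k" "\<And>g. g < M \<Longrightarrow> \<phi> (copy_vertex Q M x c g) < \<phi> x" by blast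
  show ?thesis
  proof (rule ccontr)
    assume neg: "\<not> ?thesis"
    have big: "\<phi> x < \<phi> (copy_vertex Q M x c g) + Suc d" if "g < M" for g
      using neg cn[OF c(1) that] not_less by blast
    \<comment> \<open>If no colour dropped by \<open>Suc d\<close>, the copy would use only colours
      strictly between \<open>s\<close> and \<open>\<phi> x\<close>; shifting by \<open>s\<close>
      would rank it with \<open>d\<close> colours. If the subtraction truncates to 0, positivity of
      the colours provides the lower end.\<close>
    define s where "s = \<phi> x - Suc d"
    define \<psi> where "\<psi> g = \<phi> (copy_vertex Q M x c g) - s" for g
    have gt: "s < \<phi> (copy_vertex Q M x c g)" if "g < M" for g
      using big[OF that] col[OF cn[OF c(1) that]] unfolding s_def by linarith
    have "\<psi> ` {..<M} \<subseteq> {1..d}"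
    proof
      fix y assume "y \<in> \<psi> ` {..<M}"
      then obtain g where g: "g < M" "y = \<psi> g" by auto
      have "\<phi> x \<le> s + Suc d" unfolding s_def by simp
      then show "y \<in> {1..d}" using gt[OF g(1)] c(2)[OF g(1)] unfolding g(2) \<psi>_def by auto
    qed
    moreover have "two_ranking M G \<psi>"
    proof -
      have ad: "adjacent ?A (copy_vertex Q M x c g) (copy_vertex Q M x c g')" if "adjacent G g g'" "g < M" "g' < M" for g g'
        using that attach_copy_vertex[OF x, of _ M H G c] unfolding adjacent_def by auto
      have 1: "\<psi> g \<noteq> \<psi> g'" if "g < M" "g' < M" "adjacent G g g'" for g g'
      proof -
        have "\<phi> (copy_vertex Q M x c g) \<noteq> \<phi> (copy_vertex Q M x c g')"
          using \<phi>(1) ad[OF that(3,1,2)] cn[OF c(1)] that(1,2) unfolding two_ranking_def by blast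
        then show ?thesis using gt[OF that(1)] gt[OF that(2)] unfolding \<psi>_def by linarith
      qed
      have 2: "\<psi> g < \<psi> z" if "g < M" "z < M" "g' < M" "adjacent G g z" "adjacent G z g'" "g \<noteq> g'" "\<psi> g = \<psi> g'" for g z g'
      proof -
        have "\<phi> (copy_vertex Q M x c g) = \<phi> (copy_vertex Q M x c g')"
          using that(7) gt[OF that(1)] gt[OF that(3)] unfolding \<psi>_def by linarith
        moreover have "copy_vertex Q M x c g \<noteq> copy_vertex Q M x c g'"
          using copy_vertex_inject(3)[OF _ x x that(1,3)] that(6) by blast
        ultimately have "\<phi> (copy_vertex Q M x c g) < \<phi> (copy_vertex Q M x c z)"
          using \<phi>(1) ad[OF that(4,1,2)] ad[OF that(5,2,3)] cn[OF c(1)] that(1-3)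
          unfolding two_ranking_def by blast
        then show ?thesis using gt[OF that(1)] gt[OF that(2)] unfolding \<psi>_def by linarith
      qed
      show ?thesis unfolding two_ranking_def using 1 2 by blast
    qed
    ultimately show False using d unfolding colourable_def by blast
  qed
qed

text \<open>Which vertex has a small colour depends on the colouring, so each round attaches copies
  below all vertices. At the vertex found in the previous rounds \<open>attach_colour_drop\<close>
  then gains another \<open>Suc d\<close>.\<close>

lemma attach_iterated:
  assumes G: "strict_elimination t M G" "full_elimination t M G" and d: "\<not> colourable d M G"
    and t: "1 \<le> t"
  shows "\<exists>N. strict_elimination (Suc t) ((1 + (k + 1) * M) ^ j) N \<and>
    (0 < j \<longrightarrow> full_elimination (Suc t) ((1 + (k + 1) * M) ^ j) N) \<and>
    (\<forall>\<phi>. two_ranking ((1 + (k + 1) * M) ^ j) N \<phi> \<and> \<phi> ` {..<(1 + (k + 1) * M) ^ j} \<subseteq> {1..k} \<longrightarrow>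
      (\<exists>y < (1 + (k + 1) * M) ^ j. \<phi> y + j * Suc d \<le> k))"
proof (induction j)
  case 0
  \<comment> \<open>The start is a single vertex, whose bag is too small to be full; fullness comes
    with the first round.\<close>
  have "strict_elimination (Suc t) 1 (\<lambda>_. {})" by (simp add: strict_elimination_def)
  then show ?case by (intro exI[of _ "\<lambda>_. {}"]) auto
next
  case (Suc j)
  define q where "q = 1 + (k + 1) * M"
  have M: "0 < M" using G(2) unfolding full_elimination_def by auto
  obtain H where H: "strict_elimination (Suc t) (q ^ j) H"
    "\<And>\<phi>. two_ranking (q ^ j) H \<phi> \<Longrightarrow> \<phi> ` {..<q ^ j} \<subseteq> {1..k} \<Longrightarrow> \<exists>y<q ^ j. \<phi> y + j * Suc d \<le> k"
    using Suc unfolding q_def by blast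
  let ?N = "attach (q ^ j) H M G"
  have qj: "q ^ Suc j = q ^ j * (1 + (k + 1) * M)" by (simp add: q_def mult.commute)
  have "0 < q ^ j" by (simp add: q_def)
  have "\<exists>y<q ^ Suc j. \<phi> y + Suc j * Suc d \<le> k"
    if \<phi>: "two_ranking (q ^ Suc j) ?N \<phi>" "\<phi> ` {..<q ^ Suc j} \<subseteq> {1..k}" for \<phi>
  proof -
    have le: "q ^ j \<le> q ^ Suc j" unfolding qj by simp
    have ad: "adjacent ?N u v" if "adjacent H u v" "u < q ^ j" "v < q ^ j" for u v
      using that by (simp add: adjacent_def attach_old)
    have 1: "two_ranking (q ^ j) H \<phi>"
      unfolding two_ranking_def
    proof (intro conjI allI impI, goal_cases)
      case (1 u v)
      then have "u < q ^ Suc j" "v < q ^ Suc j" using le by linarith+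
      then show ?case using \<phi>(1) ad[OF 1(3,1,2)] unfolding two_ranking_def by blast
    next
      case (2 u x v)
      then have "u < q ^ Suc j" "x < q ^ Suc j" "v < q ^ Suc j" using le by linarith+
      moreover have "adjacent ?N u x" "adjacent ?N x v" using ad 2 by blast+
      ultimately show ?case using \<phi>(1) 2(4) unfolding two_ranking_def by blast
    qed
    have "{..<q ^ j} \<subseteq> {..<q ^ Suc j}" using le by (simp only: lessThan_subset_iff)
    then have 2: "\<phi> ` {..<q ^ j} \<subseteq> {1..k}" by (rule order_trans[OF image_mono \<phi>(2)])
    obtain y where y: "y < q ^ j" "\<phi> y + j * Suc d \<le> k" using H(2)[OF 1 2] by blast
    obtain z where z: "z < q ^ Suc j" "\<phi> z + Suc d \<le> \<phi> y"
      using attach_colour_drop[OF \<phi>[unfolded qj] G(1) d y(1)] unfolding qj by blast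
    have "\<phi> z + Suc j * Suc d \<le> k" using y(2) z(2) unfolding mult_Suc by linarith
    then show ?thesis using z(1) by blast
  qed
  moreover have "strict_elimination (Suc t) (q ^ Suc j) ?N"
    unfolding qj by (rule strict_attach[OF H(1) G(1) t M])
  moreover have "full_elimination (Suc t) (q ^ Suc j) ?N"
    unfolding qj by (rule full_attach[OF G \<open>0 < q ^ j\<close>])
  ultimately show ?case unfolding q_def by blast
qed

lemma attach_iterated_not_colourable:
  assumes "strict_elimination t M G" "full_elimination t M G" "\<not> colourable d M G" "1 \<le> t"
    "0 < j" "k \<le> j * Suc d"
  shows "\<exists>N. strict_elimination (Suc t) ((1 + (k + 1) * M) ^ j) N \<and>
    full_elimination (Suc t) ((1 + (k + 1) * M) ^ j) N \<and> \<not> colourable k ((1 + (k + 1) * M) ^ j) N"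
proof -
  define n where "n = (1 + (k + 1) * M) ^ j"
  obtain N where N: "strict_elimination (Suc t) n N" "full_elimination (Suc t) n N"
    "\<And>\<phi>. two_ranking n N \<phi> \<Longrightarrow> \<phi> ` {..<n} \<subseteq> {1..k} \<Longrightarrow> \<exists>y<n. \<phi> y + j * Suc d \<le> k"
    using attach_iterated[OF assms(1-4), of k j] assms(5) unfolding n_def by blast
  have "\<not> colourable k n N"
  proof
    assume "colourable k n N"
    then obtain \<phi> where \<phi>: "two_ranking n N \<phi>" "\<phi> ` {..<n} \<subseteq> {1..k}" unfolding colourable_def by blast
    then obtain y where y: "y < n" "\<phi> y + j * Suc d \<le> k" using N(3) by blast
    then have "1 \<le> \<phi> y" using \<phi>(2) by force
    then show False using y(2) assms(6) by linarith
  qed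
  then show ?thesis using N unfolding n_def by blast
qed

section \<open>The lower bound\<close>

text \<open>Each further \<open>ln\<close> preserves the order once its argument is positive, which
  the growth of the inner iterate ensures from some point on.\<close>

lemma eventually_iterated_ln_mono:
  "\<forall>\<^sub>F x in at_top. \<forall>y\<ge>x. ((ln :: real \<Rightarrow> real) ^^ t) x \<le> (ln ^^ t) y"
proof (induction t)
  case (Suc t)
  have "\<forall>\<^sub>F x in at_top. 1 \<le> ((ln :: real \<Rightarrow> real) ^^ t) x"
    using filterlim_iterated_ln[of t] by (simp add: filterlim_at_top)
  with Suc show ?case
  proof eventually_elim
    case (elim x)
    show ?case
    proof (intro allI impI)
      fix y assume "x \<le> y"
      then have "((ln :: real \<Rightarrow> real) ^^ t) x \<le> (ln ^^ t) y" using elim by blast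
      then have "ln (((ln :: real \<Rightarrow> real) ^^ t) x) \<le> ln ((ln ^^ t) y)" using elim by simp
      then show "((ln :: real \<Rightarrow> real) ^^ Suc t) x \<le> (ln ^^ Suc t) y" by simp
    qed
  qed
qed simp

lemma iterated_ln_Suc: "((ln :: real \<Rightarrow> real) ^^ Suc t) x = (ln ^^ t) (ln x)"
  by (simp add: funpow_swap1)

text \<open>The copies are single edges, used only as not colourable with \<open>d = 0\<close>
  colours. A round then lowers the colour by one, so \<open>k\<close> rounds are needed, each
  multiplying the order by \<open>2 * k + 3 \<le> k * k\<close>.\<close>

lemma lower_bound_base:
  assumes "3 \<le> k"
  shows "\<exists>n N. strict_elimination 2 n N \<and> full_elimination 2 n N \<and> \<not> colourable k n N \<and>
    ln (real n) \<le> 2 * real k * ln (real k)"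
proof -
  define G :: "nat \<Rightarrow> nat set" where "G v = (if v = 1 then {0} else {})" for v
  have "strict_elimination 1 2 G" by (auto simp: strict_elimination_def G_def less_2_cases_iff)
  moreover have "full_elimination 1 2 G" unfolding full_elimination_def G_def by (intro exI[of _ 1]) simp
  moreover have "\<not> colourable 0 2 G" by (auto simp: colourable_def lessThan_empty_iff)
  ultimately obtain N where N: "strict_elimination (Suc 1) ((1 + (k + 1) * 2) ^ k) N"
    "full_elimination (Suc 1) ((1 + (k + 1) * 2) ^ k) N" "\<not> colourable k ((1 + (k + 1) * 2) ^ k) N"
    using attach_iterated_not_colourable[of 1 2 G 0 k k] assms by auto
  have "1 + (k + 1) * 2 \<le> k * k" 
  proof -
    have "1 + (k + 1) * 2 = 2 * k + 3" by simp
    then show ?thesis using mult_le_mono1[OF assms, of k] assms by linarith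
  qed
  then have "real (1 + (k + 1) * 2) \<le> real k ^ 2" by (metis of_nat_le_iff of_nat_power power2_eq_square)
  then have "ln (real (1 + (k + 1) * 2)) \<le> ln (real k ^ 2)" by (subst ln_le_cancel_iff) (use assms in auto)
  also have "\<dots> = 2 * ln (real k)" using assms by (simp add: ln_realpow)
  finally have "real k * ln (real (1 + (k + 1) * 2)) \<le> real k * (2 * ln (real k))"
    by (rule mult_left_mono) simp
  moreover have "ln (real ((1 + (k + 1) * 2) ^ k)) = real k * ln (real (1 + (k + 1) * 2))"
    unfolding of_nat_power by (rule ln_realpow)
  ultimately have "ln (real ((1 + (k + 1) * 2) ^ k)) \<le> 2 * real k * ln (real k)" by simp
  then show ?thesis using N unfolding Suc_1 by blast
qed

text \<open>In the step, about \<open>C * k * L / ln k\<close> rounds suffice, and each adds at most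
  \<open>3 * ln k\<close> to the logarithm of the order. The factor \<open>ln k\<close> cancels, and
  rounding the number of rounds up accounts for the other 3 in \<open>3 * C + 3\<close>.\<close>

lemma lower_bound:
  assumes "2 \<le> t"
  shows "\<exists>C>0. \<forall>\<^sub>F k in sequentially. \<exists>n N. strict_elimination t n N \<and> full_elimination t n N \<and>
    \<not> colourable k n N \<and> ln (real n) \<le> C * real k * (ln ^^ (t - 1)) (real k)"
  using assms
proof (induction t rule: dec_induct)
  case base
  have "\<forall>\<^sub>F k in sequentially. 3 \<le> (k::nat)" by (rule eventually_ge_at_top)
  then have "\<forall>\<^sub>F k in sequentially. \<exists>n N. strict_elimination 2 n N \<and> full_elimination 2 n N \<and>
    \<not> colourable k n N \<and> ln (real n) \<le> 2 * real k * (ln ^^ (2 - 1)) (real k)"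
    by eventually_elim (use lower_bound_base in simp)
  then show ?case by (intro exI[of _ 2]) simp
next
  case (step t)
  define P where "P C d \<longleftrightarrow> (\<exists>n N. strict_elimination t n N \<and> full_elimination t n N \<and>
    \<not> colourable d n N \<and> ln (real n) \<le> C * real d * (ln ^^ (t - 1)) (real d))" for C d
  obtain C where C: "C > 0" "\<forall>\<^sub>F d in sequentially. P C d" using step(3) unfolding P_def by blast
  have "\<forall>\<^sub>F d in sequentially. P C d \<and> (\<forall>y\<ge>real d. ((ln :: real \<Rightarrow> real) ^^ (t - 1)) (real d) \<le> (ln ^^ (t - 1)) y)"
    using C(2) eventually_compose_filterlim[OF eventually_iterated_ln_mono[of "t - 1"] filterlim_real_sequentially]
    by eventually_elim blast
  then obtain d\<^sub>0 where d0: "\<And>d. d \<ge> d\<^sub>0 \<Longrightarrow> P C d"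
    "\<And>d y. d \<ge> d\<^sub>0 \<Longrightarrow> real d \<le> y \<Longrightarrow> ((ln :: real \<Rightarrow> real) ^^ (t - 1)) (real d) \<le> (ln ^^ (t - 1)) y"
    unfolding eventually_sequentially by blast
  have t: "1 \<le> t - 1" "Suc (t - 1) = t" "1 \<le> t" using step(1) by auto
  have lim_ln: "filterlim (\<lambda>k::nat. ln (real k)) at_top sequentially"
    by (rule filterlim_compose[OF ln_at_top filterlim_real_sequentially])
  have lim_sqrt: "filterlim (\<lambda>k::nat. sqrt (ln (real k))) at_top sequentially"
    by (rule filterlim_compose[OF sqrt_at_top lim_ln])
  have ev1: "\<forall>\<^sub>F k in sequentially. ((ln :: real \<Rightarrow> real) ^^ (t - 1)) (ln (real k)) \<le> ln (ln (real k))"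
    using eventually_compose_filterlim[OF eventually_iterated_ln_le[OF t(1)] lim_ln] .
  have ev2: "\<forall>\<^sub>F k in sequentially. max 1 (1 / C) \<le> ((ln :: real \<Rightarrow> real) ^^ (t - 1)) (ln (real k))"
    using eventually_compose_filterlim[OF filterlim_iterated_ln[of "t - 1", unfolded filterlim_at_top, rule_format, of "max 1 (1 / C)"] lim_ln] .
  \<comment> \<open>Together with \<open>L \<le> 2 * sqrt y\<close> this pushes the \<open>d\<close>
    chosen below beyond \<open>d\<^sub>0\<close>, where the induction hypothesis is
    available.\<close>
  have ev3: "\<forall>\<^sub>F k in sequentially. (real d\<^sub>0 + 1) * (2 * C) + 1 \<le> sqrt (ln (real k))"
    using lim_sqrt by (simp add: filterlim_at_top)
  have ev4: "\<forall>\<^sub>F k in sequentially. 2 \<le> (k::nat)" by (rule eventually_ge_at_top)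
  have "\<forall>\<^sub>F k in sequentially. \<exists>n N. strict_elimination (Suc t) n N \<and> full_elimination (Suc t) n N \<and>
    \<not> colourable k n N \<and> ln (real n) \<le> (3 * C + 3) * real k * (ln ^^ (Suc t - 1)) (real k)"
    using ev1 ev2 ev3 ev4
  proof eventually_elim
    case (elim k)
    define y where "y = ln (real k)"
    define L where "L = ((ln :: real \<Rightarrow> real) ^^ (t - 1)) y"
    have L_eq: "((ln :: real \<Rightarrow> real) ^^ (Suc t - 1)) (real k) = L"
      using iterated_ln_Suc[of "t - 1" "real k"] t unfolding L_def y_def by simp
    have L: "1 \<le> L" "1 / C \<le> L" "L \<le> ln y" using elim unfolding L_def y_def by auto
    then have CL: "1 \<le> C * L" using C(1) by (simp add: field_simps)
    have sq: "(real d\<^sub>0 + 1) * (2 * C) + 1 \<le> sqrt y" using elim unfolding y_def by simp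
    have "0 \<le> (real d\<^sub>0 + 1) * (2 * C)" using C(1) by simp
    then have "0 < sqrt y" using sq by linarith
    then have y0: "0 < y" by simp
    have "L \<le> 2 * sqrt y" using L(3) ln_le_sqrt[OF y0] by linarith
    then have "(real d\<^sub>0 + 1) * (C * L) \<le> (real d\<^sub>0 + 1) * (C * (2 * sqrt y))"
      using C(1) by (intro mult_left_mono) auto
    also have "\<dots> = ((real d\<^sub>0 + 1) * (2 * C)) * sqrt y" by simp
    also have "\<dots> \<le> sqrt y * sqrt y" using sq y0 by (intro mult_right_mono) auto
    also have "\<dots> = y" using y0 by simp
    finally have "real d\<^sub>0 + 1 \<le> y / (C * L)" using CL by (simp add: le_divide_eq)
    \<comment> \<open>The largest number with \<open>C * d * L \<le> ln k\<close>: the graph for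
      \<open>d\<close> then has at most \<open>k\<close> vertices, and attaching
      \<open>k + 1\<close> copies multiplies the order by at most \<open>k ^ 3\<close>.\<close>
    define d where "d = nat \<lfloor>y / (C * L)\<rfloor>"
    have dge: "d\<^sub>0 \<le> d" using \<open>real d\<^sub>0 + 1 \<le> y / (C * L)\<close> unfolding d_def by linarith
    have "0 \<le> y / (C * L)" using y0 CL by simp
    then have d: "real d \<le> y / (C * L)" "y / (C * L) \<le> real d + 1" unfolding d_def by linarith+
    have "y / (C * L) \<le> y" using y0 CL mult_left_mono[OF CL, of y] by (simp add: divide_le_eq)
    then have "real d \<le> y" using d(1) by linarith
    then have mono: "((ln :: real \<Rightarrow> real) ^^ (t - 1)) (real d) \<le> L" unfolding L_def using d0(2)[OF dge] by blast
    obtain M G where G: "strict_elimination t M G" "full_elimination t M G" "\<not> colourable d M G"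
      "ln (real M) \<le> C * real d * (ln ^^ (t - 1)) (real d)"
      using d0(1)[OF dge] unfolding P_def by blast
    have M0: "0 < M" using G(2) unfolding full_elimination_def by auto
    have "C * real d * (ln ^^ (t - 1)) (real d) \<le> C * real d * L" using C(1) mono by (intro mult_left_mono) auto
    also have "\<dots> = real d * (C * L)" by simp
    also have "\<dots> \<le> y" using d(1) CL by (simp add: le_divide_eq)
    finally have "ln (real M) \<le> ln (real k)" using G(4) unfolding y_def by linarith
    then have Mk: "M \<le> k" using M0 elim(4) by simp
    define q where "q = 1 + (k + 1) * M"
    have "q \<le> 1 + (k + 1) * k" unfolding q_def using mult_le_mono2[OF Mk, of "k + 1"] by linarith
    also have "\<dots> \<le> k * k * k"
    proof -
      have "2 * (k * k) \<le> k * (k * k)" using elim(4) by (rule mult_le_mono1)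
      moreover have "2 * k \<le> k * k" using elim(4) by (rule mult_le_mono1)
      moreover have "1 + (k + 1) * k = 1 + k + k * k" "k * k * k = k * (k * k)" by (simp_all add: algebra_simps)
      ultimately show ?thesis using elim(4) by linarith
    qed
    finally have "real q \<le> real (k * k * k)" by (simp only: of_nat_le_iff)
    then have "real q \<le> real k ^ 3" by (simp add: power3_eq_cube)
    moreover have "0 < q" unfolding q_def by simp
    ultimately have "ln (real q) \<le> ln (real k ^ 3)" by (subst ln_le_cancel_iff) (use elim(4) in auto)
    also have "\<dots> = 3 * y" using elim(4) unfolding y_def by (simp add: ln_realpow)
    finally have lnq: "ln (real q) \<le> 3 * y" .
    have lnq0: "0 \<le> ln (real q)" unfolding q_def by simp
    define j where "j = nat \<lceil>real k / (real d + 1)\<rceil>"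
    have pos: "0 < real k / (real d + 1)" using elim(4) by simp
    have j: "real k / (real d + 1) \<le> real j" "real j \<le> real k / (real d + 1) + 1"
      using pos unfolding j_def by linarith+
    have j0: "0 < j" using j(1) pos by (metis gr0I leD of_nat_0)
    have "real k \<le> real j * (real d + 1)" using j(1) by (simp add: divide_le_eq)
    also have "\<dots> = real (j * Suc d)" by (simp add: algebra_simps)
    finally have kj: "k \<le> j * Suc d" by (simp only: of_nat_le_iff)
    obtain N where N: "strict_elimination (Suc t) (q ^ j) N" "full_elimination (Suc t) (q ^ j) N" "\<not> colourable k (q ^ j) N"
      using attach_iterated_not_colourable[OF G(1-3) t(3) j0 kj] unfolding q_def by blast
    have "real k / (real d + 1) \<le> real k / (y / (C * L))"
      using d(2) y0 CL by (intro divide_left_mono) auto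
    then have "real j \<le> real k * (C * L) / y + 1" using j(2) by simp
    then have "real j * ln (real q) \<le> (real k * (C * L) / y + 1) * (3 * y)"
      using lnq lnq0 y0 CL by (intro mult_mono) auto
    also have "\<dots> = 3 * C * (real k * L) + 3 * y" using y0 by (simp add: field_simps)
    also have "\<dots> \<le> 3 * C * (real k * L) + 3 * (real k * L)"
    proof -
      have "y \<le> real k" using ln_le_minus_one[of "real k"] elim(4) unfolding y_def by simp
      also have "real k \<le> real k * L" using mult_left_mono[OF L(1), of "real k"] by simp
      finally show ?thesis by simp
    qed
    also have "\<dots> = (3 * C + 3) * real k * L" by (simp add: algebra_simps)
    finally have "real j * ln (real q) \<le> (3 * C + 3) * real k * L" .
    moreover have "ln (real (q ^ j)) = real j * ln (real q)"
      unfolding of_nat_power by (rule ln_realpow)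
    ultimately show ?case using N unfolding L_eq by metis
  qed
  moreover have "0 < 3 * C + 3" using C(1) by simp
  ultimately show ?case by blast
qed

section \<open>Graphs of simple treewidth exactly \<open>t\<close>\<close>

lemma simple_treewidth_pos:
  assumes "pair_graph G" "(u, v) \<in> parcs G" shows "1 \<le> simple_treewidth G"
proof (rule ccontr)
  interpret pair_graph G by fact
  assume "\<not> 1 \<le> simple_treewidth G"
  then have z: "simple_treewidth G = 0" by simp
  have V: "u \<in> pverts G" "v \<in> pverts G" using assms(2) in_arcsD1 in_arcsD2 by auto
  then obtain N e where N: "elimination (pverts G) N e" "simple_elimination 0 (pverts G) N"
    "\<forall>(u, v)\<in>parcs G. adjacent N u v"
    using simple_treewidth_elimination[OF assms(1)] unfolding z by blast
  interpret elimination "pverts G" N e by fact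
  have "N w = {}" if "w \<in> pverts G" for w
  proof -
    have "card (N w) = 0" using N(2) that unfolding simple_elimination_def by simp
    then show ?thesis using finite_subset[OF N_subset[OF that] finite_V] by simp
  qed
  then show False using N(3) assms(2) V unfolding adjacent_def by auto
qed

text \<open>For \<open>t = 1\<close> the quotient of logarithms is 1, so the need for one colour is
  enough. The single edge makes the simple treewidth positive, and isolated vertices supply every
  order.\<close>

lemma lower_bound_linear:
  "infinite {n :: nat. \<exists>H :: nat pair_pre_digraph.
     pair_graph H \<and> card (pverts H) = n \<and> simple_treewidth H = 1 \<and>
     real (ranking_number 2 H) \<ge> 1 * (ln (real n) / (ln ^^ 1) (real n))}" (is "infinite ?A")
proof -
  have "n \<in> ?A" if n: "2 \<le> n" for n
  proof -
    define N :: "nat \<Rightarrow> nat set" where "N v = (if v = 1 then {0} else {})" for v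
    let ?H = "elimination_graph n N"
    have s: "strict_elimination 1 n N" unfolding strict_elimination_def N_def by auto
    have f: "full_elimination 1 n N" unfolding full_elimination_def N_def using n by (intro exI[of _ 1]) simp
    have "(0, 1) \<in> parcs ?H" using n by (simp add: elimination_graph_def adjacent_def N_def)
    then have "simple_treewidth ?H = 1"
      using simple_treewidth_pos[OF pair_graph_elimination_graph[OF s]]
        simple_treewidth_elimination_graph_le[OF s f] by (metis le_antisym le_refl)
    moreover have "\<not> colourable 0 n N" using n by (auto simp: colourable_def lessThan_empty_iff)
    then have "0 < ranking_number 2 ?H" using not_colourable_imp_ranking_number_gt[OF s] by blast
    moreover have "ln (real n) / (ln ^^ 1) (real n) = 1" using n by simp
    moreover have "card (pverts ?H) = n" by (simp add: elimination_graph_def)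
    ultimately show ?thesis using pair_graph_elimination_graph[OF s]
      by (intro CollectI exI[of _ ?H]) simp
  qed
  then have "{2..} \<subseteq> ?A" by auto
  then show ?thesis using infinite_super infinite_Ici by blast
qed

lemma lower_bound_ge_2:
  assumes t: "2 \<le> t"
  shows "\<exists>c :: real. 0 < c \<and> infinite {n :: nat. \<exists>H :: nat pair_pre_digraph.
     pair_graph H \<and> card (pverts H) = n \<and> simple_treewidth H = t \<and>
     real (ranking_number 2 H) \<ge> c * (ln (real n) / (ln ^^ t) (real n))}"
proof -
  have t1: "1 \<le> t - 1" "Suc (t - 1) = t" "1 \<le> t" using t by auto
  obtain C where C: "C > 0" "\<forall>\<^sub>F k in sequentially. \<exists>n N. strict_elimination t n N \<and> full_elimination t n N \<and>
    \<not> colourable k n N \<and> ln (real n) \<le> C * real k * (ln ^^ (t - 1)) (real k)"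
    using lower_bound[OF t] by blast
  obtain D n\<^sub>0 where D: "D > 0" "\<And>H :: nat pair_pre_digraph. n\<^sub>0 \<le> card (pverts H) \<Longrightarrow> pair_graph H \<Longrightarrow>
    simple_treewidth H \<le> t - 1 \<Longrightarrow> real (ranking_number 2 H) \<le>
      D * (ln (real (card (pverts H))) / (ln ^^ (t - 1)) (real (card (pverts H))))"
    using ranking_number_upper_bound[OF t1(1), of 2] by blast
  \<comment> \<open>\<open>K\<close> collects the constants of both bounds. A simple treewidth of at
    most \<open>t - 1\<close> would give \<open>a < K * ln a\<close> for
    \<open>a = (ln ^^ (t - 1)) (real n)\<close>, which \<open>ln a \<le> 2 * sqrt a\<close> refutes
    once \<open>a > 4 * K\<^sup>2\<close>.\<close>
  define K where "K = (2 * C + 1) * D"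
  define c where "c = 1 / (2 * C + 1)"
  have K0: "0 < K" using C(1) D(1) unfolding K_def by simp
  have lim: "filterlim (\<lambda>k::nat. sqrt (real k)) at_top sequentially"
    by (rule filterlim_compose[OF sqrt_at_top filterlim_real_sequentially])
  have "\<forall>\<^sub>F x in at_top. 4 * K\<^sup>2 < ((ln :: real \<Rightarrow> real) ^^ (t - 1)) x \<and> 1 \<le> (ln ^^ t) x \<and> 1 < x"
    using filterlim_iterated_ln[of "t - 1", unfolded filterlim_at_top_dense, rule_format, of "4 * K\<^sup>2"]
      filterlim_iterated_ln[of t, unfolded filterlim_at_top, rule_format, of 1] eventually_gt_at_top[of 1]
    by eventually_elim auto
  then obtain m\<^sub>0 where m0: "\<And>x. m\<^sub>0 \<le> x \<Longrightarrow> 4 * K\<^sup>2 < ((ln :: real \<Rightarrow> real) ^^ (t - 1)) x \<and> 1 \<le> (ln ^^ t) x \<and> 1 < x"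
    unfolding eventually_at_top_linorder by blast
  have "\<forall>\<^sub>F k in sequentially. \<exists>n>k. \<exists>H :: nat pair_pre_digraph.
     pair_graph H \<and> card (pverts H) = n \<and> simple_treewidth H = t \<and>
     real (ranking_number 2 H) \<ge> c * (ln (real n) / (ln ^^ t) (real n))"
    using C(2) eventually_ge_at_top[of "max n\<^sub>0 (nat \<lceil>m\<^sub>0\<rceil>)"]
      eventually_compose_filterlim[OF eventually_iterated_ln_sqrt[OF t1(1)] filterlim_real_sequentially]
      eventually_compose_filterlim[OF eventually_iterated_ln_mono[of "t - 1"] lim]
      eventually_compose_filterlim[OF filterlim_iterated_ln[of "t - 1", unfolded filterlim_at_top, rule_format, of 1] filterlim_real_sequentially]
      eventually_ge_at_top[of 1]
  proof eventually_elim
    case (elim k)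
    from elim(1) obtain n N where N: "strict_elimination t n N" "full_elimination t n N" "\<not> colourable k n N"
      and lnn: "ln (real n) \<le> C * real k * (ln ^^ (t - 1)) (real k)" by blast
    let ?H = "elimination_graph n N"
    define x where "x = ln (real n)"
    define Lk where "Lk = ((ln :: real \<Rightarrow> real) ^^ (t - 1)) (real k)"
    define b where "b = ((ln :: real \<Rightarrow> real) ^^ t) (real n)"
    define a where "a = ((ln :: real \<Rightarrow> real) ^^ (t - 1)) (real n)"
    have kn: "k < n" using not_colourable_imp_card_gt[OF N(1,3)] .
    have rn: "k < ranking_number 2 ?H" using not_colourable_imp_ranking_number_gt[OF N(1,3)] .
    have pg: "pair_graph ?H" using pair_graph_elimination_graph[OF N(1)] .
    have card: "card (pverts ?H) = n" by (simp add: elimination_graph_def)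
    have "m\<^sub>0 \<le> real n" "n\<^sub>0 \<le> n" using elim(2) kn by linarith+
    note m0' = m0[OF this(1)]
    have a: "4 * K\<^sup>2 < a" and b1: "1 \<le> b" and n1: "1 < real n" using m0' unfolding a_def b_def by auto
    have ab: "b = ln a" using t1 unfolding a_def b_def by (metis comp_apply funpow.simps(2))
    have bx: "b = (ln ^^ (t - 1)) x" using iterated_ln_Suc[of "t - 1" "real n"] t1 unfolding b_def x_def by simp
    have x0: "0 < x" using n1 unfolding x_def by simp
    have Lk1: "1 \<le> Lk" using elim(5) unfolding Lk_def .
    \<comment> \<open>The construction bounds \<open>x = ln n\<close> only from above, while
      \<open>b\<close> grows with \<open>x\<close>. For \<open>x \<ge> sqrt k\<close> the
      denominator \<open>b\<close> is at least \<open>Lk / 2\<close>; for smaller \<open>x\<close>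
      the quotient is at most \<open>sqrt k\<close> anyway.\<close>
    have xb: "x / b \<le> (2 * C + 1) * real k"
    proof (cases "sqrt (real k) \<le> x")
      case True
      have "Lk / 2 \<le> ((ln :: real \<Rightarrow> real) ^^ (t - 1)) (sqrt (real k))" using elim(3) unfolding Lk_def .
      also have "\<dots> \<le> b" unfolding bx using elim(4) True by blast
      finally have "x / b \<le> x / (Lk / 2)" using x0 Lk1 b1 by (intro divide_left_mono) auto
      also have "\<dots> \<le> (C * real k * Lk) / (Lk / 2)"
        using lnn Lk1 unfolding x_def Lk_def by (intro divide_right_mono) auto
      also have "\<dots> = 2 * C * real k" using Lk1 by simp
      also have "\<dots> \<le> (2 * C + 1) * real k" by (simp add: algebra_simps)
      finally show ?thesis .
    next
      case False
      have "x / b \<le> x / 1" using x0 b1 by (intro divide_left_mono) auto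
      also have "\<dots> \<le> sqrt (real k)" using False by simp
      also have "\<dots> \<le> real k"
        using elim(6) by (intro real_le_lsqrt) (auto simp: power2_eq_square)
      also have "\<dots> \<le> (2 * C + 1) * real k" using C(1) by (simp add: algebra_simps)
      finally show ?thesis .
    qed
    have "simple_treewidth ?H = t"
    proof (rule ccontr)
      assume ne: "simple_treewidth ?H \<noteq> t"
      have "simple_treewidth ?H \<le> t" using simple_treewidth_elimination_graph_le[OF N(1,2) t1(3)] .
      then have "simple_treewidth ?H \<le> t - 1" using ne by linarith
      then have "real (ranking_number 2 ?H) \<le> D * (x / a)"
        using D(2)[of ?H] pg \<open>n\<^sub>0 \<le> n\<close> unfolding card x_def a_def by blast
      then have "real k < D * (x / a)" using rn by linarith
      then have "(2 * C + 1) * real k < (2 * C + 1) * (D * (x / a))"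
        using C(1) by (intro mult_strict_left_mono) auto
      then have "x / b < K * (x / a)" using xb unfolding K_def by (simp only: mult.assoc)
      moreover have a0: "0 < a" using a zero_le_power2[of K] by linarith
      ultimately have "a < K * b" using x0 b1 by (simp add: field_simps)
      also have "\<dots> \<le> K * (2 * sqrt a)" using ln_le_sqrt[OF a0] K0 unfolding ab by (intro mult_left_mono) auto
      finally have "sqrt a * sqrt a < (2 * K) * sqrt a" using a0 by simp
      then have "sqrt a < 2 * K" using a0 by (simp only: mult_less_cancel_right_pos real_sqrt_gt_zero)
      moreover have "2 * K \<le> sqrt a"
      proof (rule real_le_rsqrt)
        show "(2 * K)\<^sup>2 \<le> a" using a by (simp add: power_mult_distrib)
      qed
      ultimately show False by linarith
    qed
    moreover have "c * (x / b) \<le> real (ranking_number 2 ?H)"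
    proof -
      have "c * (x / b) \<le> c * ((2 * C + 1) * real k)" using xb C(1) unfolding c_def by (intro mult_left_mono) auto
      also have "\<dots> = real k" using C(1) unfolding c_def by simp
      finally show ?thesis using rn by linarith
    qed
    ultimately show ?case using kn pg card unfolding x_def b_def by blast
  qed
  then obtain k\<^sub>0 where k0: "\<And>k. k\<^sub>0 \<le> k \<Longrightarrow> \<exists>n>k. \<exists>H :: nat pair_pre_digraph.
     pair_graph H \<and> card (pverts H) = n \<and> simple_treewidth H = t \<and>
     real (ranking_number 2 H) \<ge> c * (ln (real n) / (ln ^^ t) (real n))"
    unfolding eventually_sequentially by blast
  have "infinite {n :: nat. \<exists>H :: nat pair_pre_digraph.
     pair_graph H \<and> card (pverts H) = n \<and> simple_treewidth H = t \<and>
     real (ranking_number 2 H) \<ge> c * (ln (real n) / (ln ^^ t) (real n))}"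
    unfolding infinite_nat_iff_unbounded
  proof (intro allI)
    fix m
    obtain n where "n > max k\<^sub>0 m" "\<exists>H :: nat pair_pre_digraph.
     pair_graph H \<and> card (pverts H) = n \<and> simple_treewidth H = t \<and>
     real (ranking_number 2 H) \<ge> c * (ln (real n) / (ln ^^ t) (real n))"
      using k0[of "max k\<^sub>0 m"] by auto
    then show "\<exists>n>m. n \<in> {n :: nat. \<exists>H :: nat pair_pre_digraph.
     pair_graph H \<and> card (pverts H) = n \<and> simple_treewidth H = t \<and>
     real (ranking_number 2 H) \<ge> c * (ln (real n) / (ln ^^ t) (real n))}"
      by (intro exI[of _ n]) simp
  qed
  moreover have "0 < c" using C(1) unfolding c_def by simp
  ultimately show ?thesis by blast
qed

theorem theorem2:
  shows "(\<forall>l t :: nat. 2 \<le> l \<longrightarrow> 1 \<le> t \<longrightarrow>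
            (\<exists>C :: real. 0 < C \<and>
              (\<exists>N :: nat. \<forall>n \<ge> N. \<forall>H :: 'a pair_pre_digraph.
                 pair_graph H \<and> card (pverts H) = n \<and> simple_treewidth H \<le> t \<longrightarrow>
                 real (ranking_number l H) \<le> C * (ln (real n) / (ln ^^ t) (real n)))))
       \<and> (\<forall>t :: nat. 1 \<le> t \<longrightarrow>
            (\<exists>c :: real. 0 < c \<and>
              infinite {n :: nat. \<exists>H :: nat pair_pre_digraph.
                 pair_graph H \<and> card (pverts H) = n \<and> simple_treewidth H = t \<and>
                 real (ranking_number 2 H) \<ge> c * (ln (real n) / (ln ^^ t) (real n))}))"
proof (intro conjI allI impI)
  fix l t :: nat assume "1 \<le> t"
  then show "\<exists>C :: real. 0 < C \<and>
    (\<exists>N :: nat. \<forall>n \<ge> N. \<forall>H :: 'a pair_pre_digraph.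
       pair_graph H \<and> card (pverts H) = n \<and> simple_treewidth H \<le> t \<longrightarrow>
       real (ranking_number l H) \<le> C * (ln (real n) / (ln ^^ t) (real n)))"
    by (rule ranking_number_upper_bound)
next
  fix t :: nat assume "1 \<le> t"
  show "\<exists>c :: real. 0 < c \<and>
    infinite {n :: nat. \<exists>H :: nat pair_pre_digraph.
       pair_graph H \<and> card (pverts H) = n \<and> simple_treewidth H = t \<and>
       real (ranking_number 2 H) \<ge> c * (ln (real n) / (ln ^^ t) (real n))}"
  proof (cases "t = 1")
    case True
    show ?thesis unfolding True using lower_bound_linear by (intro exI[of _ 1] conjI) simp_all
  next
    case False
    then show ?thesis using lower_bound_ge_2 \<open>1 \<le> t\<close> by simp
  qed
qed

end
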